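(* Let $0<p\le1$ and let $\alpha,\beta$ be real numbers. Then $$(F_{\alpha p}^p)^*=F_\beta^\infty$$ with equivalent norms under the pairing $\langle\ ,\ \rangle_{\alpha+\beta}$. That is, for each $g\in F_\beta^\infty$ the functional $f\mapsto\langle f,g\rangle_{\alpha+\beta}$ is well defined and bounded on $F_{\alpha p}^p$; every bounded linear functional on $F_{\alpha p}^p$ is of this form for a unique $g\in F_\beta^\infty$; and the functional norm $\sup\{|\nu(f)|:\|f\|_{F_{\alpha p}^p}\le1\}$ is equivalent to $\|g\|_{F_\beta^\infty}$.
   Context: Fix an integer $n\ge1$. $dV$ is Lebesgue volume measure on $\mathbb{C}^n$ normalized so that $\int_{\mathbb{C}^n}e^{-|z|^2}dV(z)=1$. For $\alpha$ real and $0<p<\infty$, $F_\alpha^p$ is the space of entire functions $f$ on $\mathbb{C}^n$ with $\|f\|_{F_\alpha^p}=\left\{\int_{\mathbb{C}^n}|f(z)e^{-|z|^2/2}|^p(1+|z|)^{-\alpha}dV(z)\right\}^{1/p}<\infty$ (called a "norm" even when $p<1$). $F_\beta^\infty$ is the space of entire $g$ with $\|g\|_{F_\beta^\infty}=\sup_z\frac{|g(z)|e^{-|z|^2/2}}{(1+|z|)^\beta}<\infty$. For an entire $f$ with homogeneous expansion $f=\sum_{k\ge0}f_k$ ($f_k$ a homogeneous polynomial of degree $k$) and $s$ real, $f_s^-=\sum_{k\le|s|}f_k$ and $f_s^+=\sum_{k>|s|}f_k$. For $\sigma$ real put $(f,g)_\sigma=\int_{\mathbb{C}^n}f(z)\overline{g(z)}e^{-|z|^2}|z|^{-\sigma}dV(z)$,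 and define the pairing $\langle f,g\rangle_\sigma=(f,g)_\sigma$ if $\sigma<2n$, and $\langle f,g\rangle_\sigma=(f_{\sigma/2}^-,g_{\sigma/2}^-)_0+(f_{\sigma/2}^+,g_{\sigma/2}^+)_\sigma$ if $\sigma\ge2n$. *)

theory Defs
  imports "HOL-Complex_Analysis.Complex_Analysis" "HOL-Probability.Probability"
begin

text \<open>
  The space of $n$ complex variables is \<^typ>\<open>complex ^ 'n\<close> with $n$ = \<^term>\<open>CARD('n)\<close>;
  its \<^const>\<open>norm\<close> is the Euclidean norm.
\<close>

definition fock_volume :: "(complex ^ 'n) measure" where
  "fock_volume = density lborel (\<lambda>_. ennreal (1 / pi ^ CARD('n)))"

lemma gaussian_nn_integral: "(\<integral>\<^sup>+x. ennreal (exp (- (x::real)\<^sup>2)) \<partial>lborel) = ennreal (sqrt pi)"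
proof -
  have "has_bochner_integral lborel (\<lambda>x::real. exp (- x\<^sup>2)) (sqrt pi)"
    using has_bochner_integral_even_function[OF gaussian_moment_0] by simp
  then show ?thesis
    by (simp add: has_bochner_integral_iff nn_integral_eq_integral)
qed

lemma fock_volume_normalized:
  "(\<integral>\<^sup>+z. ennreal (exp (- (norm (z :: complex ^ 'n))\<^sup>2)) \<partial>fock_volume) = 1"
proof -
  have "ennreal (exp (- (norm z)\<^sup>2)) = (\<Prod>b\<in>Basis. ennreal (exp (- (z \<bullet> b)\<^sup>2)))"
    for z :: "complex ^ 'n"
  proof -
    have "(norm z)\<^sup>2 = (\<Sum>b\<in>Basis. (z \<bullet> b)\<^sup>2)"
      by (metis (mono_tags, lifting) euclidean_inner power2_eq_square power2_norm_eq_inner sum.cong)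
    then show ?thesis
      by (simp add: prod_ennreal exp_sum flip: sum_negf)
  qed
  then have "(\<integral>\<^sup>+z. ennreal (exp (- (norm (z :: complex ^ 'n))\<^sup>2)) \<partial>lborel)
      = (\<integral>\<^sup>+z. (\<Prod>b\<in>Basis. ennreal (exp (- ((z :: complex ^ 'n) \<bullet> b)\<^sup>2))) \<partial>lborel)"
    by simp
  also have "\<dots> = (\<Prod>b\<in>(Basis :: (complex ^ 'n) set). ennreal (sqrt pi))"
    by (subst nn_integral_lborel_prod) (simp_all add: gaussian_nn_integral)
  also have "\<dots> = ennreal (pi ^ CARD('n))"
    by (simp add: ennreal_power power_mult)
       (simp add: power2_eq_square flip: power_mult_distrib)
  finally show ?thesis
    unfolding fock_volume_def
    by (subst nn_integral_density, simp, simp, subst nn_integral_cmult, simp)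
       (simp del: ennreal_1 flip: ennreal_mult ennreal_1)
qed

text \<open>Holomorphy on the whole space: the Frechet derivative exists and is complex linear everywhere.\<close>

definition entire :: "(complex ^ 'n \<Rightarrow> complex) \<Rightarrow> bool" where
  "entire f \<longleftrightarrow>
    (\<forall>z. \<exists>f'. (f has_derivative f') (at z) \<and> (\<forall>c v. f' (c *s v) = c * f' v))"

text \<open>
  The Bochner integral has the junk value 0 for non-integrable functions, so membership
  in the space demands integrability of the (nonnegative, measurable) integrand explicitly.
\<close>

definition fock_integrand ::
    "real \<Rightarrow> real \<Rightarrow> (complex ^ 'n \<Rightarrow> complex) \<Rightarrow> complex ^ 'n \<Rightarrow> real" where
  "fock_integrand p \<alpha> f z =
    norm (f z * of_real (exp (- (norm z)\<^sup>2 / 2))) powr p * (1 + norm z) powr (- \<alpha>)"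

definition fock_space :: "real \<Rightarrow> real \<Rightarrow> (complex ^ 'n \<Rightarrow> complex) set" where
  "fock_space p \<alpha> = {f. entire f \<and> integrable fock_volume (fock_integrand p \<alpha> f)}"

definition fock_norm :: "real \<Rightarrow> real \<Rightarrow> (complex ^ 'n \<Rightarrow> complex) \<Rightarrow> real" where
  "fock_norm p \<alpha> f = (LINT z|fock_volume. fock_integrand p \<alpha> f z) powr (1 / p)"

definition fock_sup_quotient :: "real \<Rightarrow> (complex ^ 'n \<Rightarrow> complex) \<Rightarrow> complex ^ 'n \<Rightarrow> real" where
  "fock_sup_quotient \<beta> g z = norm (g z) * exp (- (norm z)\<^sup>2 / 2) / (1 + norm z) powr \<beta>"

definition fock_sup_space :: "real \<Rightarrow> (complex ^ 'n \<Rightarrow> complex) set" where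
  "fock_sup_space \<beta> = {g. entire g \<and> bdd_above (range (fock_sup_quotient \<beta> g))}"

definition fock_sup_norm :: "real \<Rightarrow> (complex ^ 'n \<Rightarrow> complex) \<Rightarrow> real" where
  "fock_sup_norm \<beta> g = (SUP z. fock_sup_quotient \<beta> g z)"

text \<open>The sum below runs over the multi-indices $m$ with $|m| = k$, a finite set.\<close>

lemma finite_multi_indices: "finite {m :: 'n::finite \<Rightarrow> nat. (\<Sum>i\<in>UNIV. m i) = k}"
proof (rule finite_subset)
  show "{m :: 'n \<Rightarrow> nat. (\<Sum>i\<in>UNIV. m i) = k} \<subseteq> (UNIV :: 'n set) \<rightarrow>\<^sub>E {..k}"
    by (auto simp: PiE_def intro: member_le_sum[of _ UNIV, simplified])
qed (auto intro: finite_PiE)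

definition homogeneous_poly :: "nat \<Rightarrow> (complex ^ 'n \<Rightarrow> complex) \<Rightarrow> bool" where
  "homogeneous_poly k q \<longleftrightarrow>
    (\<exists>c. \<forall>z. q z = (\<Sum>m\<in>{m. (\<Sum>i\<in>UNIV. m i) = k}. c m * (\<Prod>i\<in>UNIV. (z $ i) ^ m i)))"

definition homogeneous_expansion ::
    "(complex ^ 'n \<Rightarrow> complex) \<Rightarrow> (nat \<Rightarrow> complex ^ 'n \<Rightarrow> complex) \<Rightarrow> bool" where
  "homogeneous_expansion f q \<longleftrightarrow>
    (\<forall>k. homogeneous_poly k (q k)) \<and> (\<forall>z. (\<lambda>k. q k z) sums f z)"

lemma homogeneous_poly_scale:
  assumes "homogeneous_poly k q"
  shows "q (w *s z) = w ^ k * q z"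
proof -
  obtain c where c:
    "\<And>z. q z = (\<Sum>m\<in>{m. (\<Sum>i\<in>UNIV. m i) = k}. c m * (\<Prod>i\<in>UNIV. (z $ i) ^ m i))"
    using assms unfolding homogeneous_poly_def by blast
  show ?thesis
    unfolding c sum_distrib_left
    by (rule sum.cong) (auto simp: power_mult_distrib prod.distrib simp flip: power_sum)
qed

lemma homogeneous_expansion_unique:
  assumes "homogeneous_expansion f q" "homogeneous_expansion f r"
  shows "q = r"
proof (intro ext)
  fix k z
  define a where "a j = q j z - r j z" for j
  have sums: "(\<lambda>j. a j * w ^ j) sums 0" for w
  proof -
    have "(\<lambda>j. q j (w *s z) - r j (w *s z)) sums (f (w *s z) - f (w *s z))"
      using assms unfolding homogeneous_expansion_def by (intro sums_diff) auto
    moreover have "q j (w *s z) - r j (w *s z) = a j * w ^ j" for j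
      using assms homogeneous_poly_scale[of j "q j" w z] homogeneous_poly_scale[of j "r j" w z]
      unfolding homogeneous_expansion_def a_def by (simp add: algebra_simps)
    ultimately show ?thesis by simp
  qed
  have "a k = 0"
  proof (cases "k = 0")
    case True
    then show ?thesis using sums[of 0] by simp
  next
    case False
    show ?thesis
    proof (rule ccontr)
      assume "a k \<noteq> 0"
      with False sums obtain s :: real where
        "0 < s" "\<And>w::complex. w \<in> cball 0 s - {0} \<Longrightarrow> (0::complex) \<noteq> 0"
        using powser_0_nonzero[of 1 0 a "\<lambda>_. 0" k] by (metis diff_zero gr0I zero_less_one)
      then show False
        using \<open>0 < s\<close> by (metis Diff_iff dist_0_norm mem_cball norm_of_real abs_of_pos order_refl
            empty_iff insert_iff norm_zero less_irrefl)
    qed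
  qed
  then show "q k z = r k z" by (simp add: a_def)
qed

text \<open>Every entire function has a homogeneous expansion; it is unique by the preceding lemma.\<close>

definition homogeneous_part ::
    "(complex ^ 'n \<Rightarrow> complex) \<Rightarrow> nat \<Rightarrow> complex ^ 'n \<Rightarrow> complex" where
  "homogeneous_part f = (THE q. homogeneous_expansion f q)"

definition lower_part :: "real \<Rightarrow> (complex ^ 'n \<Rightarrow> complex) \<Rightarrow> complex ^ 'n \<Rightarrow> complex" where
  "lower_part s f z = (\<Sum>k\<in>{k. real k \<le> \<bar>s\<bar>}. homogeneous_part f k z)"

definition upper_part :: "real \<Rightarrow> (complex ^ 'n \<Rightarrow> complex) \<Rightarrow> complex ^ 'n \<Rightarrow> complex" where
  "upper_part s f z = (\<Sum>k. if real k > \<bar>s\<bar> then homogeneous_part f k z else 0)"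

text \<open>At the origin \<open>powr\<close> yields 0 for every exponent, which is immaterial as points are null sets.\<close>

definition fock_form_integrand ::
    "real \<Rightarrow> (complex ^ 'n \<Rightarrow> complex) \<Rightarrow> (complex ^ 'n \<Rightarrow> complex) \<Rightarrow> complex ^ 'n \<Rightarrow> complex" where
  "fock_form_integrand \<sigma> f g z =
    f z * cnj (g z) * of_real (exp (- (norm z)\<^sup>2) * norm z powr (- \<sigma>))"

definition fock_form ::
    "real \<Rightarrow> (complex ^ 'n \<Rightarrow> complex) \<Rightarrow> (complex ^ 'n \<Rightarrow> complex) \<Rightarrow> complex" where
  "fock_form \<sigma> f g = (LINT z|fock_volume. fock_form_integrand \<sigma> f g z)"

definition fock_pairing ::
    "real \<Rightarrow> (complex ^ 'n \<Rightarrow> complex) \<Rightarrow> (complex ^ 'n \<Rightarrow> complex) \<Rightarrow> complex" where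
  "fock_pairing \<sigma> f g =
    (if \<sigma> < 2 * real CARD('n) then fock_form \<sigma> f g
     else fock_form 0 (lower_part (\<sigma> / 2) f) (lower_part (\<sigma> / 2) g)
        + fock_form \<sigma> (upper_part (\<sigma> / 2) f) (upper_part (\<sigma> / 2) g))"

text \<open>Absolute convergence of all integrals that occur in the pairing.\<close>

definition fock_pairing_well_defined ::
    "real \<Rightarrow> (complex ^ 'n \<Rightarrow> complex) \<Rightarrow> (complex ^ 'n \<Rightarrow> complex) \<Rightarrow> bool" where
  "fock_pairing_well_defined \<sigma> f g \<longleftrightarrow>
    (if \<sigma> < 2 * real CARD('n) then integrable fock_volume (fock_form_integrand \<sigma> f g)
     else integrable fock_volume
            (fock_form_integrand 0 (lower_part (\<sigma> / 2) f) (lower_part (\<sigma> / 2) g))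
        \<and> integrable fock_volume
            (fock_form_integrand \<sigma> (upper_part (\<sigma> / 2) f) (upper_part (\<sigma> / 2) g)))"

text \<open>
  Functionals are total functions of which only the values on \<^term>\<open>fock_space p \<alpha>\<close> matter.
\<close>

definition fock_bounded_functional ::
    "real \<Rightarrow> real \<Rightarrow> ((complex ^ 'n \<Rightarrow> complex) \<Rightarrow> complex) \<Rightarrow> bool" where
  "fock_bounded_functional p \<alpha> \<nu> \<longleftrightarrow>
    (\<forall>f\<in>fock_space p \<alpha>. \<forall>h\<in>fock_space p \<alpha>. \<nu> (\<lambda>z. f z + h z) = \<nu> f + \<nu> h) \<and>
    (\<forall>c. \<forall>f\<in>fock_space p \<alpha>. \<nu> (\<lambda>z. c * f z) = c * \<nu> f) \<and>
    (\<exists>B. \<forall>f\<in>fock_space p \<alpha>. norm (\<nu> f) \<le> B * fock_norm p \<alpha> f)"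

definition fock_functional_norm ::
    "real \<Rightarrow> real \<Rightarrow> ((complex ^ 'n \<Rightarrow> complex) \<Rightarrow> complex) \<Rightarrow> real" where
  "fock_functional_norm p \<alpha> \<nu> =
    (SUP f\<in>{f \<in> fock_space p \<alpha>. fock_norm p \<alpha> f \<le> 1}. norm (\<nu> f))"

end

(* The pairing acts diagonally on homogeneous expansions: on homogeneous polynomials of degree k the weight
   |z|^(-sigma) multiplies the Gaussian inner product by Gamma(n+k-sigma/2)/Gamma(n+k). A bounded functional nu
   is first represented by G(w) = conj (nu (exp <.,w>)) in the unweighted Gaussian pairing; the norm of exp <.,w> in
   the Fock space shows that G lies in F^infinity_(-alpha). Dividing the homogeneous parts of G by the Gamma
   quotients gives g. This multiplier is a Beta integral along rays followed by first-order radial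
   differential operators, which maps F^infinity_(-alpha) to F^infinity_beta by one-variable estimates, so no
   asymptotics of reproducing kernels are needed. That nu and the pairing with g agree everywhere follows from
   the density of polynomials. For p < 1 the inclusion in a weighted L^1 space rests on the submean property of
   |f|^p. *)
theory Submission
  imports Defs "HOL-Real_Asymp.Real_Asymp"
begin

section \<open>Unitary scalars, the Hermitian form and Lebesgue measure\<close>

text \<open>Once \<open>\<sigma> \<ge> 2 * n\<close> the weight
  \<open>norm z powr (- \<sigma>)\<close> is not integrable at the origin, which is why degrees up
  to \<open>\<sigma> / 2\<close> are paired without it. Above this cut
  \<open>n + k - \<sigma> / 2\<close> is positive, and both factors vanish at the origin to an order
  that restores integrability. The growth exponents match by counting: a radial derivative costs 2,
  a Beta integral of order \<open>t\<close> gains \<open>2 * t\<close>. With \<open>N\<close>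
  derivatives and \<open>t = N - \<sigma> / 2\<close> the exponent goes from
  \<open>- \<alpha>\<close> to \<open>- \<alpha> + \<sigma> = \<beta>\<close>. The gain is Gaussian:
  at \<open>\<tau> *s z\<close> the factor \<open>exp (norm z ^ 2 / 2)\<close> has dropped by about
  \<open>exp (- (1 - \<tau>) * (1 + norm z) ^ 2 / 8)\<close>, so only a piece of the segment of
  relative length \<open>(1 + norm z) powr (-2)\<close> near \<open>z\<close> counts. For
  \<open>p < 1\<close> the triangle inequality fails, so functionals are only ever applied to
  explicit functions: exponentials, homogeneous polynomials and dilates. Complex analysis in several
  variables is reduced to one variable by restriction to complex lines and by finite averages over
  rotations, hence the need for the rotation invariance of Lebesgue measure.\<close>

lemma norm_vector_smult [simp]: "norm (c *s z) = norm c * norm z" for z :: "complex ^ 'n"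
proof -
  have "(\<Sum>i\<in>UNIV. (norm c * norm (z $ i))\<^sup>2) = (norm c)\<^sup>2 * (\<Sum>i\<in>UNIV. (norm (z $ i))\<^sup>2)"
    by (simp add: power_mult_distrib sum_distrib_left)
  then show ?thesis
    by (simp add: norm_vec_def L2_set_def norm_mult real_sqrt_mult)
qed

lemma scaleR_eq_vector_smult: "r *\<^sub>R z = of_real r *s z" for z :: "complex ^ 'n"
  by (simp add: vec_eq_iff vector_scalar_mult_def) (simp add: scaleR_conv_of_real)

lemma vector_smult_diff_right: "c *s (z - w) = c *s z - c *s w" for z :: "complex ^ 'n"
  by (simp add: vec_eq_iff algebra_simps)

text \<open>Linear in the first argument, so that \<open>\<lambda>z. exp (herm z w)\<close> is
  entire; this exponential is the reproducing kernel of the unweighted Gaussian pairing.\<close>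

definition herm :: "complex ^ 'n \<Rightarrow> complex ^ 'n \<Rightarrow> complex" where
  "herm z w = (\<Sum>i\<in>UNIV. z $ i * cnj (w $ i))"

lemma herm_simps:
  "herm (z + z') w = herm z w + herm z' w" "herm z (w + w') = herm z w + herm z w'"
  "herm (c *s z) w = c * herm z w" "herm z (c *s w) = cnj c * herm z w"
  "herm 0 w = 0" "herm z 0 = 0"
  by (simp_all add: herm_def sum.distrib algebra_simps sum_distrib_left)

lemma cnj_herm: "cnj (herm z w) = herm w z"
  by (simp add: herm_def mult.commute)

lemma Re_herm: "Re (herm z w) = z \<bullet> w"
  by (simp add: herm_def inner_vec_def inner_complex_def)

lemma herm_self: "herm z z = of_real ((norm z)\<^sup>2)"
proof -
  have "Im (herm z z) = 0" using cnj_herm[of z z] by (simp add: complex_eq_iff)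
  then show ?thesis
    by (simp add: complex_eq_iff Re_herm power2_norm_eq_inner)
qed

lemma norm_herm_le: "norm (herm z w) \<le> norm z * norm w"
proof -
  \<comment> \<open>Multiplying \<open>z\<close> by this scalar makes the form real and nonnegative,
    which reduces the claim to the real Cauchy-Schwarz inequality. If the form vanishes then
    \<open>c = 0\<close>, hence only \<open>norm c \<le> 1\<close> is recorded.\<close>
  define c where "c = cnj (sgn (herm z w))"
  have c: "norm c \<le> 1" by (simp add: c_def norm_sgn)
  have "of_real (norm (herm z w)) = c * herm z w"
    using complex_norm_square[of "herm z w"]
    by (cases "herm z w = 0") (auto simp: c_def sgn_eq mult.commute power2_eq_square eq_divide_eq)
  then have "norm (herm z w) = Re (herm (c *s z) w)"
    by (metis Re_complex_of_real herm_simps(3))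
  also have "\<dots> \<le> norm (c *s z) * norm w"
    unfolding Re_herm by (rule norm_cauchy_schwarz)
  also have "\<dots> \<le> norm z * norm w"
    using c by (simp add: mult_left_le_one_le mult_right_mono)
  finally show ?thesis .
qed

lemma norm_diff_sq: "(norm (z + w))\<^sup>2 = (norm z)\<^sup>2 + (norm w)\<^sup>2 + 2 * Re (herm z w)"
  by (simp add: Re_herm power2_norm_eq_inner inner_add_left inner_add_right inner_commute)

lemma continuous_on_vector_smult [continuous_intros]:
  fixes g :: "'a::topological_space \<Rightarrow> complex ^ 'n"
  assumes "continuous_on S f" "continuous_on S g"
  shows "continuous_on S (\<lambda>x. f x *s g x)"
  unfolding vector_scalar_mult_def using assms by (intro continuous_intros)

lemma continuous_on_herm [continuous_intros]:
  assumes "continuous_on S f" "continuous_on S g"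
  shows "continuous_on S (\<lambda>x. herm (f x) (g x))"
  unfolding herm_def using assms by (intro continuous_intros)

lemma emeasure_ball_isometry:
  fixes T S :: "'a::euclidean_space \<Rightarrow> 'a"
  assumes T: "\<And>x y. dist (T x) (T y) = dist x y" and TS: "\<And>x. T (S x) = x" and "r > 0"
  shows "T -` ball x r = ball (S x) r" "emeasure lborel (T -` ball x r) = emeasure lborel (ball x r)"
proof -
  show *: "T -` ball x r = ball (S x) r"
    using T[of "S x"] by (auto simp: TS)
  show "emeasure lborel (T -` ball x r) = emeasure lborel (ball x r)"
    unfolding * using \<open>r > 0\<close> by (simp add: emeasure_ball)
qed

text \<open>By Vitali's covering theorem an open set is a disjoint union of balls up to a null set.\<close>

lemma emeasure_open_isometry_ge:
  fixes T S :: "'a::euclidean_space \<Rightarrow> 'a"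
  assumes T: "\<And>x y. dist (T x) (T y) = dist x y" and TS: "\<And>x. T (S x) = x" and U: "open U"
  shows "emeasure lborel U \<le> emeasure lborel (T -` U)"
proof -
  define K where "K = {(x, r). r > 0 \<and> ball x r \<subseteq> U}"
  have "\<exists>i. i \<in> K \<and> x \<in> ball (fst i) (snd i) \<and> snd i < d" if x: "x \<in> U" "0 < d" for x d
  proof -
    obtain e where e: "e > 0" "ball x e \<subseteq> U" using U x open_contains_ball by blast
    have "ball x (min e (d/2)) \<subseteq> U" using e by (auto simp: ball_def)
    then show ?thesis using e x by (intro exI[of _ "(x, min e (d/2))"]) (auto simp: K_def)
  qed
  then obtain C where C: "countable C" "C \<subseteq> K"
     "pairwise (\<lambda>i j. disjnt (ball (fst i) (snd i)) (ball (fst j) (snd j))) C"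
     "negligible (U - (\<Union>i\<in>C. ball (fst i) (snd i)))"
    by (rule Vitali_covering_theorem_balls[of U K fst snd]) auto
  have disj: "disjoint_family_on (\<lambda>i. ball (fst i) (snd i)) C"
    using C(3) unfolding disjoint_family_on_def pairwise_def disjnt_def by blast
  have cont: "continuous_on UNIV T"
    unfolding continuous_on_iff using T by metis
  have meas [measurable]: "T \<in> borel_measurable borel"
    using cont by (rule borel_measurable_continuous_onI)
  let ?W = "\<Union>i\<in>C. ball (fst i) (snd i)"
  have Wo: "open ?W" by auto
  \<comment> \<open>Vitali's theorem yields a null set of the completed measure; as a difference of
    two open sets it is Borel, so it is null for \<open>lborel\<close> itself.\<close>
  have "U - ?W \<in> null_sets lborel"
  proof -
    have "U - ?W \<in> null_sets (completion lborel)"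
      using C(4) by (simp add: negligible_iff_null_sets)
    then show ?thesis
      using U Wo by (metis borel_open lebesgue_openin null_sets_completion_iff sets.Diff sets_lborel)
  qed
  then have "emeasure lborel U \<le> emeasure lborel ?W"
  proof -
    have "emeasure lborel U \<le> emeasure lborel (?W \<union> (U - ?W))"
      using U Wo by (intro emeasure_mono) auto
    also have "\<dots> = emeasure lborel ?W"
      using \<open>U - ?W \<in> null_sets lborel\<close> Wo by (intro emeasure_Un_null_set) auto
    finally show ?thesis .
  qed
  also have "\<dots> = (\<integral>\<^sup>+i. emeasure lborel (ball (fst i) (snd i)) \<partial>count_space C)"
    using C(1) disj by (intro emeasure_UN_countable) auto
  also have "\<dots> = (\<integral>\<^sup>+i. emeasure lborel (T -` ball (fst i) (snd i)) \<partial>count_space C)"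
  proof (rule nn_integral_cong)
    fix i assume "i \<in> space (count_space C)"
    then have "snd i > 0" using C(2) by (auto simp: K_def)
    then show "emeasure lborel (ball (fst i) (snd i)) = emeasure lborel (T -` ball (fst i) (snd i))"
      using emeasure_ball_isometry(2)[of T S, OF T TS] by simp
  qed
  also have "\<dots> = emeasure lborel (\<Union>i\<in>C. T -` ball (fst i) (snd i))"
  proof (rule emeasure_UN_countable[symmetric])
    show "T -` ball (fst i) (snd i) \<in> sets lborel" if "i \<in> C" for i
      using measurable_sets[OF meas, of "ball (fst i) (snd i)"] by simp
    show "disjoint_family_on (\<lambda>i. T -` ball (fst i) (snd i)) C"
      using disj unfolding disjoint_family_on_def by blast
  qed (use C in auto)
  also have "\<dots> \<le> emeasure lborel (T -` U)"
  proof (rule emeasure_mono)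
    show "(\<Union>i\<in>C. T -` ball (fst i) (snd i)) \<subseteq> T -` U"
      using C(2) by (fastforce simp: K_def)
    show "T -` U \<in> sets lborel"
      using measurable_sets[OF meas, of U] U by simp
  qed
  finally show ?thesis .
qed

text \<open>The inequality for open sets, applied to \<open>T\<close> and to its inverse
  \<open>S\<close>, gives equality on open boxes, and these determine \<open>lborel\<close>.
  Multiplication by a unimodular complex scalar is such an isometry.\<close>

lemma lborel_distr_isometry:
  fixes T S :: "'a::euclidean_space \<Rightarrow> 'a"
  assumes T: "\<And>x y. dist (T x) (T y) = dist x y" and TS: "\<And>x. T (S x) = x" and ST: "\<And>x. S (T x) = x"
  shows "distr lborel borel T = lborel"
proof (rule lborel_eqI[symmetric])
  have S: "dist (S x) (S y) = dist x y" for x y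
    using T[of "S x" "S y"] by (simp add: TS)
  have cont: "continuous_on UNIV T"
    unfolding continuous_on_iff using T by metis
  have meas [measurable]: "T \<in> borel_measurable borel"
    using cont by (rule borel_measurable_continuous_onI)
  fix l u :: 'a assume lu: "\<And>b. b \<in> Basis \<Longrightarrow> l \<bullet> b \<le> u \<bullet> b"
  have "open (T -` box l u)"
    using cont continuous_on_open_vimage[of UNIV T] by (metis Int_UNIV_right open_UNIV open_box)
  then have "emeasure lborel (T -` box l u) \<le> emeasure lborel (S -` (T -` box l u))"
    using emeasure_open_isometry_ge[of S T, OF S ST] by blast
  also have "S -` (T -` box l u) = box l u" using TS by auto
  finally have "emeasure lborel (T -` box l u) = emeasure lborel (box l u)"
    using emeasure_open_isometry_ge[of T S, OF T TS, of "box l u"] by (auto intro: antisym)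
  then show "emeasure (distr lborel borel T) (box l u) = ennreal (\<Prod>b\<in>Basis. (u - l) \<bullet> b)"
    using lu by (simp add: emeasure_distr emeasure_lborel_box)
qed auto

section \<open>Rotation, translation and dilation of the normalized volume\<close>

lemma sets_fock_volume [simp, measurable_cong]: "sets (fock_volume :: (complex ^ 'n) measure) = sets borel"
  by (simp add: fock_volume_def)

lemma space_fock_volume [simp]: "space (fock_volume :: (complex ^ 'n) measure) = UNIV"
  by (simp add: fock_volume_def)

lemma emeasure_fock_volume:
  "A \<in> sets borel \<Longrightarrow> emeasure (fock_volume :: (complex ^ 'n) measure) A
     = ennreal (1 / pi ^ CARD('n)) * emeasure lborel A"
  by (simp add: fock_volume_def emeasure_density nn_integral_cmult nn_integral_indicator)

lemma distr_fock_volumeI: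
  fixes T :: "complex ^ 'n \<Rightarrow> complex ^ 'n"
  assumes "distr lborel borel T = lborel" and [measurable]: "T \<in> borel_measurable borel"
  shows "distr fock_volume fock_volume T = (fock_volume :: (complex ^ 'n) measure)"
proof (rule measure_eqI)
  fix A assume "A \<in> sets (distr fock_volume fock_volume T :: (complex ^ 'n) measure)"
  then have A [measurable]: "A \<in> sets borel" by simp
  have "T -` A \<in> sets borel" using measurable_sets[OF assms(2) A] by simp
  moreover have "emeasure lborel (T -` A) = emeasure (distr lborel borel T) A"
    by (simp add: emeasure_distr)
  ultimately show "emeasure (distr fock_volume fock_volume T) A = emeasure fock_volume A"
    by (simp add: emeasure_distr emeasure_fock_volume assms(1))
qed simp

lemma borel_measurable_vector_smult [measurable]: "(\<lambda>z :: complex ^ 'n. c *s z) \<in> borel_measurable borel"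
  by (intro borel_measurable_continuous_onI continuous_intros)

lemma fock_volume_rotate:
  assumes "norm c = 1"
  shows "distr fock_volume fock_volume ((*s) c) = (fock_volume :: (complex ^ 'n) measure)"
proof (rule distr_fock_volumeI)
  have c: "c * cnj c = 1" using assms complex_norm_square[of c] by simp
  show "distr lborel borel ((*s) c) = (lborel :: (complex ^ 'n) measure)"
  proof (rule lborel_distr_isometry)
    show "dist (c *s x) (c *s y) = dist x y" for x y :: "complex ^ 'n"
      using assms by (metis dist_norm mult_1 norm_vector_smult vector_smult_diff_right)
    show "c *s (cnj c *s x) = x" "cnj c *s (c *s x) = x" for x :: "complex ^ 'n"
      using c by (simp_all add: vec_eq_iff vector_scalar_mult_def mult.commute flip: mult.assoc)
  qed
qed simp

lemma fock_volume_translate: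
  "distr fock_volume fock_volume (\<lambda>z. z + a) = (fock_volume :: (complex ^ 'n) measure)"
proof (rule distr_fock_volumeI)
  have "(\<lambda>z. z + a) = (+) a" by (simp add: fun_eq_iff add.commute)
  then show "distr lborel borel (\<lambda>z. z + a) = lborel"
    using lborel_distr_plus[of a] by simp
qed simp

lemma integral_rotate:
  fixes f :: "complex ^ 'n \<Rightarrow> 'b::{banach, second_countable_topology}"
  assumes "norm c = 1" and [measurable]: "f \<in> borel_measurable borel"
  shows "(LINT z|fock_volume. f (c *s z)) = (LINT z|fock_volume. f z)"
  by (subst (2) fock_volume_rotate[OF assms(1), symmetric]) (simp add: integral_distr)

lemma integral_translate:
  fixes f :: "complex ^ 'n \<Rightarrow> 'b::{banach, second_countable_topology}"
  assumes [measurable]: "f \<in> borel_measurable borel"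
  shows "(LINT z|fock_volume. f (z + a)) = (LINT z|fock_volume. f z)"
  by (subst (2) fock_volume_translate[of a, symmetric]) (simp add: integral_distr)

lemma integrable_translate:
  fixes f :: "complex ^ 'n \<Rightarrow> 'b::{banach, second_countable_topology}"
  assumes "integrable fock_volume f"
  shows "integrable fock_volume (\<lambda>z. f (z + a))"
proof -
  have "integrable (distr fock_volume fock_volume (\<lambda>z. z + a)) f"
    using assms by (simp add: fock_volume_translate)
  moreover have "f \<in> borel_measurable fock_volume" using assms by auto
  ultimately show ?thesis by (subst (asm) integrable_distr_eq) simp_all
qed

lemma nn_integral_fock_volume:
  assumes [measurable]: "f \<in> borel_measurable borel"
  shows "(\<integral>\<^sup>+z. f z \<partial>(fock_volume :: (complex ^ 'n) measure)) = ennreal (1 / pi ^ CARD('n)) * (\<integral>\<^sup>+z. f z \<partial>lborel)"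
  by (simp add: fock_volume_def nn_integral_density nn_integral_cmult)

lemma nn_integral_scale:
  fixes f :: "complex ^ 'n \<Rightarrow> ennreal"
  assumes [measurable]: "f \<in> borel_measurable borel" and r: "r > 0"
  shows "(\<integral>\<^sup>+z. f z \<partial>fock_volume) = ennreal (r ^ (2 * CARD('n))) * (\<integral>\<^sup>+z. f (r *\<^sub>R z) \<partial>fock_volume)"
proof -
  have "(\<integral>\<^sup>+z. f z \<partial>lborel) = (\<integral>\<^sup>+z. f z \<partial>density (distr lborel borel (\<lambda>x. 0 + r *\<^sub>R x)) (\<lambda>_. \<bar>r\<bar> ^ DIM(complex ^ 'n)))"
    using r lborel_affine[of r "0 :: complex ^ 'n"] by simp
  also have "\<dots> = ennreal (r ^ (2 * CARD('n))) * (\<integral>\<^sup>+z. f (r *\<^sub>R z) \<partial>lborel)"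
    using r by (simp add: nn_integral_density nn_integral_distr nn_integral_cmult mult.commute[of "CARD('n)" 2])
  finally show ?thesis by (simp add: nn_integral_fock_volume mult.left_commute)
qed

lemma has_bochner_integral_scale:
  fixes f :: "complex ^ 'n \<Rightarrow> 'b::{banach, second_countable_topology}"
  assumes r: "r > 0" and f: "integrable fock_volume f"
  shows "integrable fock_volume (\<lambda>z. f (r *\<^sub>R z))"
    "(LINT z|fock_volume. f z) = r ^ (2 * CARD('n)) *\<^sub>R (LINT z|fock_volume. f (r *\<^sub>R z))"
proof -
  have [measurable]: "f \<in> borel_measurable borel" using f by auto
  have "fock_volume = density (distr fock_volume borel (\<lambda>z :: complex ^ 'n. r *\<^sub>R z)) (\<lambda>_. ennreal (r ^ (2 * CARD('n))))"
  proof (rule measure_eqI)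
    fix A :: "(complex ^ 'n) set" assume "A \<in> sets fock_volume"
    then have [measurable]: "A \<in> sets borel" by simp
    have "(\<integral>\<^sup>+ z. indicator A (r *\<^sub>R z) \<partial>fock_volume) = (\<integral>\<^sup>+ z. indicator A z \<partial>distr fock_volume borel (\<lambda>z :: complex ^ 'n. r *\<^sub>R z))"
      by (subst nn_integral_distr) auto
    then show "emeasure fock_volume A = emeasure (density (distr fock_volume borel (\<lambda>z :: complex ^ 'n. r *\<^sub>R z)) (\<lambda>_. ennreal (r ^ (2 * CARD('n))))) A"
      using nn_integral_scale[OF _ r, of "indicator A"]
      by (simp add: emeasure_density nn_integral_cmult)
  qed simp
  note eq = this
  have 1: "integrable (density (distr fock_volume borel (\<lambda>z :: complex ^ 'n. r *\<^sub>R z)) (\<lambda>_. ennreal (r ^ (2 * CARD('n))))) f"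
    by (subst eq[symmetric]) (rule f)
  then have "integrable fock_volume (\<lambda>z. r ^ (2 * CARD('n)) *\<^sub>R f (r *\<^sub>R z))"
    using r by (subst (asm) integrable_density) (simp_all add: integrable_distr_eq)
  then have "integrable fock_volume (\<lambda>z. inverse (r ^ (2 * CARD('n))) *\<^sub>R (r ^ (2 * CARD('n)) *\<^sub>R f (r *\<^sub>R z)))"
    by (rule integrable_scaleR_right)
  then show "integrable fock_volume (\<lambda>z. f (r *\<^sub>R z))" using r by simp
  have "(LINT z|fock_volume. f z) = (LINT z|density (distr fock_volume borel (\<lambda>z :: complex ^ 'n. r *\<^sub>R z)) (\<lambda>_. ennreal (r ^ (2 * CARD('n)))). f z)"
    by (subst eq[symmetric]) (rule refl)
  also have "\<dots> = r ^ (2 * CARD('n)) *\<^sub>R (LINT z|fock_volume. f (r *\<^sub>R z))"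
    using r by (subst integral_density) (simp_all add: integral_distr)
  finally show "(LINT z|fock_volume. f z) = r ^ (2 * CARD('n)) *\<^sub>R (LINT z|fock_volume. f (r *\<^sub>R z))" .
qed

unbundle no fps_syntax

section \<open>Entire functions and their homogeneous expansions\<close>

lemma entireI:
  assumes "\<And>z. (f has_derivative f' z) (at z)" "\<And>z c v. f' z (c *s v) = c * f' z v"
  shows "entire f"
  using assms unfolding entire_def by blast

lemma entireE:
  assumes "entire f"
  obtains f' where "\<And>z. (f has_derivative f' z) (at z)" "\<And>z c v. f' z (c *s v) = c * f' z v"
  using assms unfolding entire_def by metis

lemma entire_const [simp]: "entire (\<lambda>_. c)"
  by (rule entireI[of _ "\<lambda>_ _. 0"]) auto

lemma entire_coord: "entire (\<lambda>z :: complex ^ 'n. z $ i)"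
proof (rule entireI)
  show "((\<lambda>z :: complex ^ 'n. z $ i) has_derivative (\<lambda>z. z $ i)) (at z)" for z
    by (intro bounded_linear_imp_has_derivative bounded_linear_vec_nth)
qed simp

lemma entire_add: "entire f \<Longrightarrow> entire g \<Longrightarrow> entire (\<lambda>z. f z + g z)"
  by (elim entireE, rule entireI, rule has_derivative_add, assumption+) (simp add: algebra_simps)

lemma entire_mult: "entire f \<Longrightarrow> entire g \<Longrightarrow> entire (\<lambda>z. f z * g z)"
  by (elim entireE, rule entireI, rule has_derivative_mult, assumption+) (simp add: algebra_simps)

lemma entire_cmult: "entire f \<Longrightarrow> entire (\<lambda>z. c * f z)"
  by (intro entire_mult entire_const)

lemma entire_diff: "entire f \<Longrightarrow> entire g \<Longrightarrow> entire (\<lambda>z. f z - g z)"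
  using entire_add[OF _ entire_cmult[of g "-1"], of f] by simp

lemma entire_sum: "(\<And>i. i \<in> I \<Longrightarrow> entire (f i)) \<Longrightarrow> entire (\<lambda>z. \<Sum>i\<in>I. f i z)"
  by (induction I rule: infinite_finite_induct) (auto intro: entire_add)

lemma entire_power: "entire f \<Longrightarrow> entire (\<lambda>z. f z ^ k)"
  by (induction k) (auto intro: entire_mult)

lemma entire_prod: "(\<And>i. i \<in> I \<Longrightarrow> entire (f i)) \<Longrightarrow> entire (\<lambda>z. \<Prod>i\<in>I. f i z)"
  by (induction I rule: infinite_finite_induct) (auto intro: entire_mult)

lemma entire_compose:
  assumes "entire f" and h: "\<And>w. (h has_field_derivative h' w) (at w)"
  shows "entire (\<lambda>z. h (f z))"
proof -
  obtain f' where f': "\<And>z. (f has_derivative f' z) (at z)" "\<And>z c v. f' z (c *s v) = c * f' z v"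
    using assms(1) by (rule entireE) blast
  show ?thesis
  proof (rule entireI)
    show "((\<lambda>z. h (f z)) has_derivative (\<lambda>v. h' (f z) * f' z v)) (at z)" for z
      using has_derivative_compose[OF f'(1) h[unfolded has_field_derivative_def]] .
  qed (simp add: f')
qed

lemma entire_exp: "entire f \<Longrightarrow> entire (\<lambda>z. exp (f z))"
  by (rule entire_compose[where h = exp and h' = exp]) (auto intro: DERIV_exp)

lemma bounded_linear_smult_left: "bounded_linear (\<lambda>z :: complex ^ 'n. c *s z)"
  by (intro linear_conv_bounded_linear[THEN iffD1] linearI)
     (simp_all add: vec_eq_iff algebra_simps)

lemma bounded_linear_smult_right: "bounded_linear (\<lambda>w. w *s (v :: complex ^ 'n))"
  by (intro linear_conv_bounded_linear[THEN iffD1] linearI)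
     (simp_all add: vec_eq_iff algebra_simps)

lemma entire_affine:
  assumes "entire f" shows "entire (\<lambda>z. f (c *s z + a))"
proof -
  obtain f' where f': "\<And>z. (f has_derivative f' z) (at z)" "\<And>z c v. f' z (c *s v) = c * f' z v"
    using assms(1) by (rule entireE) blast
  show ?thesis
  proof (rule entireI)
    fix z
    have "((\<lambda>z. c *s z + a) has_derivative (\<lambda>v. c *s v)) (at z)"
      using has_derivative_add[OF bounded_linear_imp_has_derivative[OF bounded_linear_smult_left] has_derivative_const]
      by simp
    then show "((\<lambda>z. f (c *s z + a)) has_derivative (\<lambda>v. f' (c *s z + a) (c *s v))) (at z)"
      by (rule has_derivative_compose) (rule f')
  qed (simp add: f' vector_smult_assoc)
qed

lemma entire_herm: "entire (\<lambda>z. herm z w)"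
  unfolding herm_def by (intro entire_sum entire_mult entire_coord entire_const)

lemma entire_continuous_on: "entire f \<Longrightarrow> continuous_on S f"
  by (elim entireE) (meson continuous_at_imp_continuous_on has_derivative_continuous)

lemma entire_measurable: "entire f \<Longrightarrow> f \<in> borel_measurable borel"
  by (intro borel_measurable_continuous_onI entire_continuous_on)

lemma entire_bounded_on_ball:
  assumes "entire f" obtains B where "B \<ge> 0" "\<And>z. norm z \<le> R \<Longrightarrow> norm (f z) \<le> B"
proof -
  have "compact (f ` cball 0 R)"
    by (intro compact_continuous_image entire_continuous_on assms compact_cball)
  then obtain B where "\<And>z. norm z \<le> R \<Longrightarrow> norm (f z) \<le> B"
    by (metis bounded_iff compact_imp_bounded dist_0_norm image_eqI mem_cball)
  then show ?thesis using that[of "max B 0"] by (metis max.cobounded2 max.coboundedI1)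
qed

text \<open>Complex linearity of the Frechet derivative is exactly what makes restrictions to
  complex lines holomorphic. Through this lemma the one-variable theory (power series, Cauchy's
  inequality, Liouville) becomes available.\<close>

lemma entire_line_has_field_derivative:
  fixes f :: "complex ^ 'n \<Rightarrow> complex"
  assumes "(f has_derivative f') (at (a + w *s v))" "\<And>c v. f' (c *s v) = c * f' v"
  shows "((\<lambda>w. f (a + w *s v)) has_field_derivative f' v) (at w)"
proof -
  have "((\<lambda>w. a + w *s v) has_derivative (\<lambda>h. h *s v)) (at w)"
    using has_derivative_add[OF has_derivative_const[of a] bounded_linear_imp_has_derivative[OF bounded_linear_smult_right[of v]]]
    by simp
  then have "((\<lambda>w. f (a + w *s v)) has_derivative (\<lambda>h. f' (h *s v))) (at w)"
    by (rule has_derivative_compose) (rule assms)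
  moreover have "(\<lambda>h. h * f' v) = (*) (f' v)" by (simp add: fun_eq_iff mult.commute)
  ultimately show ?thesis by (simp add: has_field_derivative_def assms(2))
qed

lemma entire_line_holomorphic:
  assumes "entire f" shows "(\<lambda>w. f (a + w *s v)) holomorphic_on S"
proof -
  obtain f' where f': "\<And>z. (f has_derivative f' z) (at z)" "\<And>z c v. f' z (c *s v) = c * f' z v"
    using assms(1) by (rule entireE) blast
  have "((\<lambda>w. f (a + w *s v)) has_field_derivative f' (a + w *s v) v) (at w within S)" for w
    using entire_line_has_field_derivative[OF f'] has_field_derivative_at_within by blast
  then show ?thesis unfolding holomorphic_on_def field_differentiable_def by blast
qed

text \<open>Discrete averages over roots of unity replace Cauchy's integrals: they stay finite sums of
  translates of the given function, so no differentiation under the integral is needed.\<close>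

definition circ_avg :: "nat \<Rightarrow> nat \<Rightarrow> (complex \<Rightarrow> complex) \<Rightarrow> complex" where
  "circ_avg N k F = (\<Sum>j<N. F (cis (2 * pi * real j / real N)) * cnj (cis (2 * pi * real j / real N)) ^ k) / of_nat N"

text \<open>A geometric sum whose ratio \<open>x\<close> is an \<open>N\<close>-th root of unity.
  Since \<open>l\<close> and \<open>k\<close> both lie below \<open>N\<close>, they are congruent
  modulo \<open>N\<close> only if equal, so \<open>x \<noteq> 1\<close> for
  \<open>l \<noteq> k\<close>.\<close>

lemma sum_roots_of_unity:
  assumes "k < N" "l < N"
  shows "(\<Sum>j<N. cis (2 * pi * real j / real N) ^ l * cnj (cis (2 * pi * real j / real N)) ^ k)
    = (if l = k then of_nat N else 0)"
proof -
  define x where "x = cis (2 * pi * (real l - real k) / real N)"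
  have eq: "cis (2 * pi * real j / real N) ^ l * cnj (cis (2 * pi * real j / real N)) ^ k = x ^ j" for j
    unfolding x_def cis_cnj Complex.DeMoivre cis_mult
    by (rule arg_cong[where f = cis]) (simp add: algebra_simps diff_divide_distrib)
  show ?thesis
  proof (cases "l = k")
    case True
    then show ?thesis unfolding eq by (simp add: x_def)
  next
    case False
    have "x \<noteq> 1"
    proof
      assume "x = 1"
      then have "cos (2 * pi * (real l - real k) / real N) = 1"
        unfolding x_def by (metis cis.simps(1) one_complex.simps(1))
      then obtain m :: int where "2 * pi * (real l - real k) / real N = of_int m * 2 * pi"
        using cos_one_2pi_int by blast
      then have "real l - real k = of_int m * real N"
        using assms by (simp add: field_simps) (metis (no_types, opaque_lifting) mult.left_commute mult_cancel_left pi_neq_zero distrib_left zero_neq_numeral mult.commute)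
      then have "real_of_int (int l - int k) = real_of_int (m * int N)" by simp
      then have "int l - int k = m * int N" by (simp only: of_int_eq_iff)
      then have "int N dvd int l - int k" by simp
      then show False
        using assms False by (metis int_ops(1) mod_less nat_dvd_iff of_nat_eq_iff mod_eq_dvd_iff zmod_int)
    qed
    moreover have "x ^ N = 1"
    proof -
      have "x ^ N = cis (2 * pi * of_int (int l - int k))"
        unfolding x_def Complex.DeMoivre using assms by (intro arg_cong[where f = cis]) simp
      then show ?thesis using cis_multiple_2pi Ints_of_int by metis
    qed
    ultimately show ?thesis using False unfolding eq by (simp add: geometric_sum)
  qed
qed

lemma norm_circ_avg_le:
  assumes "\<And>w. norm w = 1 \<Longrightarrow> norm (F w) \<le> B" "0 \<le> B"
  shows "norm (circ_avg N k F) \<le> B"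
proof (cases "N = 0")
  case False
  have "norm (\<Sum>j<N. F (cis (2 * pi * real j / real N)) * cnj (cis (2 * pi * real j / real N)) ^ k) \<le> (\<Sum>j<N. B)"
    using assms by (intro sum_norm_le) (simp add: norm_mult norm_power)
  then show ?thesis using False
    by (simp add: circ_avg_def norm_divide divide_le_eq mult.commute)
qed (use assms in \<open>simp add: circ_avg_def\<close>)

text \<open>By orthogonality the average is exact on the terms of degree below \<open>N\<close>. The
  error is therefore the average of the remainder, and averaging does not increase a bound.\<close>

lemma circ_avg_error:
  assumes sm: "summable (\<lambda>l. norm (a l))"
    and F: "\<And>w. norm w = 1 \<Longrightarrow> (\<lambda>l. a l * w ^ l) sums F w" and "k < N"
  shows "norm (circ_avg N k F - a k) \<le> (\<Sum>l. norm (a (l + N)))"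
proof -
  define R where "R w = (\<Sum>l. a (l + N) * w ^ (l + N))" for w
  have split: "F w = (\<Sum>l<N. a l * w ^ l) + R w" if "norm w = 1" for w
    using sums_unique[OF F[OF that]] suminf_split_initial_segment[OF sums_summable[OF F[OF that]], of N]
    by (simp add: R_def add.commute)
  have smN: "summable (\<lambda>l. norm (a (l + N)))"
    using sm summable_iff_shift[of "\<lambda>l. norm (a l)" N] by simp
  have R: "norm (R w) \<le> (\<Sum>l. norm (a (l + N)))" if "norm w = 1" for w
    unfolding R_def using summable_norm[of "\<lambda>l. a (l + N) * w ^ (l + N)"] smN that
    by (simp add: norm_mult norm_power)
  have "circ_avg N k F = circ_avg N k (\<lambda>w. \<Sum>l<N. a l * w ^ l) + circ_avg N k R"
    by (simp add: circ_avg_def split add_divide_distrib[symmetric] sum.distrib[symmetric] distrib_right)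
  also have "circ_avg N k (\<lambda>w. \<Sum>l<N. a l * w ^ l)
      = (\<Sum>l<N. a l * (\<Sum>j<N. cis (2 * pi * real j / real N) ^ l * cnj (cis (2 * pi * real j / real N)) ^ k)) / of_nat N"
    unfolding circ_avg_def sum_distrib_left sum_distrib_right
    by (subst sum.swap) (simp add: mult.assoc)
  also have "\<dots> = (\<Sum>l<N. if l = k then a l * of_nat N else 0) / of_nat N"
    using \<open>k < N\<close> by (intro arg_cong2[where f = "(/)"] sum.cong refl) (simp add: sum_roots_of_unity)
  also have "\<dots> = a k" using \<open>k < N\<close> by simp
  finally have "circ_avg N k F - a k = circ_avg N k R" by simp
  also have "norm \<dots> \<le> (\<Sum>l. norm (a (l + N)))"
    by (rule norm_circ_avg_le) (auto intro: R suminf_nonneg smN)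
  finally show ?thesis .
qed

lemma tail_suminf_tendsto:
  fixes f :: "nat \<Rightarrow> real"
  assumes "summable f" shows "(\<lambda>N. \<Sum>l. f (l + N)) \<longlonglongrightarrow> 0"
proof -
  have "(\<Sum>l. f (l + N)) = suminf f - sum f {..<N}" for N
    by (rule suminf_minus_initial_segment[OF assms])
  moreover have "(\<lambda>N. suminf f - sum f {..<N}) \<longlonglongrightarrow> suminf f - suminf f"
    by (intro tendsto_intros summable_LIMSEQ assms)
  ultimately show ?thesis by simp
qed

lemma circ_avg_tendsto:
  assumes sm: "summable (\<lambda>l. norm (a l))"
    and F: "\<And>w. norm w = 1 \<Longrightarrow> (\<lambda>l. a l * w ^ l) sums F w"
  shows "(\<lambda>N. circ_avg N k F) \<longlonglongrightarrow> a k"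
proof -
  have "(\<lambda>N. circ_avg N k F - a k) \<longlonglongrightarrow> 0"
  proof (rule Lim_null_comparison)
    show "\<forall>\<^sub>F N in sequentially. norm (circ_avg N k F - a k) \<le> (\<Sum>l. norm (a (l + N)))"
      using eventually_gt_at_top[of k] by eventually_elim (rule circ_avg_error[OF assms])
  qed (rule tail_suminf_tendsto[OF sm])
  then show ?thesis by (simp add: LIM_zero_iff)
qed

text \<open>Convergence at the single point 2 already forces absolute convergence on the unit
  circle.\<close>

lemma everywhere_sums_summable_norm:
  fixes a :: "nat \<Rightarrow> complex"
  assumes "\<And>w. (\<lambda>l. a l * w ^ l) sums F w"
  shows "summable (\<lambda>l. norm (a l))"
  using powser_insidea[of a 2 1] sums_summable[OF assms[of 2]] by simp

lemma powser_coeff_unique: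
  fixes a b :: "nat \<Rightarrow> complex"
  assumes "\<And>w. (\<lambda>l. a l * w ^ l) sums F w" "\<And>w. (\<lambda>l. b l * w ^ l) sums F w"
  shows "a k = b k"
  using circ_avg_tendsto[OF everywhere_sums_summable_norm[OF assms(1)] assms(1), of k]
    circ_avg_tendsto[OF everywhere_sums_summable_norm[OF assms(2)] assms(2), of k]
  by (rule LIMSEQ_unique)

text \<open>The candidate for the \<open>k\<close>-th homogeneous part, read off as a Taylor
  coefficient at 0 along the complex line through \<open>z\<close>. That it is a polynomial in
  \<open>z\<close> is the content of \<open>line_coeff_poly_fun\<close>.\<close>

definition line_coeff :: "(complex ^ 'n \<Rightarrow> complex) \<Rightarrow> nat \<Rightarrow> complex ^ 'n \<Rightarrow> complex" where
  "line_coeff f k z = (deriv ^^ k) (\<lambda>w. f (w *s z)) 0 / fact k"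

lemma line_coeff_sums:
  assumes "entire f" shows "(\<lambda>k. line_coeff f k z * w ^ k) sums f (w *s z)"
proof -
  have "(\<lambda>w. f (w *s z)) holomorphic_on ball 0 (norm w + 1)"
    using entire_line_holomorphic[OF assms, of 0 z] by simp
  from holomorphic_power_series[OF this, of w] show ?thesis
    by (simp add: line_coeff_def)
qed

lemma line_coeff_scale:
  assumes "entire f" shows "line_coeff f k (c *s z) = c ^ k * line_coeff f k z"
proof (rule powser_coeff_unique)
  show "(\<lambda>l. line_coeff f l (c *s z) * w ^ l) sums f (w *s (c *s z))" for w
    by (rule line_coeff_sums[OF assms])
  show "(\<lambda>l. (c ^ l * line_coeff f l z) * w ^ l) sums f (w *s (c *s z))" for w
    using line_coeff_sums[OF assms, of z "w * c"]
    by (simp add: vector_smult_assoc power_mult_distrib mult_ac)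
qed

lemma norm_line_coeff_le:
  assumes "entire f" "\<And>w. norm w = norm z \<Longrightarrow> norm (f w) \<le> B"
  shows "norm (line_coeff f k z) \<le> B"
proof -
  have "norm ((deriv ^^ k) (\<lambda>w. f (w *s z)) 0) \<le> fact k * B / 1 ^ k"
  proof (rule Cauchy_inequality)
    show "(\<lambda>w. f (w *s z)) holomorphic_on ball 0 1" "continuous_on (cball 0 1) (\<lambda>w. f (w *s z))"
      using entire_line_holomorphic[OF assms(1), of 0 z] holomorphic_on_imp_continuous_on by auto
  qed (use assms in auto)
  then show ?thesis by (simp add: line_coeff_def norm_divide divide_le_eq mult.commute)
qed

lemma norm_line_coeff_decay:
  assumes "entire f" "\<And>w. norm w \<le> 2 * R \<Longrightarrow> norm (f w) \<le> B" "norm z \<le> R"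
  shows "norm (line_coeff f k z) \<le> B / 2 ^ k"
proof -
  have "norm (line_coeff f k (2 *s z)) \<le> B"
    using assms by (intro norm_line_coeff_le) auto
  then show ?thesis
    by (simp add: line_coeff_scale[OF assms(1)] norm_mult norm_power field_simps)
qed

text \<open>Along a line the coefficient is a locally uniform limit of the averages
  \<open>circ_avg N k\<close>, which are finite sums of restrictions of \<open>f\<close> to complex
  lines. Uniformity comes from the geometric decay of the coefficients on balls: the tail in
  \<open>circ_avg_error\<close> is at most \<open>2 * B / 2 ^ N\<close>.\<close>

lemma line_coeff_holomorphic:
  assumes "entire f" shows "(\<lambda>\<zeta>. line_coeff f k (a + \<zeta> *s v)) holomorphic_on UNIV"
proof (rule holomorphic_uniform_sequence)
  fix N
  have "(\<lambda>\<zeta>. circ_avg N k (\<lambda>w. f (w *s a + \<zeta> *s (w *s v)))) holomorphic_on UNIV"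
    unfolding circ_avg_def divide_inverse by (intro holomorphic_intros entire_line_holomorphic[OF assms])
  moreover have "w *s (a + \<zeta> *s v) = w *s a + \<zeta> *s (w *s v)" for \<zeta> w
    by (simp add: vec_eq_iff algebra_simps)
  ultimately show "(\<lambda>\<zeta>. circ_avg N k (\<lambda>w. f (w *s (a + \<zeta> *s v)))) holomorphic_on UNIV"
    by (simp only:)
next
  fix x :: complex
  \<comment> \<open>Bounds \<open>norm (a + \<zeta> *s v)\<close> for all \<open>\<zeta>\<close> in
    the closed unit disc around \<open>x\<close>; \<open>B\<close> is taken on the doubled radius
    because \<open>norm_line_coeff_decay\<close> evaluates \<open>f\<close> there.\<close>
  define R where "R = norm a + (norm x + 1) * norm v"
  obtain B where B: "B \<ge> 0" "\<And>z. norm z \<le> 2 * R \<Longrightarrow> norm (f z) \<le> B"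
    using entire_bounded_on_ball[OF assms] by blast
  have "uniform_limit (cball x 1) (\<lambda>N \<zeta>. circ_avg N k (\<lambda>w. f (w *s (a + \<zeta> *s v))))
     (\<lambda>\<zeta>. line_coeff f k (a + \<zeta> *s v)) sequentially"
  proof (rule uniform_limitI)
    fix e :: real assume "e > 0"
    have "(\<lambda>N. 2 * B / 2 ^ N) \<longlonglongrightarrow> 0" by real_asymp
    then have "\<forall>\<^sub>F N in sequentially. 2 * B / 2 ^ N < e"
      using \<open>e > 0\<close> by (rule order_tendstoD)
    then show "\<forall>\<^sub>F N in sequentially. \<forall>\<zeta>\<in>cball x 1.
       dist (circ_avg N k (\<lambda>w. f (w *s (a + \<zeta> *s v)))) (line_coeff f k (a + \<zeta> *s v)) < e"
      using eventually_gt_at_top[of k]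
    proof eventually_elim
      case (elim N)
      show ?case
      proof
        fix \<zeta> assume "\<zeta> \<in> cball x 1"
        then have \<zeta>: "norm \<zeta> \<le> norm x + 1"
          by (metis dist_commute dist_norm mem_cball norm_triangle_sub add.commute add_le_cancel_left order_trans)
        define z where "z = a + \<zeta> *s v"
        have "norm z \<le> R" unfolding z_def R_def
          using \<zeta> by (intro order_trans[OF norm_triangle_ineq]) (simp add: mult_right_mono)
        then have b: "norm (line_coeff f l z) \<le> B / 2 ^ l" for l
          using norm_line_coeff_decay[OF assms B(2)] by blast
        have gs: "(\<lambda>l. B / 2 ^ (l + m)) sums (2 * B / 2 ^ m)" for m
          using sums_mult[OF geometric_sums[of "1/2::real"], of "B / 2 ^ m"]
          by (simp add: power_add field_simps)
        have "norm (circ_avg N k (\<lambda>w. f (w *s z)) - line_coeff f k z) \<le> (\<Sum>l. norm (line_coeff f (l + N) z))"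
          using elim(2) by (intro circ_avg_error line_coeff_sums[OF assms] everywhere_sums_summable_norm[OF line_coeff_sums[OF assms]])
        also have "\<dots> \<le> (\<Sum>l. B / 2 ^ (l + N))"
        proof (rule suminf_le)
          show sm: "summable (\<lambda>l. B / 2 ^ (l + N))" using gs sums_summable by blast
          show "summable (\<lambda>l. norm (line_coeff f (l + N) z))"
            using sm by (rule summable_comparison_test') (use b in auto)
        qed (rule b)
        also have "\<dots> = 2 * B / 2 ^ N" using gs sums_unique by metis
        finally show "dist (circ_avg N k (\<lambda>w. f (w *s (a + \<zeta> *s v)))) (line_coeff f k (a + \<zeta> *s v)) < e"
          using elim(1) unfolding z_def dist_norm by linarith
      qed
    qed
  qed
  then show "\<exists>d>0. cball x d \<subseteq> UNIV \<and> uniform_limit (cball x d) (\<lambda>N \<zeta>. circ_avg N k (\<lambda>w. f (w *s (a + \<zeta> *s v))))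
     (\<lambda>\<zeta>. line_coeff f k (a + \<zeta> *s v)) sequentially"
    by (intro exI[of _ 1]) simp
qed simp

lemma norm_line_coeff_growth:
  assumes "entire f" obtains B where "B \<ge> 0" "\<And>z. norm (line_coeff f k z) \<le> B * norm z ^ k"
proof -
  obtain B where B: "B \<ge> 0" "\<And>z. norm z \<le> 1 \<Longrightarrow> norm (f z) \<le> B"
    using entire_bounded_on_ball[OF assms] by blast
  have "norm (line_coeff f k z) \<le> B * norm z ^ k" for z
  proof -
    define u where "u = of_real (1 / norm z) *s z"
    \<comment> \<open>For \<open>z = 0\<close> division by zero makes \<open>u = 0\<close>, and the
      identity persists.\<close>
    have z: "z = of_real (norm z) *s u"
      by (cases "z = 0") (simp_all add: u_def vector_smult_assoc)
    have u: "norm u \<le> 1" by (simp add: u_def norm_divide)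
    have "norm (line_coeff f k u) \<le> B"
      using u B(2) by (intro norm_line_coeff_le assms) auto
    then show ?thesis
      using mult_right_mono[of "norm (line_coeff f k u)" B "norm z ^ k"]
      by (subst z) (simp add: line_coeff_scale[OF assms] norm_mult norm_power mult.commute)
  qed
  then show ?thesis using that B(1) by blast
qed

section \<open>Polynomials in several variables and their homogeneous pieces\<close>

inductive poly_fun :: "(complex ^ 'n \<Rightarrow> complex) \<Rightarrow> bool" where
  const: "poly_fun (\<lambda>_. c)"
| coord: "poly_fun (\<lambda>z. z $ i)"
| add: "poly_fun f \<Longrightarrow> poly_fun g \<Longrightarrow> poly_fun (\<lambda>z. f z + g z)"
| mult: "poly_fun f \<Longrightarrow> poly_fun g \<Longrightarrow> poly_fun (\<lambda>z. f z * g z)"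

lemma poly_fun_sum: "(\<And>i. i \<in> I \<Longrightarrow> poly_fun (f i)) \<Longrightarrow> poly_fun (\<lambda>z. \<Sum>i\<in>I. f i z)"
  by (induction I rule: infinite_finite_induct) (auto intro: poly_fun.intros)

lemma poly_fun_power: "poly_fun f \<Longrightarrow> poly_fun (\<lambda>z. f z ^ k)"
  by (induction k) (auto intro: poly_fun.intros)

definition vec_upd :: "complex ^ 'n \<Rightarrow> 'n \<Rightarrow> complex \<Rightarrow> complex ^ 'n" where
  "vec_upd z i \<zeta> = (\<chi> j. if j = i then \<zeta> else z $ j)"

lemma vec_upd_simps [simp]:
  "vec_upd z i \<zeta> $ j = (if j = i then \<zeta> else z $ j)"
  "vec_upd z i (z $ i) = z"
  "vec_upd (vec_upd z i \<zeta>) i \<xi> = vec_upd z i \<xi>"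
  by (simp_all add: vec_upd_def vec_eq_iff)

lemma vec_upd_commute: "i \<noteq> j \<Longrightarrow> vec_upd (vec_upd z i \<zeta>) j \<xi> = vec_upd (vec_upd z j \<xi>) i \<zeta>"
  by (simp add: vec_eq_iff)

text \<open>A polynomial of degree below \<open>N\<close> in one variable is recovered from its values at the \<open>N\<close>-th roots of
  unity; iterating over the variables interpolates a separately polynomial function.\<close>

lemma poly_fun_if_separately_polynomial:
  fixes q :: "complex ^ 'n \<Rightarrow> complex"
  assumes "\<And>z i. \<exists>c. \<forall>\<zeta>. q (vec_upd z i \<zeta>) = (\<Sum>j<N. c j * \<zeta> ^ j)"
  shows "poly_fun q"
proof -
  \<comment> \<open>Induction on a set \<open>S\<close> of coordinates that determine the value of
    \<open>q\<close>. Freezing the coordinate \<open>i\<close> at a root of unity removes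
    \<open>i\<close> from this set, and the values at the roots of unity recover \<open>q\<close> as
    a polynomial in \<open>z $ i\<close>.\<close>
  have "poly_fun q" if "finite S" "\<And>z z'. (\<And>i. i \<in> S \<Longrightarrow> z $ i = z' $ i) \<Longrightarrow> q z = q z'"
     "\<And>z i. \<exists>c. \<forall>\<zeta>. q (vec_upd z i \<zeta>) = (\<Sum>j<N. c j * \<zeta> ^ j)"
    for S :: "'n set" and q :: "complex ^ 'n \<Rightarrow> complex"
    using that
  proof (induction S arbitrary: q rule: finite_induct)
    case empty
    then have "q = (\<lambda>_. q 0)" by auto
    then show ?case using poly_fun.const by metis
  next
    case (insert i S)
    have eq: "q z = (\<Sum>j<N. circ_avg N j (\<lambda>\<zeta>. q (vec_upd z i \<zeta>)) * (z $ i) ^ j)" for z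
    proof -
      obtain c where c: "\<And>\<zeta>. q (vec_upd z i \<zeta>) = (\<Sum>j<N. c j * \<zeta> ^ j)"
        using insert.prems(2) by blast
      define a where "a j = (if j < N then c j else 0)" for j
      have "(\<lambda>l. a l * \<zeta> ^ l) sums q (vec_upd z i \<zeta>)" for \<zeta>
      proof -
        have "(\<lambda>l. a l * \<zeta> ^ l) sums (\<Sum>l<N. a l * \<zeta> ^ l)"
          by (rule sums_finite) (auto simp: a_def)
        then show ?thesis by (simp add: c a_def)
      qed
      then have "norm (circ_avg N j (\<lambda>\<zeta>. q (vec_upd z i \<zeta>)) - a j) \<le> (\<Sum>l. norm (a (l + N)))" if "j < N" for j
        using that by (intro circ_avg_error everywhere_sums_summable_norm)
      then have "circ_avg N j (\<lambda>\<zeta>. q (vec_upd z i \<zeta>)) = c j" if "j < N" for j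
        using that by (simp add: a_def)
      then show ?thesis using c[of "z $ i"] by simp
    qed
    have "poly_fun (\<lambda>z. q (vec_upd z i \<omega>))" for \<omega>
    proof (rule insert.IH)
      show "q (vec_upd z i \<omega>) = q (vec_upd z' i \<omega>)" if "\<And>i. i \<in> S \<Longrightarrow> z $ i = z' $ i" for z z'
        using that by (intro insert.prems(1)) auto
      show "\<exists>c. \<forall>\<zeta>. q (vec_upd (vec_upd z j \<zeta>) i \<omega>) = (\<Sum>j<N. c j * \<zeta> ^ j)" for z j
      proof (cases "j = i")
        \<comment> \<open>After freezing, the function is constant in the coordinate
          \<open>i\<close>, so only the term \<open>j = 0\<close> occurs. With \<open>N = 0\<close>
          there is no such term, but then \<open>q\<close> vanishes.\<close>
        case True
        obtain c where c: "\<And>\<zeta>. q (vec_upd z i \<zeta>) = (\<Sum>j<N. c j * \<zeta> ^ j)"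
          using insert.prems(2) by blast
        show ?thesis
        proof (cases "N = 0")
          case True then show ?thesis using c \<open>j = i\<close> by simp
        next
          case False
          have "q (vec_upd z i \<omega>) = (\<Sum>j<N. (if j = 0 then q (vec_upd z i \<omega>) else 0) * \<zeta> ^ j)" for \<zeta>
            using False by (simp add: if_distrib[of "\<lambda>x. x * _"] cong: if_cong)
          then show ?thesis using True
            by (intro exI[of _ "\<lambda>j. if j = 0 then q (vec_upd z i \<omega>) else 0"]) simp
        qed
      next
        case False
        then show ?thesis using insert.prems(2)[of "vec_upd z i \<omega>" j] by (simp add: vec_upd_commute)
      qed
    qed
    then have "poly_fun (\<lambda>z. \<Sum>j<N. circ_avg N j (\<lambda>\<zeta>. q (vec_upd z i \<zeta>)) * (z $ i) ^ j)"
      unfolding circ_avg_def divide_inverse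
      by (intro poly_fun_sum poly_fun.mult poly_fun_power poly_fun.coord poly_fun.const)
    then show ?case unfolding eq[symmetric] by simp
  qed
  from this[of UNIV q] show ?thesis using assms by (metis UNIV_I finite_code vec_eq_iff)
qed

text \<open>In each variable separately the coefficient is entire and grows at most like the
  \<open>k\<close>-th power, so it is a polynomial of degree at most \<open>k\<close> by Liouville.
  The bound on the degree is uniform in the other variables, as
  \<open>poly_fun_if_separately_polynomial\<close> requires.\<close>

lemma line_coeff_poly_fun:
  fixes f :: "complex ^ 'n \<Rightarrow> complex"
  assumes "entire f" shows "poly_fun (line_coeff f k)"
proof (rule poly_fun_if_separately_polynomial)
  fix z :: "complex ^ 'n" and i :: 'n
  define a where "a = vec_upd z i 0"
  define v where "v = (axis i 1 :: complex ^ 'n)"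
  have upd: "vec_upd z i \<zeta> = a + \<zeta> *s v" for \<zeta>
    by (simp add: a_def v_def vec_eq_iff axis_def)
  obtain B where B: "B \<ge> 0" "\<And>z. norm (line_coeff f k z) \<le> B * norm z ^ k"
    using norm_line_coeff_growth[OF assms] by blast
  let ?\<phi> = "\<lambda>\<zeta>. line_coeff f k (a + \<zeta> *s v)"
  have "?\<phi> \<zeta> = (\<Sum>j\<le>k. (deriv ^^ j) ?\<phi> 0 / fact j * \<zeta> ^ j)" for \<zeta>
  proof (rule Liouville_polynomial[OF line_coeff_holomorphic[OF assms], where A = 1 and B = "B * (norm a + norm v) ^ k"])
    fix w :: complex assume w: "1 \<le> norm w"
    have "norm (a + w *s v) \<le> norm a + norm w * norm v"
      using norm_triangle_ineq[of a "w *s v"] by simp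
    also have "\<dots> \<le> norm w * norm a + norm w * norm v"
      using w by (simp add: mult_right_le_one_le mult_le_cancel_right1)
    finally have "norm (a + w *s v) \<le> (norm a + norm v) * norm w" by (simp add: algebra_simps)
    then have "B * norm (a + w *s v) ^ k \<le> B * ((norm a + norm v) * norm w) ^ k"
      using B(1) by (intro mult_left_mono power_mono) auto
    then show "norm (line_coeff f k (a + w *s v)) \<le> B * (norm a + norm v) ^ k * norm w ^ k"
      using B(2)[of "a + w *s v"] by (simp add: power_mult_distrib mult.assoc)
  qed
  then show "\<exists>c. \<forall>\<zeta>. line_coeff f k (vec_upd z i \<zeta>) = (\<Sum>j<Suc k. c j * \<zeta> ^ j)"
    unfolding upd lessThan_Suc_atMost by (intro exI[of _ "\<lambda>j. (deriv ^^ j) ?\<phi> 0 / fact j"]) blast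
qed

lemma homogeneous_poly_add:
  assumes "homogeneous_poly k p" "homogeneous_poly k q" shows "homogeneous_poly k (\<lambda>z. p z + q z)"
proof -
  obtain c d where
    "\<And>z. p z = (\<Sum>m\<in>{m. (\<Sum>i\<in>UNIV. m i) = k}. c m * (\<Prod>i\<in>UNIV. (z $ i) ^ m i))"
    "\<And>z. q z = (\<Sum>m\<in>{m. (\<Sum>i\<in>UNIV. m i) = k}. d m * (\<Prod>i\<in>UNIV. (z $ i) ^ m i))"
    using assms unfolding homogeneous_poly_def by blast
  then have "p z + q z = (\<Sum>m\<in>{m. (\<Sum>i\<in>UNIV. m i) = k}. (c m + d m) * (\<Prod>i\<in>UNIV. (z $ i) ^ m i))" for z
    by (simp add: sum.distrib distrib_right)
  then show ?thesis unfolding homogeneous_poly_def by (intro exI[of _ "\<lambda>m. c m + d m"]) blast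
qed

lemma homogeneous_poly_cmult:
  assumes "homogeneous_poly k p" shows "homogeneous_poly k (\<lambda>z. a * p z)"
proof -
  obtain c where
    "\<And>z. p z = (\<Sum>m\<in>{m. (\<Sum>i\<in>UNIV. m i) = k}. c m * (\<Prod>i\<in>UNIV. (z $ i) ^ m i))"
    using assms unfolding homogeneous_poly_def by blast
  then have "a * p z = (\<Sum>m\<in>{m. (\<Sum>i\<in>UNIV. m i) = k}. (a * c m) * (\<Prod>i\<in>UNIV. (z $ i) ^ m i))" for z
    by (simp add: sum_distrib_left mult.assoc)
  then show ?thesis unfolding homogeneous_poly_def by (intro exI[of _ "\<lambda>m. a * c m"]) blast
qed

lemma homogeneous_poly_zero [simp]: "homogeneous_poly k (\<lambda>_. 0)"
  unfolding homogeneous_poly_def by (intro exI[of _ "\<lambda>_. 0"]) simp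

lemma homogeneous_poly_sum:
  "(\<And>i. i \<in> I \<Longrightarrow> homogeneous_poly k (p i)) \<Longrightarrow> homogeneous_poly k (\<lambda>z. \<Sum>i\<in>I. p i z)"
  by (induction I rule: infinite_finite_induct) (auto intro: homogeneous_poly_add)

lemma homogeneous_poly_monomial:
  "homogeneous_poly (\<Sum>i\<in>UNIV. m i) (\<lambda>z :: complex ^ 'n. \<Prod>i\<in>UNIV. (z $ i) ^ m i)"
  unfolding homogeneous_poly_def
  by (intro exI[of _ "\<lambda>l. if l = m then 1 else 0"])
     (simp add: if_distrib[of "\<lambda>x. x * _"] finite_multi_indices cong: if_cong)

lemma homogeneous_poly_mult:
  fixes p q :: "complex ^ 'n \<Rightarrow> complex"
  assumes "homogeneous_poly k p" "homogeneous_poly l q"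
  shows "homogeneous_poly (k + l) (\<lambda>z. p z * q z)"
proof -
  obtain c d where
    p: "\<And>z. p z = (\<Sum>m\<in>{m. (\<Sum>i\<in>UNIV. m i) = k}. c m * (\<Prod>i\<in>UNIV. (z $ i) ^ m i))" and
    q: "\<And>z. q z = (\<Sum>m\<in>{m. (\<Sum>i\<in>UNIV. m i) = l}. d m * (\<Prod>i\<in>UNIV. (z $ i) ^ m i))"
    using assms unfolding homogeneous_poly_def by blast
  have "homogeneous_poly (k + l) (\<lambda>z. \<Sum>m\<in>{m. (\<Sum>i\<in>UNIV. m i) = k}. \<Sum>m'\<in>{m. (\<Sum>i\<in>UNIV. m i) = l}.
      (c m * d m') * (\<Prod>i\<in>UNIV. (z $ i) ^ (m i + m' i)))"
  proof (intro homogeneous_poly_sum homogeneous_poly_cmult)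
    fix m m' :: "'n \<Rightarrow> nat"
    assume "m \<in> {m. (\<Sum>i\<in>UNIV. m i) = k}" "m' \<in> {m. (\<Sum>i\<in>UNIV. m i) = l}"
    then have "(\<Sum>i\<in>UNIV. m i + m' i) = k + l" by (simp add: sum.distrib)
    then show "homogeneous_poly (k + l) (\<lambda>z :: complex ^ 'n. \<Prod>i\<in>UNIV. (z $ i) ^ (m i + m' i))"
      using homogeneous_poly_monomial[of "\<lambda>i. m i + m' i"] by simp
  qed
  moreover have "p z * q z = (\<Sum>m\<in>{m. (\<Sum>i\<in>UNIV. m i) = k}. \<Sum>m'\<in>{m. (\<Sum>i\<in>UNIV. m i) = l}.
      (c m * d m') * (\<Prod>i\<in>UNIV. (z $ i) ^ (m i + m' i)))" for z
    unfolding p q sum_product by (simp add: power_add prod.distrib mult_ac)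
  ultimately show ?thesis by presburger
qed

lemma homogeneous_poly_const: "homogeneous_poly 0 (\<lambda>_ :: complex ^ 'n. c)"
  using homogeneous_poly_cmult[OF homogeneous_poly_monomial[of "\<lambda>_ :: 'n. 0"], of c] by simp

lemma homogeneous_poly_coord: "homogeneous_poly 1 (\<lambda>z :: complex ^ 'n. z $ i)"
proof -
  have "(\<Prod>j\<in>UNIV. (z $ j) ^ (if j = i then 1 else 0)) = z $ i" for z :: "complex ^ 'n"
  proof -
    have "(\<Prod>j\<in>UNIV. (z $ j) ^ (if j = i then 1 else 0)) = (\<Prod>j\<in>UNIV. if j = i then z $ j else 1)"
      by (rule prod.cong) auto
    then show ?thesis by simp
  qed
  then show ?thesis
    using homogeneous_poly_monomial[of "\<lambda>j. if j = i then 1 else 0"] by simp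
qed

lemma homogeneous_poly_entire: "homogeneous_poly k q \<Longrightarrow> entire q"
proof -
  assume "homogeneous_poly k q"
  then obtain c where
    q: "q = (\<lambda>z. \<Sum>m\<in>{m. (\<Sum>i\<in>UNIV. m i) = k}. c m * (\<Prod>i\<in>UNIV. (z $ i) ^ m i))"
    unfolding homogeneous_poly_def by blast
  show ?thesis
    unfolding q by (intro entire_sum entire_mult entire_const entire_prod entire_power entire_coord)
qed

text \<open>Degrees may repeat in the list \<open>L\<close>, so that sums correspond to appended
  lists and products to lists of all pairs.\<close>

lemma poly_fun_homogeneous_decomposition:
  "poly_fun p \<Longrightarrow> \<exists>L. (\<forall>(d, q)\<in>set L. homogeneous_poly d q) \<and> (\<forall>z. p z = (\<Sum>(d, q)\<leftarrow>L. q z))"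
proof (induction rule: poly_fun.induct)
  case (const c)
  show ?case by (rule exI[of _ "[(0, \<lambda>_. c)]"]) (simp add: homogeneous_poly_const)
next
  case (coord i)
  show ?case by (rule exI[of _ "[(1, \<lambda>z. z $ i)]"]) (simp add: homogeneous_poly_coord[simplified])
next
  case (add f g)
  then obtain L M where "\<forall>(d, q)\<in>set L. homogeneous_poly d q" "\<forall>z. f z = (\<Sum>(d, q)\<leftarrow>L. q z)"
    "\<forall>(d, q)\<in>set M. homogeneous_poly d q" "\<forall>z. g z = (\<Sum>(d, q)\<leftarrow>M. q z)" by blast
  then show ?case by (intro exI[of _ "L @ M"]) auto
next
  case (mult f g)
  then obtain L M where L: "\<forall>(d, q)\<in>set L. homogeneous_poly d q" "\<forall>z. f z = (\<Sum>(d, q)\<leftarrow>L. q z)"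
    and M: "\<forall>(d, q)\<in>set M. homogeneous_poly d q" "\<forall>z. g z = (\<Sum>(d, q)\<leftarrow>M. q z)" by blast
  define P where "P = concat (map (\<lambda>(d, q). map (\<lambda>(e, r). (d + e, \<lambda>z. q z * r z)) M) L)"
  have "(\<Sum>(d, q)\<leftarrow>map (\<lambda>(e, r). (d + e, \<lambda>z. q z * r z)) M. q z) = q z * g z" for d q z
    unfolding M(2)[rule_format] by (induction M) (auto simp: distrib_left)
  then have "(\<Sum>(d, q)\<leftarrow>P. q z) = f z * g z" for z
    unfolding P_def L(2)[rule_format] by (induction L) (auto simp: distrib_right)
  moreover have "\<forall>(d, q)\<in>set P. homogeneous_poly d q"
    using L(1) M(1) by (fastforce simp: P_def intro: homogeneous_poly_mult)
  ultimately show ?case by (intro exI[of _ P]) auto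
qed

text \<open>For fixed \<open>z\<close> both sides of the scaling law are polynomials in the scalar
  \<open>c\<close>, and the right one is a single monomial. Comparing coefficients leaves only the
  pieces of degree \<open>k\<close>.\<close>

lemma poly_fun_scale_homogeneous_poly:
  assumes "poly_fun p" "\<And>c z. p (c *s z) = c ^ k * p z"
  shows "homogeneous_poly k p"
proof -
  obtain L where L: "\<forall>(d, q)\<in>set L. homogeneous_poly d q" "\<And>z. p z = (\<Sum>(d, q)\<leftarrow>L. q z)"
    using poly_fun_homogeneous_decomposition[OF assms(1)] by blast
  have 1: "p z = (\<Sum>(d, q)\<leftarrow>filter (\<lambda>(d, q). d = k) L. q z)" for z
  proof -
    have "poly (\<Sum>(d, q)\<leftarrow>L. monom (q z) d) c = (\<Sum>(d, q)\<leftarrow>L. q (c *s z))" for c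
    proof -
      have "\<forall>(d, q)\<in>set M. homogeneous_poly d q \<Longrightarrow> poly (\<Sum>(d, q)\<leftarrow>M. monom (q z) d) c = (\<Sum>(d, q)\<leftarrow>M. q (c *s z))" for M
      proof (induction M)
        case (Cons x M)
        then show ?case
          using homogeneous_poly_scale[of "fst x" "snd x" c z]
          by (cases x) (simp add: poly_monom mult.commute)
      qed simp
      then show ?thesis using L(1) .
    qed
    then have "poly (\<Sum>(d, q)\<leftarrow>L. monom (q z) d) c = poly (monom (p z) k) c" for c
      using L(2)[of "c *s z"] assms(2)[of c z] by (simp add: poly_monom mult.commute)
    then have "(\<Sum>(d, q)\<leftarrow>L. monom (q z) d) = monom (p z) k"
      by (intro poly_eq_poly_eq_iff[THEN iffD1] ext)
    then have "p z = coeff (\<Sum>(d, q)\<leftarrow>L. monom (q z) d) k" by simp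
    also have "\<dots> = (\<Sum>(d, q)\<leftarrow>filter (\<lambda>(d, q). d = k) L. q z)"
    proof -
      have "coeff (\<Sum>(d, q)\<leftarrow>M. monom (q z) d) k = (\<Sum>(d, q)\<leftarrow>filter (\<lambda>(d, q). d = k) M. q z)" for M
        by (induction M) auto
      then show ?thesis .
    qed
    finally show ?thesis .
  qed
  have "homogeneous_poly k (\<lambda>z. \<Sum>(d, q)\<leftarrow>filter (\<lambda>(d, q). d = k) L. q z)"
  proof -
    have "\<forall>(d, q)\<in>set M. homogeneous_poly d q \<Longrightarrow> homogeneous_poly k (\<lambda>z. \<Sum>(d, q)\<leftarrow>filter (\<lambda>(d, q). d = k) M. q z)" for M
    proof (induction M)
      case (Cons x M)
      then show ?case by (cases x) (auto intro: homogeneous_poly_add)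
    qed simp
    then show ?thesis using L(1) .
  qed
  moreover have "p = (\<lambda>z. \<Sum>(d, q)\<leftarrow>filter (\<lambda>(d, q). d = k) L. q z)" using 1 by (rule ext)
  ultimately show ?thesis by simp
qed

section \<open>Homogeneous expansions and Cauchy estimates\<close>

lemma entire_homogeneous_expansion:
  assumes "entire f" shows "homogeneous_expansion f (line_coeff f)"
  unfolding homogeneous_expansion_def
proof (intro conjI allI)
  show "homogeneous_poly k (line_coeff f k)" for k
    by (intro poly_fun_scale_homogeneous_poly line_coeff_poly_fun line_coeff_scale assms)
  show "(\<lambda>k. line_coeff f k z) sums f z" for z
    using line_coeff_sums[OF assms, of z 1] by simp
qed

lemma homogeneous_part_eq: "homogeneous_expansion f q \<Longrightarrow> homogeneous_part f = q"
  unfolding homogeneous_part_def using homogeneous_expansion_unique by blast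

lemma homogeneous_expansion_homogeneous_part:
  "entire f \<Longrightarrow> homogeneous_expansion f (homogeneous_part f)"
  using homogeneous_part_eq entire_homogeneous_expansion by metis

lemma homogeneous_expansion_line_sums:
  assumes "homogeneous_expansion f q" shows "(\<lambda>k. q k z * w ^ k) sums f (w *s z)"
  using assms homogeneous_poly_scale[of _ "q _" w z] unfolding homogeneous_expansion_def
  by (metis (no_types, lifting) ext mult.commute)

lemma homogeneous_expansion_summable:
  "homogeneous_expansion f q \<Longrightarrow> summable (\<lambda>k. norm (q k z))"
  by (rule everywhere_sums_summable_norm[OF homogeneous_expansion_line_sums])

lemma homogeneous_expansion_circ_avg:
  "homogeneous_expansion f q \<Longrightarrow> (\<lambda>N. circ_avg N k (\<lambda>w. f (w *s z))) \<longlonglongrightarrow> q k z"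
  by (intro circ_avg_tendsto homogeneous_expansion_summable homogeneous_expansion_line_sums)

lemma homogeneous_expansion_norm_le:
  assumes "homogeneous_expansion f q" "\<And>w. norm w = norm z \<Longrightarrow> norm (f w) \<le> B"
  shows "norm (q k z) \<le> B"
proof (rule LIMSEQ_le_const2[OF tendsto_norm[OF homogeneous_expansion_circ_avg[OF assms(1)]]])
  have "0 \<le> B" using assms(2)[of z] norm_ge_zero order_trans by blast
  then show "\<exists>N. \<forall>n\<ge>N. norm (circ_avg n k (\<lambda>w. f (w *s z))) \<le> B"
    using assms(2) by (intro exI[of _ 0] allI impI norm_circ_avg_le) auto
qed

text \<open>Cauchy's estimate on the sphere of radius \<open>r * norm z\<close>. The factor
  \<open>r\<close> stays free: later it is 2, or fits a sphere of fixed radius, or trades a little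
  Gaussian growth for geometric decay in \<open>k\<close>.\<close>

lemma homogeneous_expansion_norm_le_scaled:
  assumes q: "homogeneous_expansion f q" and "r > 0" "\<And>w. norm w = r * norm z \<Longrightarrow> norm (f w) \<le> B"
  shows "norm (q k z) \<le> B / r ^ k"
proof -
  have "norm (q k (of_real r *s z)) \<le> B"
    using assms by (intro homogeneous_expansion_norm_le[OF q]) auto
  moreover have "q k (of_real r *s z) = of_real r ^ k * q k z"
    using q homogeneous_poly_scale unfolding homogeneous_expansion_def by blast
  ultimately show ?thesis using \<open>r > 0\<close>
    by (simp add: norm_mult norm_power field_simps)
qed

text \<open>Boundedness on balls makes the homogeneous parts decay geometrically there. Cauchy's
  inequality on complex lines carries the decay over to their Frechet derivatives, so the series can
  be differentiated term by term, and complex linearity passes to the limit.\<close>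

lemma entire_if_homogeneous_expansion:
  fixes f :: "complex ^ 'n \<Rightarrow> complex"
  assumes q: "homogeneous_expansion f q"
    and bd: "\<And>R. \<exists>B. \<forall>z. norm z \<le> R \<longrightarrow> norm (f z) \<le> B"
  shows "entire f"
proof -
  have "\<forall>k. entire (q k)" using q homogeneous_poly_entire unfolding homogeneous_expansion_def by blast
  then obtain D where D: "\<And>k z. (q k has_derivative D k z) (at z)" "\<And>k z c v. D k z (c *s v) = c * D k z v"
    unfolding entire_def by metis
  have bound: "\<exists>B\<ge>0. \<forall>z k v. norm z \<le> R \<longrightarrow> norm (D k z v) \<le> B / 2 ^ k * norm v" for R
  proof -
    obtain B where B: "\<And>z. norm z \<le> 2 * (R + 1) \<Longrightarrow> norm (f z) \<le> B"
      using bd by meson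
    have qb: "norm (q k z) \<le> max B 0 / 2 ^ k" if "norm z \<le> R + 1" for k z
      using that by (intro homogeneous_expansion_norm_le_scaled[OF q] max.coboundedI1 B) auto
    have "norm (D k z v) \<le> max B 0 / 2 ^ k * norm v" if z: "norm z \<le> R" for k z v
    proof (cases "v = 0")
      case True
      then show ?thesis using D(2)[of k z 0 v] by simp
    next
      case False
      let ?h = "\<lambda>w. q k (z + w *s v)"
      have hol: "?h holomorphic_on S" for S
        using q homogeneous_poly_entire entire_line_holomorphic unfolding homogeneous_expansion_def by blast
      have "(?h has_field_derivative D k z v) (at 0)"
        using entire_line_has_field_derivative[of "q k" "D k z" z 0 v] D by simp
      then have "D k z v = deriv ?h 0" by (simp add: DERIV_imp_deriv)
      \<comment> \<open>The radius \<open>1 / norm v\<close> makes the displacement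
        \<open>x *s v\<close> a unit vector, so the circle stays in the ball of radius
        \<open>R + 1\<close>; dividing by it produces the factor \<open>norm v\<close>.\<close>
      moreover have "norm ((deriv ^^ 1) ?h 0) \<le> fact 1 * (max B 0 / 2 ^ k) / (1 / norm v) ^ 1"
      proof (rule Cauchy_inequality)
        show "norm (?h x) \<le> max B 0 / 2 ^ k" if "norm (0 - x) = 1 / norm v" for x
        proof (rule qb)
          have "norm (x *s v) = 1" using that False by simp
          then show "norm (z + x *s v) \<le> R + 1"
            using z norm_triangle_ineq[of z "x *s v"] by simp
        qed
      qed (use False hol holomorphic_on_imp_continuous_on in auto)
      ultimately show ?thesis by simp
    qed
    then show ?thesis by (intro exI[of _ "max B 0"]) auto
  qed
  define D' where "D' z v = (\<Sum>k. D k z v)" for z v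
  have summ: "summable (\<lambda>k. norm (D k z v))" for z v
  proof -
    obtain B where B: "\<And>k. norm (D k z v) \<le> B / 2 ^ k * norm v" using bound[of "norm z"] by blast
    have "summable (\<lambda>k. (B * norm v) * (1 / 2) ^ k)"
      by (intro summable_mult summable_geometric) simp
    then show ?thesis
      by (rule summable_comparison_test') (use B in \<open>auto simp: power_divide\<close>)
  qed
  show ?thesis
  proof (rule entireI)
    fix z :: "complex ^ 'n"
    define R where "R = norm z + 1"
    obtain B where B: "B \<ge> 0" "\<And>z k v. norm z \<le> R \<Longrightarrow> norm (D k z v) \<le> B / 2 ^ k * norm v"
      using bound[of R] by blast
    have "\<exists>g. \<forall>x\<in>ball 0 R. (\<lambda>k. q k x) sums g x \<and> (g has_derivative D' x) (at x within ball 0 R)"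
    proof (rule has_derivative_series[where f' = D and x = z and l = "f z"])
      show "(q k has_derivative D k x) (at x within ball 0 R)" for k x
        using D(1) has_derivative_at_withinI by blast
      show "z \<in> ball 0 R" by (simp add: R_def)
      show "(\<lambda>k. q k z) sums f z" using q unfolding homogeneous_expansion_def by blast
      fix e :: real assume "e > 0"
      have "(\<lambda>N. 2 * B / 2 ^ N) \<longlonglongrightarrow> 0" by real_asymp
      then have "\<forall>\<^sub>F N in sequentially. 2 * B / 2 ^ N < e"
        using \<open>e > 0\<close> by (rule order_tendstoD)
      then show "\<forall>\<^sub>F N in sequentially. \<forall>x\<in>ball 0 R. \<forall>h. norm ((\<Sum>i<N. D i x h) - D' x h) \<le> e * norm h"
      proof eventually_elim
        case (elim N)
        show ?case
        proof (intro ballI allI)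
          fix x h :: "complex ^ 'n" assume "x \<in> ball 0 R"
          then have b: "norm (D k x h) \<le> B / 2 ^ k * norm h" for k using B by simp
          have gs: "(\<lambda>l. B / 2 ^ (l + N) * norm h) sums (2 * B / 2 ^ N * norm h)"
            using sums_mult[OF geometric_sums[of "1/2::real"], of "B / 2 ^ N * norm h"]
            by (simp add: power_add field_simps)
          have smN: "summable (\<lambda>l. norm (D (l + N) x h))"
            using summ summable_iff_shift[of "\<lambda>l. norm (D l x h)" N] by simp
          have "D' x h - (\<Sum>i<N. D i x h) = (\<Sum>l. D (l + N) x h)"
            unfolding D'_def by (rule suminf_minus_initial_segment[symmetric]) (rule summable_norm_cancel[OF summ])
          then have "norm ((\<Sum>i<N. D i x h) - D' x h) = norm (\<Sum>l. D (l + N) x h)"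
            by (metis norm_minus_commute)
          also have "\<dots> \<le> (\<Sum>l. norm (D (l + N) x h))" by (rule summable_norm[OF smN])
          also have "\<dots> \<le> (\<Sum>l. B / 2 ^ (l + N) * norm h)"
            by (rule suminf_le[OF _ smN sums_summable[OF gs]]) (rule b)
          also have "\<dots> = 2 * B / 2 ^ N * norm h" using gs sums_unique by metis
          also have "\<dots> \<le> e * norm h" using elim by (intro mult_right_mono) auto
          finally show "norm ((\<Sum>i<N. D i x h) - D' x h) \<le> e * norm h" .
        qed
      qed
    qed simp
    then obtain g where g: "\<And>x. x \<in> ball 0 R \<Longrightarrow> (\<lambda>k. q k x) sums g x"
        "\<And>x. x \<in> ball 0 R \<Longrightarrow> (g has_derivative D' x) (at x within ball 0 R)" by blast
    have gf: "g x = f x" if "x \<in> ball 0 R" for x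
      using g(1)[OF that] q sums_unique2 unfolding homogeneous_expansion_def by blast
    have zR: "z \<in> ball 0 R" by (simp add: R_def)
    have "(f has_derivative D' z) (at z within ball 0 R)"
      using g(2)[OF zR] by (rule has_derivative_transform_within[of _ _ _ _ 1]) (use zR gf in auto)
    then show "(f has_derivative D' z) (at z)"
      using zR by (simp add: at_within_open[OF zR])
    show "D' z (c *s v) = c * D' z v" for c v
      unfolding D'_def D(2) by (rule suminf_mult) (rule summable_norm_cancel[OF summ])
  qed
qed

lemma measurable_fock_volume [simp]:
  "measurable (fock_volume :: (complex ^ 'n) measure) N = measurable borel N"
  by (rule measurable_cong_sets) simp_all

section \<open>Gaussian integrals, mean values and pointwise estimates\<close>

lemma one_plus_powr_le_exp: "0 \<le> r \<Longrightarrow> (1 + r) powr a \<le> exp (\<bar>a\<bar> * r)" for a r :: real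
proof -
  assume r: "0 \<le> r"
  have "a * ln (1 + r) \<le> \<bar>a\<bar> * r"
    using r ln_add_one_self_le_self[of r] ln_ge_zero[of "1 + r"]
    by (intro mult_mono) auto
  then show ?thesis using r by (simp add: powr_def)
qed

text \<open>Both factors together are at most \<open>exp (d * r)\<close> with
  \<open>d = \<bar>a\<bar> + \<bar>b\<bar>\<close>, and completing the square trades this for an
  arbitrarily narrow Gaussian factor.\<close>

lemma powr_exp_le_gauss:
  fixes a b c r :: real
  assumes "0 \<le> r" "0 < c"
  shows "(1 + r) powr a * exp (b * r) \<le> exp ((\<bar>a\<bar> + \<bar>b\<bar>)\<^sup>2 / (4 * c)) * exp (c * r\<^sup>2)"
proof -
  define d where "d = \<bar>a\<bar> + \<bar>b\<bar>"
  have "0 \<le> (d - 2 * c * r)\<^sup>2 / (4 * c)" using assms by simp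
  also have "\<dots> = d\<^sup>2 / (4 * c) + c * r\<^sup>2 - d * r"
    using assms by (simp add: field_simps power2_eq_square)
  finally have 1: "d * r \<le> d\<^sup>2 / (4 * c) + c * r\<^sup>2" by simp
  have "(1 + r) powr a * exp (b * r) \<le> exp (\<bar>a\<bar> * r) * exp (\<bar>b\<bar> * r)"
    using assms one_plus_powr_le_exp[of r a] by (intro mult_mono) (auto intro: mult_right_mono)
  also have "\<dots> = exp (d * r)" by (simp add: d_def distrib_right exp_add)
  also have "\<dots> \<le> exp (d\<^sup>2 / (4 * c) + c * r\<^sup>2)" using 1 by simp
  finally show ?thesis by (simp add: d_def exp_add)
qed

text \<open>Positive bases that are comparable up to \<open>t\<close> have comparable powers,
  whatever the sign of the exponent.\<close>

lemma powr_quotient_le: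
  fixes x y t \<gamma> :: real
  assumes "0 < x" "0 < y" "1 \<le> t" "x \<le> y * t" "y \<le> x * t"
  shows "x powr \<gamma> \<le> y powr \<gamma> * t powr \<bar>\<gamma>\<bar>"
proof (cases "\<gamma> \<ge> 0")
  case True
  then have "x powr \<gamma> \<le> (y * t) powr \<gamma>" using assms by (intro powr_mono2) auto
  then show ?thesis using assms True by (simp add: powr_mult)
next
  case False
  then have "(x * t) powr \<gamma> \<le> y powr \<gamma>" using assms by (intro powr_mono2') auto
  then have "x powr \<gamma> * t powr \<gamma> * t powr - \<gamma> \<le> y powr \<gamma> * t powr - \<gamma>"
    using assms by (intro mult_right_mono) (auto simp: powr_mult)
  then show ?thesis using assms False by (simp add: mult.assoc flip: powr_add)
qed

lemma peetre:
  fixes z u :: "'a::real_normed_vector"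
  shows "(1 + norm (u + z)) powr \<gamma> \<le> (1 + norm z) powr \<gamma> * (1 + norm u) powr \<bar>\<gamma>\<bar>"
proof (rule powr_quotient_le)
  show "1 + norm (u + z) \<le> (1 + norm z) * (1 + norm u)"
  proof -
    have "(1 + norm z) * (1 + norm u) = 1 + norm u + norm z + norm u * norm z" by (simp add: algebra_simps)
    then show ?thesis using norm_triangle_ineq[of u z] mult_nonneg_nonneg[OF norm_ge_zero[of u] norm_ge_zero[of z]]
      by linarith
  qed
  have "norm z \<le> norm (u + z) + norm u" using norm_triangle_ineq4[of "u + z" u] by simp
  then show "1 + norm z \<le> (1 + norm (u + z)) * (1 + norm u)"
  proof -
    have "(1 + norm (u + z)) * (1 + norm u) = 1 + norm u + norm (u + z) + norm (u + z) * norm u" by (simp add: algebra_simps)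
    then show ?thesis using \<open>norm z \<le> norm (u + z) + norm u\<close> mult_nonneg_nonneg[OF norm_ge_zero[of "u + z"] norm_ge_zero[of u]]
      by linarith
  qed
qed (auto intro: add_pos_nonneg)

lemma gauss_integrable:
  assumes "c > 0" shows "integrable fock_volume (\<lambda>z :: complex ^ 'n. exp (- c * (norm z)\<^sup>2))"
proof -
  have "integrable fock_volume (\<lambda>z :: complex ^ 'n. exp (- (norm z)\<^sup>2))"
    by (rule integrableI_nonneg) (auto simp: fock_volume_normalized)
  from has_bochner_integral_scale(1)[OF _ this, of "sqrt c"] assms show ?thesis
    by (simp add: power_mult_distrib)
qed

text \<open>Half of the Gaussian absorbs the growth factors and the other half is integrable.
  Depending on \<open>norm z\<close> only, these functions serve as rotation invariant majorants
  later.\<close>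

lemma gauss_growth_integrable:
  assumes "c > 0"
  shows "integrable fock_volume (\<lambda>z :: complex ^ 'n. (1 + norm z) powr a * exp (b * norm z) * exp (- c * (norm z)\<^sup>2))"
proof (rule Bochner_Integration.integrable_bound)
  show "integrable fock_volume (\<lambda>z :: complex ^ 'n. exp ((\<bar>a\<bar> + \<bar>b\<bar>)\<^sup>2 / (4 * (c/2))) * exp (- (c/2) * (norm z)\<^sup>2))"
    using assms by (intro integrable_mult_right gauss_integrable) simp
  show "AE z in fock_volume. norm ((1 + norm z) powr a * exp (b * norm z) * exp (- c * (norm (z :: complex ^ 'n))\<^sup>2))
     \<le> norm (exp ((\<bar>a\<bar> + \<bar>b\<bar>)\<^sup>2 / (4 * (c/2))) * exp (- (c/2) * (norm z)\<^sup>2))"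
  proof (rule AE_I2)
    fix z :: "complex ^ 'n"
    have "(1 + norm z) powr a * exp (b * norm z) * exp (- c * (norm z)\<^sup>2)
      \<le> exp ((\<bar>a\<bar> + \<bar>b\<bar>)\<^sup>2 / (4 * (c/2))) * exp (c/2 * (norm z)\<^sup>2) * exp (- c * (norm z)\<^sup>2)"
      using assms powr_exp_le_gauss[of "norm z" "c/2" a b] by (intro mult_right_mono) auto
    also have "exp (c/2 * (norm z)\<^sup>2) * exp (- c * (norm z)\<^sup>2) = exp (- (c/2) * (norm z)\<^sup>2)"
      by (simp add: field_simps flip: exp_add)
    then have "exp ((\<bar>a\<bar> + \<bar>b\<bar>)\<^sup>2 / (4 * (c/2))) * exp (c/2 * (norm z)\<^sup>2) * exp (- c * (norm z)\<^sup>2)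
      = exp ((\<bar>a\<bar> + \<bar>b\<bar>)\<^sup>2 / (4 * (c/2))) * exp (- (c/2) * (norm z)\<^sup>2)"
      by (simp add: mult.assoc)
    finally show "norm ((1 + norm z) powr a * exp (b * norm z) * exp (- c * (norm z)\<^sup>2))
     \<le> norm (exp ((\<bar>a\<bar> + \<bar>b\<bar>)\<^sup>2 / (4 * (c/2))) * exp (- (c/2) * (norm z)\<^sup>2))"
      by (simp add: abs_mult)
  qed
qed simp

section \<open>Orthogonality of degrees and mean values\<close>

lemma borel_measurable_cnj_of_real [measurable]:
  "f \<in> borel_measurable M \<Longrightarrow> (\<lambda>x. cnj (f x)) \<in> borel_measurable M"
  "g \<in> borel_measurable M \<Longrightarrow> (\<lambda>x. complex_of_real (g x)) \<in> borel_measurable M"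
  by (rule borel_measurable_continuous_on[where f = cnj], intro continuous_intros, assumption)
     (rule borel_measurable_continuous_on[where f = complex_of_real], intro continuous_intros, assumption)

text \<open>A radial weight sees only the part of \<open>g\<close> of the same degree as
  \<open>q\<close>. Averaging the integrand over the \<open>N\<close>-th roots of unity leaves the
  integral unchanged and replaces \<open>g\<close> by \<open>circ_avg N k\<close>, which tends to
  \<open>h k\<close>; the rotation invariant majorant \<open>D\<close> dominates all the
  averages.\<close>

lemma integral_homogeneous_component:
  fixes g :: "complex ^ 'n \<Rightarrow> complex" and \<phi> :: "complex ^ 'n \<Rightarrow> real"
  assumes q: "\<And>c z. norm c = 1 \<Longrightarrow> q (c *s z) = c ^ k * q z" and [measurable]: "q \<in> borel_measurable borel"
    and g: "homogeneous_expansion g h" "entire g"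
    and \<phi>: "\<And>c z. norm c = 1 \<Longrightarrow> \<phi> (c *s z) = \<phi> z" and [measurable]: "\<phi> \<in> borel_measurable borel"
    and D: "integrable fock_volume D" "\<And>c z. norm c = 1 \<Longrightarrow> D (c *s z) = D z"
      "\<And>z. norm (q z * cnj (g z) * \<phi> z) \<le> D z"
  shows "(LINT z|fock_volume. q z * cnj (g z) * \<phi> z) = (LINT z|fock_volume. q z * cnj (h k z) * \<phi> z)"
proof -
  have [measurable]: "g \<in> borel_measurable borel" by (rule entire_measurable[OF g(2)])
  define F where "F z = q z * cnj (g z) * \<phi> z" for z
  have Fm [measurable]: "F \<in> borel_measurable borel" unfolding F_def by measurable
  define \<omega> where "\<omega> N j = cis (2 * pi * real j / real N)" for N j :: nat
  have \<omega>: "norm (\<omega> N j) = 1" for N j by (simp add: \<omega>_def)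
  define G where "G N z = (\<Sum>j<N. F (\<omega> N j *s z)) / of_nat N" for N z
  have eq: "q z * cnj (circ_avg N k (\<lambda>w. g (w *s z))) * \<phi> z = G N z" for N z
    unfolding G_def circ_avg_def F_def \<omega>_def[symmetric]
    by (simp add: q \<phi> \<omega> sum_distrib_left sum_distrib_right sum_divide_distrib mult_ac)
  have Fint: "integrable fock_volume (\<lambda>z. F (w *s z))" if "norm w = 1" for w
    by (rule Bochner_Integration.integrable_bound[OF D(1)])
       (use D(3)[of "w *s _"] D(2)[OF that] in \<open>auto simp: F_def intro!: order_trans[OF _ abs_ge_self]\<close>)
  have "(LINT z|fock_volume. G N z) = (LINT z|fock_volume. F z)" if "N > 0" for N
  proof -
    have "(LINT z|fock_volume. G N z) = (\<Sum>j<N. LINT z|fock_volume. F (\<omega> N j *s z)) / of_nat N"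
      unfolding G_def by (subst integral_divide_zero) (simp add: Bochner_Integration.integral_sum Fint \<omega>)
    also have "\<dots> = (LINT z|fock_volume. F z)"
      using that by (simp add: integral_rotate[OF \<omega> Fm])
    finally show ?thesis .
  qed
  then have "\<forall>\<^sub>F N in sequentially. (LINT z|fock_volume. F z) = (LINT z|fock_volume. G N z)"
    by (intro eventually_mono[OF eventually_gt_at_top[of 0]]) simp
  then have "(\<lambda>N. LINT z|fock_volume. G N z) \<longlonglongrightarrow> (LINT z|fock_volume. F z)"
    by (rule Lim_transform_eventually[OF tendsto_const])
  moreover have "(\<lambda>N. LINT z|fock_volume. G N z) \<longlonglongrightarrow> (LINT z|fock_volume. q z * cnj (h k z) * \<phi> z)"
  proof (rule integral_dominated_convergence[where w = D])
    have "homogeneous_poly k (h k)" using g(1) unfolding homogeneous_expansion_def by blast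
    then have [measurable]: "h k \<in> borel_measurable borel"
      by (intro entire_measurable homogeneous_poly_entire)
    show "(\<lambda>z. q z * cnj (h k z) * \<phi> z) \<in> borel_measurable fock_volume" by measurable
    show "G N \<in> borel_measurable fock_volume" for N
      unfolding G_def by measurable
    show "AE z in fock_volume. (\<lambda>N. G N z) \<longlonglongrightarrow> q z * cnj (h k z) * \<phi> z"
      unfolding eq[symmetric]
      by (intro AE_I2 tendsto_intros homogeneous_expansion_circ_avg[OF g(1)])
    show "AE z in fock_volume. norm (G N z) \<le> D z" for N
    proof (rule AE_I2)
      fix z
      have "norm (\<Sum>j<N. F (\<omega> N j *s z)) \<le> (\<Sum>j<N. D z)"
        using D(2,3) \<omega> unfolding F_def by (intro sum_norm_le) metis
      then have "norm (G N z) \<le> D z" if "N > 0" using that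
        by (simp add: G_def norm_divide divide_le_eq mult.commute)
      \<comment> \<open>Needed at \<open>N = 0\<close>, where division by zero makes
        \<open>G\<close> vanish.\<close>
      moreover have "0 \<le> D z" using D(3)[of z] norm_ge_zero order_trans by blast
      ultimately show "norm (G N z) \<le> D z" by (cases "N = 0") (auto simp: G_def)
    qed
  qed (rule D(1))
  ultimately show ?thesis unfolding F_def by (rule LIMSEQ_unique)
qed

lemma homogeneous_expansion_0: "homogeneous_expansion f q \<Longrightarrow> q 0 z = f 0"
  using homogeneous_expansion_line_sums[of f q z 0] powser_sums_zero sums_unique2
  by (metis vector_smult_lzero)

text \<open>The case \<open>q = 1\<close>, \<open>k = 0\<close>, in which the homogeneous part is
  the constant \<open>F 0\<close>. The conjugate of the whole identity is taken because
  \<open>integral_homogeneous_component\<close> conjugates its second function.\<close>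

lemma integral_mean_value:
  fixes F :: "complex ^ 'n \<Rightarrow> complex" and \<phi> :: "complex ^ 'n \<Rightarrow> real"
  assumes F: "entire F"
    and \<phi>: "\<And>c z. norm c = 1 \<Longrightarrow> \<phi> (c *s z) = \<phi> z" and [measurable]: "\<phi> \<in> borel_measurable borel"
    and D: "integrable fock_volume D" "\<And>c z. norm c = 1 \<Longrightarrow> D (c *s z) = D z"
      "\<And>z. norm (F z * \<phi> z) \<le> D z"
  shows "(LINT z|fock_volume. F z * \<phi> z) = F 0 * complex_of_real (LINT z|fock_volume. \<phi> z)"
proof -
  have "(LINT z|fock_volume. 1 * cnj (F z) * \<phi> z) = (LINT z|fock_volume. 1 * cnj (homogeneous_part F 0 z) * \<phi> z)"
    by (rule integral_homogeneous_component[OF _ _ homogeneous_expansion_homogeneous_part F _ _ D(1)])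
       (use F \<phi> D in \<open>auto simp: norm_mult\<close>)
  also have "\<dots> = cnj (F 0) * complex_of_real (LINT z|fock_volume. \<phi> z)"
    by (simp add: homogeneous_expansion_0[OF homogeneous_expansion_homogeneous_part[OF F]] integral_complex_of_real)
  finally have "(LINT z|fock_volume. cnj (F z * \<phi> z)) = cnj (F 0 * complex_of_real (LINT z|fock_volume. \<phi> z))"
    by simp
  moreover have "(LINT z|fock_volume. cnj (F z * \<phi> z)) = cnj (LINT z|fock_volume. F z * \<phi> z)"
    by (rule Bochner_Integration.integral_cnj)
  ultimately show ?thesis by (simp only: complex_cnj_cancel_iff)
qed

lemma emeasure_fock_ball_finite: "emeasure fock_volume (ball (a :: complex ^ 'n) r) < \<infinity>"
  using emeasure_lborel_ball_finite[of a r]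
  by (simp add: emeasure_fock_volume ennreal_mult_less_top top.not_eq_extremum)

lemma indicator_ball_integrable: "integrable fock_volume (\<lambda>z :: complex ^ 'n. indicator (ball a r) z :: real)"
  using emeasure_fock_ball_finite by (simp add: integrable_indicator_iff)

lemma indicator_ball_integrable_continuous:
  fixes g :: "complex ^ 'n \<Rightarrow> real"
  assumes "continuous_on UNIV g" shows "integrable fock_volume (\<lambda>z. indicator (ball a r) z * g z)"
proof -
  have "compact (g ` cball a r)"
    by (intro compact_continuous_image compact_cball continuous_on_subset[OF assms]) simp
  then obtain B where B: "\<And>z. z \<in> cball a r \<Longrightarrow> norm (g z) \<le> B"
    by (metis bounded_iff compact_imp_bounded image_eqI)
  have [measurable]: "g \<in> borel_measurable borel" by (rule borel_measurable_continuous_onI[OF assms])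
  show ?thesis
  proof (rule Bochner_Integration.integrable_bound)
    show "integrable fock_volume (\<lambda>z. B * indicator (ball a r) z)"
      by (intro integrable_mult_right indicator_ball_integrable)
    show "AE z in fock_volume. norm (indicator (ball a r) z * g z) \<le> norm (B * indicator (ball a r) z)"
    proof (rule AE_I2)
      fix z
      show "norm (indicator (ball a r) z * g z) \<le> norm (B * indicator (ball a r) z)"
        using B[of z] by (cases "z \<in> ball a r") auto
    qed
    show "(\<lambda>z. indicator (ball a r) z * g z) \<in> borel_measurable fock_volume"
      unfolding measurable_fock_volume by (intro borel_measurable_times borel_measurable_indicator) auto
  qed
qed

lemma measure_fock_ball:
  "measure fock_volume (ball (0 :: complex ^ 'n) 1) > 0"
  "r > 0 \<Longrightarrow> measure fock_volume (ball (0 :: complex ^ 'n) r) = measure fock_volume (ball (0 :: complex ^ 'n) 1) * r ^ (2 * CARD('n))"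
proof -
  have "emeasure lborel (ball (0 :: complex ^ 'n) 1) > 0" by (simp add: emeasure_ball unit_ball_vol_pos)
  then have "emeasure fock_volume (ball (0 :: complex ^ 'n) 1) > 0"
    by (simp add: emeasure_fock_volume ennreal_zero_less_mult_iff)
  then show "measure fock_volume (ball (0 :: complex ^ 'n) 1) > 0"
    using emeasure_fock_ball_finite[of "0 :: complex ^ 'n" 1] by (simp add: measure_def enn2real_positive_iff)
  assume r: "r > 0"
  have "(LINT z|fock_volume. indicator (ball (0 :: complex ^ 'n) r) z :: real) = r ^ (2 * CARD('n)) * (LINT z|fock_volume. indicator (ball (0 :: complex ^ 'n) r) (r *\<^sub>R z))"
    using has_bochner_integral_scale(2)[OF r indicator_ball_integrable[of "0 :: complex ^ 'n" r]] by simp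
  also have "(\<lambda>z. indicator (ball (0 :: complex ^ 'n) r) (r *\<^sub>R z) :: real) = indicator (ball 0 1)"
    using r by (auto simp: indicator_def fun_eq_iff)
  finally show "measure fock_volume (ball (0 :: complex ^ 'n) r) = measure fock_volume (ball (0 :: complex ^ 'n) 1) * r ^ (2 * CARD('n))"
    by (simp add: mult.commute)
qed

lemma submean_ball:
  fixes F :: "complex ^ 'n \<Rightarrow> complex"
  assumes "entire F"
  shows "norm (F a) * measure fock_volume (ball (0 :: complex ^ 'n) r) \<le> (LINT z|fock_volume. indicator (ball 0 r) z * norm (F (z + a)))"
proof -
  define G where "G z = F (1 *s z + a)" for z
  have G: "entire G" unfolding G_def by (rule entire_affine[OF assms])
  obtain B where B: "B \<ge> 0" "\<And>z. norm z \<le> r \<Longrightarrow> norm (G z) \<le> B"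
    using entire_bounded_on_ball[OF G] by blast
  have "(LINT z|fock_volume. G z * (indicator (ball 0 r) z :: real)) = G 0 * complex_of_real (LINT z|fock_volume. indicator (ball (0 :: complex ^ 'n) r) z)"
  proof (rule integral_mean_value[OF G, where D = "\<lambda>z. B * indicator (ball 0 r) z" and \<phi> = "indicator (ball 0 r)"])
    show "integrable fock_volume (\<lambda>z :: complex ^ 'n. B * indicator (ball 0 r) z)"
      by (intro integrable_mult_right indicator_ball_integrable)
    show "norm (G z * (indicator (ball 0 r) z :: real)) \<le> B * indicator (ball 0 r) z" for z
      using B(2)[of z] by (cases "z \<in> ball 0 r") auto
    show "indicator (ball 0 r) \<in> borel_measurable borel"
      by (intro borel_measurable_indicator) simp
  qed (auto simp: indicator_def)
  then have "norm (G 0 * measure fock_volume (ball (0 :: complex ^ 'n) r)) \<le> (LINT z|fock_volume. norm (G z * (indicator (ball 0 r) z :: real)))"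
    using integral_norm_bound[of fock_volume "\<lambda>z. G z * (indicator (ball 0 r) z :: real)"] by simp
  moreover have "norm (G z * (indicator (ball 0 r) z :: real)) = indicator (ball 0 r) z * norm (F (z + a))" for z
    by (simp add: G_def norm_mult indicator_def)
  ultimately show ?thesis by (simp add: G_def norm_mult mult.commute)
qed

text \<open>For \<open>p < 1\<close> the submean property of \<open>norm F powr p\<close> follows from the one of \<open>norm F\<close>, applied in a
  ball around the point where \<open>(1 - norm u) powr (2 n / p) * norm (F u)\<close> is maximal: there
  \<open>norm F\<close> is controlled by its value at the centre.\<close>

lemma submean_powr:
  assumes p: "0 < p" "p \<le> (1::real)"
  shows "\<exists>C>0. \<forall>F :: complex ^ 'n \<Rightarrow> complex. entire F \<longrightarrow>
    norm (F 0) powr p \<le> C * (LINT z|fock_volume. indicator (ball 0 1) z * norm (F z) powr p)"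
proof -
  define n where "n = 2 * CARD('n)"
  \<comment> \<open>Chosen so that the \<open>p\<close>-th power of
    \<open>(2 * \<delta>) powr a\<close> is \<open>(2 * \<delta>) ^ n\<close>, which cancels against
    the volume \<open>v * \<delta> ^ n\<close> of the small ball; \<open>n\<close> is the real
    dimension.\<close>
  define a where "a = real n / p"
  define v where "v = measure fock_volume (ball (0 :: complex ^ 'n) 1)"
  define C where "C = 2 ^ n * 2 powr (a * (1 - p)) / v"
  have a: "a > 0" using p by (simp add: a_def n_def)
  have v: "v > 0" unfolding v_def by (rule measure_fock_ball)
  have "norm (F 0) powr p \<le> C * (LINT z|fock_volume. indicator (ball 0 1) z * norm (F z) powr p)"
    if F: "entire F" for F :: "complex ^ 'n \<Rightarrow> complex"
  proof -
    define I where "I = (LINT z|fock_volume. indicator (ball 0 1) z * norm (F z) powr p)"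
    have I0: "I \<ge> 0" unfolding I_def by (rule integral_nonneg_AE) auto
    have cont: "continuous_on S F" for S by (rule entire_continuous_on[OF F])
    have contp: "continuous_on S (\<lambda>z. norm (F z) powr p)" for S
      using p cont by (intro continuous_on_powr' continuous_intros) auto
    define \<psi> where "\<psi> u = (1 - norm u) powr a * norm (F u)" for u
    have "continuous_on (cball 0 1) \<psi>"
      unfolding \<psi>_def using a cont by (intro continuous_intros continuous_on_powr') auto
    then obtain u where u: "u \<in> cball 0 1" "\<And>w. w \<in> cball 0 1 \<Longrightarrow> \<psi> w \<le> \<psi> u"
      using continuous_attains_sup[of "cball 0 1" \<psi>] by auto
    have \<psi>0: "\<psi> 0 = norm (F 0)" by (simp add: \<psi>_def)
    show ?thesis
    proof (cases "\<psi> u = 0")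
      case True
      then have "norm (F 0) = 0" using u(2)[of 0] \<psi>0 by simp
      then show ?thesis using I0 v by (simp add: I_def[symmetric] C_def)
    next
      case False
      then have "norm u \<noteq> 1" "F u \<noteq> 0" by (auto simp: \<psi>_def)
      then have u1: "norm u < 1" and Fu: "norm (F u) > 0" using u(1) by auto
      \<comment> \<open>Half the distance from \<open>u\<close> to the unit sphere. On the ball of
        radius \<open>\<delta>\<close> around \<open>u\<close> the distance to the sphere is still
        at least \<open>\<delta>\<close>, so the maximality of \<open>u\<close> costs only the
        factor \<open>2 powr a\<close> in \<open>M\<close>.\<close>
      define \<delta> where "\<delta> = (1 - norm u) / 2"
      have \<delta>: "\<delta> > 0" using u1 by (simp add: \<delta>_def)
      have d2: "1 - norm u = 2 * \<delta>" by (simp add: \<delta>_def)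
      define M where "M = 2 powr a * norm (F u)"
      have M: "norm (F (z + u)) \<le> M" if "z \<in> ball 0 \<delta>" for z
      proof -
        have "norm (z + u) < \<delta> + norm u" using that norm_triangle_ineq[of z u] by simp
        then have 1: "\<delta> < 1 - norm (z + u)" unfolding \<delta>_def by argo
        then have "\<psi> (z + u) \<le> \<psi> u" using \<delta> by (intro u(2)) auto
        then have "(1 - norm (z + u)) powr a * norm (F (z + u)) \<le> (2 * \<delta>) powr a * norm (F u)"
          unfolding \<psi>_def d2 .
        moreover have "\<delta> powr a * norm (F (z + u)) \<le> (1 - norm (z + u)) powr a * norm (F (z + u))"
          using 1 \<delta> a by (intro mult_right_mono powr_mono2) auto
        ultimately have "\<delta> powr a * norm (F (z + u)) \<le> (2 * \<delta>) powr a * norm (F u)" by linarith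
        also have "\<dots> = \<delta> powr a * M"
          using \<delta> by (simp add: M_def powr_mult mult_ac)
        finally have "\<delta> powr a * norm (F (z + u)) \<le> \<delta> powr a * M" .
        then show ?thesis using \<delta> by simp
      qed
      have M0: "M > 0" using Fu by (simp add: M_def)
      have contu: "continuous_on UNIV (\<lambda>z. F (z + u))"
        using entire_continuous_on[OF entire_affine[OF F, of 1 u]] by simp
      have "norm (F u) * (v * \<delta> ^ n) \<le> (LINT z|fock_volume. indicator (ball 0 \<delta>) z * norm (F (z + u)))"
        using submean_ball[OF F, of u \<delta>] measure_fock_ball(2)[OF \<delta>, where 'n = 'n] by (simp add: v_def n_def)
      also have "\<dots> \<le> (LINT z|fock_volume. M powr (1 - p) * (indicator (ball 0 1) (z + u) * norm (F (z + u)) powr p))"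
      proof (rule integral_mono)
        show "integrable fock_volume (\<lambda>z. indicator (ball 0 \<delta>) z * norm (F (z + u)))"
          by (intro indicator_ball_integrable_continuous continuous_on_norm contu)
        show "integrable fock_volume (\<lambda>z. M powr (1 - p) * (indicator (ball 0 1) (z + u) * norm (F (z + u)) powr p))"
          by (intro integrable_mult_right integrable_translate[where f = "\<lambda>z. indicator (ball 0 1) z * norm (F z) powr p"]
              indicator_ball_integrable_continuous contp)
        fix z
        show "indicator (ball 0 \<delta>) z * norm (F (z + u)) \<le> M powr (1 - p) * (indicator (ball 0 1) (z + u) * norm (F (z + u)) powr p)"
        proof (cases "z \<in> ball 0 \<delta>")
          case True
          then have "norm (z + u) < 1"
            using norm_triangle_ineq[of z u] u1 unfolding \<delta>_def by simp
          moreover have "norm (F (z + u)) \<le> M powr (1 - p) * norm (F (z + u)) powr p"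
          proof -
            have "norm (F (z + u)) = norm (F (z + u)) powr (1 - p) * norm (F (z + u)) powr p"
              by (cases "F (z + u) = 0") (auto simp flip: powr_add)
            also have "\<dots> \<le> M powr (1 - p) * norm (F (z + u)) powr p"
              using p M[OF True] by (intro mult_right_mono powr_mono2) auto
            finally show ?thesis .
          qed
          ultimately show ?thesis using True by simp
        qed auto
      qed
      also have "\<dots> = M powr (1 - p) * I"
        unfolding I_def
        by (subst integral_mult_right_zero, subst integral_translate[where f = "\<lambda>z. indicator (ball 0 1) z * norm (F z) powr p"])
           (intro borel_measurable_times borel_measurable_indicator borel_measurable_continuous_onI contp, simp_all)
      finally have 1: "norm (F u) * (v * \<delta> ^ n) \<le> 2 powr (a * (1 - p)) * norm (F u) powr (1 - p) * I"
        by (simp add: M_def powr_mult powr_powr)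
      \<comment> \<open>The factor \<open>norm (F u) powr (1 - p)\<close> occurs on both sides and
        is positive, so cancelling it leaves an estimate for the \<open>p\<close>-th power.\<close>
      have "norm (F u) powr (1 - p) * (norm (F u) powr p * (v * \<delta> ^ n)) = norm (F u) * (v * \<delta> ^ n)"
        using Fu by (simp flip: mult.assoc powr_add)
      also note 1
      also have "2 powr (a * (1 - p)) * norm (F u) powr (1 - p) * I = norm (F u) powr (1 - p) * (2 powr (a * (1 - p)) * I)"
        by (simp only: mult_ac)
      finally have 2: "norm (F u) powr p * (v * \<delta> ^ n) \<le> 2 powr (a * (1 - p)) * I"
        using Fu by (subst (asm) mult_le_cancel_left_pos) auto
      have "norm (F 0) powr p \<le> \<psi> u powr p"
        using u(2)[of 0] p \<psi>0 by (intro powr_mono2) auto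
      also have "\<dots> = (2 * \<delta>) powr real n * norm (F u) powr p"
        unfolding \<psi>_def d2 using \<delta> p by (simp add: powr_mult powr_powr a_def)
      also have "\<dots> = 2 ^ n * (norm (F u) powr p * (v * \<delta> ^ n)) / v"
        using \<delta> v by (simp add: powr_realpow power_mult_distrib)
      also have "\<dots> \<le> 2 ^ n * (2 powr (a * (1 - p)) * I) / v"
        using 2 v by (intro divide_right_mono mult_left_mono) auto
      also have "\<dots> = C * I" by (simp add: C_def)
      finally show ?thesis unfolding I_def .
    qed
  qed
  then show ?thesis using v by (intro exI[of _ C]) (auto simp: C_def)
qed

section \<open>Pointwise bounds in the Fock spaces\<close>

lemma fock_integrand_nonneg [simp]: "0 \<le> fock_integrand p \<gamma> f z"
  by (simp add: fock_integrand_def)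

lemma fock_norm_nonneg [simp]: "0 \<le> fock_norm p \<gamma> f"
  by (simp add: fock_norm_def)

lemma fock_integrand_measurable [measurable]:
  fixes f :: "complex ^ 'n \<Rightarrow> complex"
  assumes [measurable]: "f \<in> borel_measurable borel"
  shows "fock_integrand p \<gamma> f \<in> borel_measurable borel"
proof -
  have [measurable]: "(\<lambda>x :: complex ^ 'n. complex_of_real (exp (- (norm x)\<^sup>2 / 2))) \<in> borel_measurable borel"
    by (intro borel_measurable_continuous_onI continuous_intros) auto
  have [measurable]: "(\<lambda>x :: complex ^ 'n. (1 + norm x) powr - \<gamma>) \<in> borel_measurable borel"
    by simp
  have [measurable]: "(\<lambda>x :: complex ^ 'n. f x * complex_of_real (exp (- (norm x)\<^sup>2 / 2))) \<in> borel_measurable borel"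
    by measurable
  show ?thesis
  unfolding fock_integrand_def by measurable
qed

lemma integral_fock_integrand:
  "p > 0 \<Longrightarrow> (LINT z|fock_volume. fock_integrand p \<gamma> f z) = fock_norm p \<gamma> f powr p"
  by (simp add: fock_norm_def powr_powr integral_nonneg_AE)

text \<open>The submean property at 0 is applied to
  \<open>F u = f (u + z) * exp (- herm u z)\<close>. The exponential twist turns the Gaussian
  centred at 0 into the one centred at \<open>z\<close>: \<open>norm (F u)\<close> equals
  \<open>norm (f (u + z))\<close> with its Fock weight, times
  \<open>exp (norm u ^ 2 / 2) * exp (norm z ^ 2 / 2)\<close>, and the first factor is bounded on the
  unit ball.\<close>

lemma fock_pointwise:
  assumes p: "0 < p" "p \<le> (1::real)"
  shows "\<exists>C>0. \<forall>f \<in> fock_space p (\<alpha> * p). \<forall>z :: complex ^ 'n.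
    norm (f z) \<le> C * fock_norm p (\<alpha> * p) f * exp ((norm z)\<^sup>2 / 2) * (1 + norm z) powr \<alpha>"
proof -
  obtain C where C: "C > 0" "\<And>F :: complex ^ 'n \<Rightarrow> complex. entire F \<Longrightarrow>
    norm (F 0) powr p \<le> C * (LINT z|fock_volume. indicator (ball 0 1) z * norm (F z) powr p)"
    using submean_powr[OF p, where 'n = 'n] by blast
  define \<gamma> where "\<gamma> = \<alpha> * p"
  define K where "K = C * exp (p / 2) * 2 powr \<bar>\<gamma>\<bar>"
  have K: "K > 0" using C by (simp add: K_def)
  have "norm (f z) \<le> K powr (1 / p) * fock_norm p \<gamma> f * exp ((norm z)\<^sup>2 / 2) * (1 + norm z) powr \<alpha>"
    if f: "f \<in> fock_space p \<gamma>" for f and z :: "complex ^ 'n"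
  proof -
    have fe: "entire f" and fi: "integrable fock_volume (fock_integrand p \<gamma> f)"
      using f by (auto simp: fock_space_def)
    define F where "F u = f (1 *s u + z) * exp (- 1 * herm u z)" for u
    have F: "entire F"
      unfolding F_def
      by (rule entire_mult[OF entire_affine[OF fe] entire_exp[OF entire_cmult[OF entire_herm]]])
    define L where "L = exp (p / 2) * 2 powr \<bar>\<gamma>\<bar> * exp (p * (norm z)\<^sup>2 / 2) * (1 + norm z) powr \<gamma>"
    have bound: "norm (F u) powr p \<le> L * fock_integrand p \<gamma> f (u + z)" if u: "norm u < 1" for u
    proof -
      have e: "exp (- (norm (u + z))\<^sup>2 / 2) = exp (- Re (herm u z)) * exp (- ((norm u)\<^sup>2 / 2)) * exp (- ((norm z)\<^sup>2 / 2))"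
        unfolding norm_diff_sq exp_add[symmetric] by (simp add: field_simps)
      have "norm (F u) = norm (f (u + z)) * exp (- Re (herm u z))"
        by (simp add: F_def norm_mult)
      then have 1: "norm (F u) = norm (f (u + z)) * exp (- (norm (u + z))\<^sup>2 / 2) * exp ((norm u)\<^sup>2 / 2) * exp ((norm z)\<^sup>2 / 2)"
        unfolding e by (simp add: exp_minus field_simps)
      have "exp ((norm u)\<^sup>2 / 2) \<le> exp (1 / 2 :: real)"
        using u by (simp add: abs_square_le_1)
      then have "norm (F u) \<le> norm (f (u + z)) * exp (- (norm (u + z))\<^sup>2 / 2) * exp (1 / 2) * exp ((norm z)\<^sup>2 / 2)"
        unfolding 1 by (intro mult_right_mono mult_left_mono) auto
      then have "norm (F u) powr p \<le> (norm (f (u + z)) * exp (- (norm (u + z))\<^sup>2 / 2) * exp (1 / 2) * exp ((norm z)\<^sup>2 / 2)) powr p"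
        using p by (intro powr_mono2) auto
      also have "\<dots> = (norm (f (u + z)) * exp (- (norm (u + z))\<^sup>2 / 2)) powr p * exp (p / 2) * exp (p * (norm z)\<^sup>2 / 2)"
        by (simp add: powr_mult exp_powr_real mult_ac)
      also have "\<dots> = fock_integrand p \<gamma> f (u + z) * (1 + norm (u + z)) powr \<gamma> * exp (p / 2) * exp (p * (norm z)\<^sup>2 / 2)"
        by (simp add: fock_integrand_def norm_mult powr_minus field_simps add_nonneg_eq_0_iff)
      also have "\<dots> \<le> fock_integrand p \<gamma> f (u + z) * (2 powr \<bar>\<gamma>\<bar> * (1 + norm z) powr \<gamma>) * exp (p / 2) * exp (p * (norm z)\<^sup>2 / 2)"
      proof (intro mult_right_mono mult_left_mono)
        have "(1 + norm u) powr \<bar>\<gamma>\<bar> \<le> 2 powr \<bar>\<gamma>\<bar>" using u by (intro powr_mono2) auto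
        then show "(1 + norm (u + z)) powr \<gamma> \<le> 2 powr \<bar>\<gamma>\<bar> * (1 + norm z) powr \<gamma>"
          using peetre[of u z \<gamma>] mult_left_mono[of "(1 + norm u) powr \<bar>\<gamma>\<bar>" "2 powr \<bar>\<gamma>\<bar>" "(1 + norm z) powr \<gamma>"]
          by (simp add: mult.commute)
      qed auto
      finally show ?thesis by (simp add: L_def mult_ac)
    qed
    have "norm (f z) powr p = norm (F 0) powr p" by (simp add: F_def herm_simps)
    also have "\<dots> \<le> C * (LINT z|fock_volume. indicator (ball 0 1) z * norm (F z) powr p)" by (rule C(2)[OF F])
    also have "\<dots> \<le> C * (LINT u|fock_volume. L * fock_integrand p \<gamma> f (u + z))"
    proof (intro mult_left_mono integral_mono)
      show "integrable fock_volume (\<lambda>z. indicator (ball 0 1) z * norm (F z) powr p)"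
        using p by (intro indicator_ball_integrable_continuous continuous_on_powr' continuous_intros entire_continuous_on[OF F]) auto
      show "integrable fock_volume (\<lambda>u. L * fock_integrand p \<gamma> f (u + z))"
        by (intro integrable_mult_right integrable_translate fi)
      show "indicator (ball 0 1) u * norm (F u) powr p \<le> L * fock_integrand p \<gamma> f (u + z)" for u
        using bound[of u] by (auto simp: indicator_def L_def)
    qed (use C in auto)
    also have "(LINT u|fock_volume. L * fock_integrand p \<gamma> f (u + z)) = L * fock_norm p \<gamma> f powr p"
      using p entire_measurable[OF fe]
      by (simp add: integral_translate[where f = "fock_integrand p \<gamma> f"] integral_fock_integrand)
    finally have "norm (f z) powr p \<le> K * exp (p * (norm z)\<^sup>2 / 2) * (1 + norm z) powr \<gamma> * fock_norm p \<gamma> f powr p"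
      by (simp add: K_def L_def mult_ac)
    then have "(norm (f z) powr p) powr (1 / p) \<le> (K * exp (p * (norm z)\<^sup>2 / 2) * (1 + norm z) powr \<gamma> * fock_norm p \<gamma> f powr p) powr (1 / p)"
      using p by (intro powr_mono2) auto
    then show ?thesis
      using p K by (simp add: powr_mult powr_powr exp_powr_real \<gamma>_def mult_ac)
  qed
  then show ?thesis using K unfolding \<gamma>_def by (intro exI[of _ "K powr (1 / p)"]) auto
qed

section \<open>Radial weights and the reproducing formula\<close>

text \<open>The measure \<open>h dV\<close> with \<open>h\<close> homogeneous of degree \<open>2 k\<close>, pushed forward along \<open>z \<mapsto> norm z ^ 2\<close>, has a
  distribution function that scales like \<open>a ^ (n + k)\<close>.\<close>

lemma nn_integral_radial:
  fixes h :: "complex ^ 'n \<Rightarrow> real"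
  assumes h: "continuous_on UNIV h" "\<And>z. 0 \<le> h z" "\<And>r z. 0 < r \<Longrightarrow> h (r *\<^sub>R z) = r ^ (2 * k) * h z"
  shows "\<exists>c. 0 \<le> c \<and> (\<forall>\<phi>\<in>borel_measurable borel. (\<integral>\<^sup>+z. ennreal (h z) * \<phi> ((norm z)\<^sup>2) \<partial>fock_volume)
    = ennreal c * (\<integral>\<^sup>+t. ennreal (indicator {0..} t * t ^ (CARD('n) + k - 1)) * \<phi> t \<partial>lborel))"
proof -
  define m where "m = CARD('n) + k"
  have m: "m > 0" unfolding m_def by simp
  have [measurable]: "h \<in> borel_measurable borel" by (rule borel_measurable_continuous_onI[OF h(1)])
  obtain B where B: "\<And>z. norm z \<le> 1 \<Longrightarrow> h z \<le> B"
  proof -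
    have "compact (h ` cball 0 1)"
      by (intro compact_continuous_image compact_cball continuous_on_subset[OF h(1)]) simp
    then show ?thesis using that by (metis abs_le_D1 bounded_iff compact_imp_bounded dist_0_norm image_eqI mem_cball real_norm_def)
  qed
  define J where "J = (\<integral>\<^sup>+z. ennreal (h z) * indicator {..1} ((norm z)\<^sup>2) \<partial>fock_volume)"
  have "J \<le> (\<integral>\<^sup>+z. ennreal (max B 0) * indicator (ball (0 :: complex ^ 'n) 2) z \<partial>fock_volume)"
    unfolding J_def
  proof (rule nn_integral_mono)
    fix z :: "complex ^ 'n"
    show "ennreal (h z) * indicator {..1} ((norm z)\<^sup>2) \<le> ennreal (max B 0) * indicator (ball 0 2) z"
      using B[of z] by (auto simp: indicator_def abs_square_le_1 intro!: ennreal_leI)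
  qed
  also have "\<dots> = ennreal (max B 0) * emeasure fock_volume (ball (0 :: complex ^ 'n) 2)"
    by (rule nn_integral_cmult_indicator) simp
  also have "\<dots> < \<infinity>" using emeasure_fock_ball_finite[of "0 :: complex ^ 'n" 2] by (simp add: ennreal_mult_less_top)
  finally have J: "J < \<infinity>" .
  define \<Phi> where "\<Phi> = enn2real J"
  have J\<Phi>: "J = ennreal \<Phi>" "\<Phi> \<ge> 0" using J by (simp_all add: \<Phi>_def)
  define M where "M = distr (density fock_volume (\<lambda>z. ennreal (h z))) borel (\<lambda>z :: complex ^ 'n. (norm z)\<^sup>2)"
  \<comment> \<open>Its distribution function is \<open>\<Phi> * a ^ m\<close>, which is what
    scaling by \<open>sqrt a\<close> forces on \<open>M\<close>: a factor \<open>a ^ n\<close> from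
    the volume and \<open>a ^ k\<close> from \<open>h\<close>.\<close>
  define N where "N = density lborel (\<lambda>t. ennreal (real m * \<Phi> * (indicator {0..} t * t ^ (m - 1))))"
  have emM: "emeasure M X = (\<integral>\<^sup>+z. ennreal (h z) * indicator X ((norm z)\<^sup>2) \<partial>fock_volume)" if [measurable]: "X \<in> sets borel" for X
  proof -
    have "emeasure M X = (\<integral>\<^sup>+z. indicator X z \<partial>M)" by (simp add: M_def)
    also have "\<dots> = (\<integral>\<^sup>+z. ennreal (h z) * indicator X ((norm z)\<^sup>2) \<partial>fock_volume)"
      unfolding M_def by (subst nn_integral_distr) (simp_all add: nn_integral_density)
    finally show ?thesis .
  qed
  have emN: "emeasure N {..a} = (if a \<ge> 0 then ennreal (\<Phi> * a ^ m) else 0)" for a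
  proof -
    have "emeasure N {..a} = (\<integral>\<^sup>+t. ennreal (real m * \<Phi> * (indicator {0..} t * t ^ (m - 1))) * indicator {..a} t \<partial>lborel)"
      unfolding N_def by (subst emeasure_density) auto
    also have "\<dots> = (if a \<ge> 0 then ennreal (\<Phi> * a ^ m) else 0)"
    proof (cases "a \<ge> 0")
      case True
      have "(\<integral>\<^sup>+t. ennreal (real m * \<Phi> * (indicator {0..} t * t ^ (m - 1))) * indicator {..a} t \<partial>lborel)
        = (\<integral>\<^sup>+t. ennreal (real m * \<Phi> * t ^ (m - 1)) * indicator {0..a} t \<partial>lborel)"
        by (rule nn_integral_cong) (auto simp: indicator_def)
      also have "\<dots> = ennreal (\<Phi> * a ^ m - \<Phi> * 0 ^ m)"
      proof (rule nn_integral_FTC_Icc)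
        show "((\<lambda>t. \<Phi> * t ^ m) has_real_derivative real m * \<Phi> * t ^ (m - 1)) (at t)" for t
          by (auto intro!: derivative_eq_intros)
      qed (use True J\<Phi> in auto)
      finally show ?thesis using True m by (simp add: zero_power)
    next
      case False
      then have "(\<integral>\<^sup>+t. ennreal (real m * \<Phi> * (indicator {0..} t * t ^ (m - 1))) * indicator {..a} t \<partial>lborel)
        = (\<integral>\<^sup>+t. 0 \<partial>(lborel :: real measure))"
        by (intro nn_integral_cong) (auto simp: indicator_def)
      then show ?thesis using False by simp
    qed
    finally show ?thesis .
  qed
  have eq: "emeasure M {..a} = emeasure N {..a}" for a
  proof (cases "a > 0")
    case True
    define r where "r = sqrt a"
    have r: "r > 0" "r\<^sup>2 = a" using True by (simp_all add: r_def)
    have "emeasure M {..a} = (\<integral>\<^sup>+z. ennreal (h z) * indicator {..a} ((norm z)\<^sup>2) \<partial>fock_volume)"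
      by (rule emM) simp
    also have "\<dots> = ennreal (r ^ (2 * CARD('n))) * (\<integral>\<^sup>+z. ennreal (h (r *\<^sub>R z)) * indicator {..a} ((norm (r *\<^sub>R z))\<^sup>2) \<partial>fock_volume)"
      by (rule nn_integral_scale[OF _ r(1)]) measurable
    also have "(\<lambda>z. ennreal (h (r *\<^sub>R z)) * indicator {..a} ((norm (r *\<^sub>R z))\<^sup>2))
        = (\<lambda>z. ennreal (r ^ (2 * k)) * (ennreal (h z) * indicator {..1} ((norm z)\<^sup>2)))"
      using r by (auto simp: fun_eq_iff h(3) power_mult_distrib indicator_def ennreal_mult h(2))
    also have "(\<integral>\<^sup>+z. ennreal (r ^ (2 * k)) * (ennreal (h z) * indicator {..1} ((norm z)\<^sup>2)) \<partial>fock_volume) = ennreal (r ^ (2 * k)) * J"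
      unfolding J_def by (rule nn_integral_cmult) measurable
    also have "ennreal (r ^ (2 * CARD('n))) * (ennreal (r ^ (2 * k)) * J) = ennreal (\<Phi> * a ^ m)"
      using r J\<Phi> by (simp add: J\<Phi> m_def power_add mult_ac flip: ennreal_mult power_mult r(2))
    finally show ?thesis using True by (simp add: emN)
  next
    case False
    have "emeasure M {..a} = (\<integral>\<^sup>+z. ennreal (h z) * indicator {..a} ((norm z)\<^sup>2) \<partial>fock_volume)"
      by (rule emM) simp
    also have "\<dots> \<le> (\<integral>\<^sup>+z. ennreal (h 0) * indicator {0 :: complex ^ 'n} z \<partial>fock_volume)"
    proof (rule nn_integral_mono)
      fix z :: "complex ^ 'n"
      have "(norm z)\<^sup>2 \<le> a \<Longrightarrow> z = 0" using False by (smt (verit) power2_less_0 zero_eq_power2 norm_eq_zero)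
      then show "ennreal (h z) * indicator {..a} ((norm z)\<^sup>2) \<le> ennreal (h 0) * indicator {0} z"
        by (auto simp: indicator_def)
    qed
    also have "\<dots> = ennreal (h 0) * emeasure fock_volume {0 :: complex ^ 'n}"
      by (rule nn_integral_cmult_indicator) simp
    also have "\<dots> = 0" by (simp add: emeasure_fock_volume)
    finally have "emeasure M {..a} = 0" by simp
    moreover have "emeasure N {..a} = 0" using False m by (simp add: emN zero_power)
    ultimately show ?thesis by simp
  qed
  have "M = N"
  proof (rule measure_eqI_generator_eq[where E = "range atMost" and A = "\<lambda>i. {..real i}" and \<Omega> = UNIV])
    show "Int_stable (range atMost :: real set set)"
      by (auto simp: Int_stable_def)
    show "sets M = sigma_sets UNIV (range atMost)" "sets N = sigma_sets UNIV (range atMost)"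
      by (simp_all add: M_def N_def borel_eq_atMost)
    show "(\<Union>i. {..real i}) = UNIV" using real_arch_simple by auto
    show "emeasure M {..real i} \<noteq> \<infinity>" for i by (simp add: eq emN)
  qed (auto simp: eq)
  have "(\<integral>\<^sup>+z. ennreal (h z) * \<phi> ((norm z)\<^sup>2) \<partial>fock_volume)
    = ennreal (real m * \<Phi>) * (\<integral>\<^sup>+t. ennreal (indicator {0..} t * t ^ (m - 1)) * \<phi> t \<partial>lborel)"
    if [measurable]: "\<phi> \<in> borel_measurable borel" for \<phi>
  proof -
    have "(\<integral>\<^sup>+z. ennreal (h z) * \<phi> ((norm z)\<^sup>2) \<partial>fock_volume) = (\<integral>\<^sup>+t. \<phi> t \<partial>M)"
      unfolding M_def by (subst nn_integral_distr) (simp_all add: nn_integral_density)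
    also have "\<dots> = (\<integral>\<^sup>+t. ennreal (real m * \<Phi> * (indicator {0..} t * t ^ (m - 1))) * \<phi> t \<partial>lborel)"
      unfolding \<open>M = N\<close> N_def by (rule nn_integral_density) auto
    also have "\<dots> = (\<integral>\<^sup>+t. ennreal (real m * \<Phi>) * (ennreal (indicator {0..} t * t ^ (m - 1)) * \<phi> t) \<partial>lborel)"
      using J\<Phi> by (intro nn_integral_cong) (simp add: ennreal_mult' mult.assoc)
    also have "\<dots> = ennreal (real m * \<Phi>) * (\<integral>\<^sup>+t. ennreal (indicator {0..} t * t ^ (m - 1)) * \<phi> t \<partial>lborel)"
      by (rule nn_integral_cmult) measurable
    finally show ?thesis .
  qed
  then show ?thesis using J\<Phi>(2) unfolding m_def by (intro exI[of _ "real (CARD('n) + k) * \<Phi>"]) auto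
qed

definition fock_weight :: "real \<Rightarrow> complex ^ 'n \<Rightarrow> real" where
  "fock_weight \<sigma> z = exp (- (norm z)\<^sup>2) * norm z powr (- \<sigma>)"

lemma fock_weight_nonneg [simp]: "0 \<le> fock_weight \<sigma> z"
  by (simp add: fock_weight_def)

lemma fock_weight_measurable [measurable]: "(fock_weight \<sigma> :: complex ^ 'n \<Rightarrow> real) \<in> borel_measurable borel"
  unfolding fock_weight_def by measurable

lemma fock_weight_rotate: "norm c = 1 \<Longrightarrow> fock_weight \<sigma> (c *s z) = fock_weight \<sigma> z"
  by (simp add: fock_weight_def)

lemma fock_form_integrand_eq: "fock_form_integrand \<sigma> f g z = f z * cnj (g z) * fock_weight \<sigma> z"
  by (simp add: fock_form_integrand_def fock_weight_def)

definition fock_ratio :: "nat \<Rightarrow> real \<Rightarrow> nat \<Rightarrow> real" where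
  "fock_ratio n \<sigma> k = Gamma (real (n + k) - \<sigma> / 2) / Gamma (real (n + k))"

lemma fock_ratio_pos: "n > 0 \<Longrightarrow> \<sigma> / 2 < real (n + k) \<Longrightarrow> fock_ratio n \<sigma> k > 0"
  unfolding fock_ratio_def by (intro divide_pos_pos Gamma_real_pos) auto

text \<open>Under \<open>t = norm z ^ 2\<close> the integral becomes a Gamma integral times a
  constant \<open>c\<close> that depends on \<open>h\<close> but not on the weight, so
  \<open>c\<close> cancels when \<open>\<sigma>\<close> is compared with 0.\<close>

lemma integral_fock_weight_nonneg:
  fixes h :: "complex ^ 'n \<Rightarrow> real"
  assumes h: "continuous_on UNIV h" "\<And>z. 0 \<le> h z" "\<And>r z. 0 < r \<Longrightarrow> h (r *\<^sub>R z) = r ^ (2 * k) * h z"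
    and \<sigma>: "\<sigma> / 2 < real (CARD('n) + k)"
  shows "integrable fock_volume (\<lambda>z. h z * fock_weight \<sigma> z)"
    "(LINT z|fock_volume. h z * fock_weight \<sigma> z) = fock_ratio CARD('n) \<sigma> k * (LINT z|fock_volume. h z * fock_weight 0 z)"
proof -
  obtain c where c: "0 \<le> c" "\<And>\<phi>. \<phi> \<in> borel_measurable borel \<Longrightarrow> (\<integral>\<^sup>+z. ennreal (h z) * \<phi> ((norm z)\<^sup>2) \<partial>fock_volume)
    = ennreal c * (\<integral>\<^sup>+t. ennreal (indicator {0..} t * t ^ (CARD('n) + k - 1)) * \<phi> t \<partial>lborel)"
    using nn_integral_radial[OF h] by blast
  define m where "m = CARD('n) + k"
  have m: "m > 0" unfolding m_def by simp
  have [measurable]: "h \<in> borel_measurable borel" by (rule borel_measurable_continuous_onI[OF h(1)])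
  have nn: "(\<integral>\<^sup>+z. ennreal (h z * fock_weight \<tau> z) \<partial>fock_volume) = ennreal (c * Gamma (real m - \<tau> / 2))" if \<tau>: "\<tau> / 2 < real m" for \<tau>
  proof -
    have w: "fock_weight \<tau> z = exp (- (norm z)\<^sup>2) * ((norm z)\<^sup>2) powr (- (\<tau> / 2))" for z :: "complex ^ 'n"
      by (cases "z = 0") (simp_all add: fock_weight_def powr_powr flip: powr_numeral)
    have "(\<integral>\<^sup>+z. ennreal (h z * fock_weight \<tau> z) \<partial>fock_volume)
      = (\<integral>\<^sup>+z. ennreal (h z) * ennreal (exp (- (norm z)\<^sup>2) * ((norm z)\<^sup>2) powr (- (\<tau> / 2))) \<partial>fock_volume)"
      by (simp add: w ennreal_mult' h(2))
    also have "\<dots> = ennreal c * (\<integral>\<^sup>+t. ennreal (indicator {0..} t * t ^ (m - 1)) * ennreal (exp (- t) * t powr (- (\<tau> / 2))) \<partial>lborel)"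
      unfolding m_def by (rule c(2)[of "\<lambda>t. ennreal (exp (- t) * t powr (- (\<tau> / 2)))"]) measurable
    also have "(\<integral>\<^sup>+t. ennreal (indicator {0..} t * t ^ (m - 1)) * ennreal (exp (- t) * t powr (- (\<tau> / 2))) \<partial>lborel)
      = (\<integral>\<^sup>+t. ennreal (indicator {0..} t * t powr (real m - \<tau> / 2 - 1) / exp t) \<partial>lborel)"
    proof (rule nn_integral_cong)
      fix t :: real
      show "ennreal (indicator {0..} t * t ^ (m - 1)) * ennreal (exp (- t) * t powr (- (\<tau> / 2)))
        = ennreal (indicator {0..} t * t powr (real m - \<tau> / 2 - 1) / exp t)"
      proof (cases "t > 0")
        case True
        have "t ^ (m - 1) = t powr (real m - 1)"
          using True m by (simp add: powr_realpow[symmetric] of_nat_diff)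
        then have "t ^ (m - 1) * (exp (- t) * t powr (- (\<tau> / 2))) = t powr (real m - \<tau> / 2 - 1) / exp t"
          using True by (simp add: exp_minus field_simps flip: powr_add) 
        then show ?thesis using True by (simp flip: ennreal_mult')
      qed (auto simp: indicator_def)
    qed
    also have "\<dots> = ennreal (Gamma (real m - \<tau> / 2))"
      using \<tau> by (intro Gamma_conv_nn_integral_real[symmetric]) simp
    finally show ?thesis using c(1) by (simp add: ennreal_mult')
  qed
  have G: "Gamma (real m - \<tau> / 2) > 0" if "\<tau> / 2 < real m" for \<tau>
    using that by (intro Gamma_real_pos) simp
  have int: "integrable fock_volume (\<lambda>z. h z * fock_weight \<tau> z)"
    and val: "(LINT z|fock_volume. h z * fock_weight \<tau> z) = c * Gamma (real m - \<tau> / 2)" if "\<tau> / 2 < real m" for \<tau>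
  proof -
    have "has_bochner_integral fock_volume (\<lambda>z. h z * fock_weight \<tau> z) (c * Gamma (real m - \<tau> / 2))"
      using nn[OF that] c(1) G[OF that] h(2) by (intro has_bochner_integral_nn_integral) auto
    then show "integrable fock_volume (\<lambda>z. h z * fock_weight \<tau> z)"
      "(LINT z|fock_volume. h z * fock_weight \<tau> z) = c * Gamma (real m - \<tau> / 2)"
      by (simp_all add: has_bochner_integral_iff)
  qed
  show "integrable fock_volume (\<lambda>z. h z * fock_weight \<sigma> z)"
    using int \<sigma> by (simp add: m_def)
  show "(LINT z|fock_volume. h z * fock_weight \<sigma> z) = fock_ratio CARD('n) \<sigma> k * (LINT z|fock_volume. h z * fock_weight 0 z)"
  proof -
    define g where "g = Gamma (real m)"
    have "g > 0" using m unfolding g_def by (intro Gamma_real_pos) simp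
    then show ?thesis
      using val[of \<sigma>] val[of 0] \<sigma> m unfolding m_def[symmetric] fock_ratio_def by (simp add: g_def[symmetric])
  qed
qed

lemma integral_fock_weight_real:
  fixes h :: "complex ^ 'n \<Rightarrow> real"
  assumes h: "continuous_on UNIV h" "\<And>r z. 0 < r \<Longrightarrow> h (r *\<^sub>R z) = r ^ (2 * k) * h z"
    and \<sigma>: "\<sigma> / 2 < real (CARD('n) + k)"
  shows "integrable fock_volume (\<lambda>z. h z * fock_weight \<sigma> z)"
    "(LINT z|fock_volume. h z * fock_weight \<sigma> z) = fock_ratio CARD('n) \<sigma> k * (LINT z|fock_volume. h z * fock_weight 0 z)"
proof -
  define P where "P z = max (h z) 0" for z
  define Q where "Q z = max (- h z) 0" for z
  have hPQ: "h z = P z - Q z" for z by (simp add: P_def Q_def max_def)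
  have pos: "max (r ^ (2 * k) * x) 0 = r ^ (2 * k) * max x 0" "max (- (r ^ (2 * k) * x)) 0 = r ^ (2 * k) * max (- x) 0"
    if "r > 0" for r x :: real
  proof -
    have "0 < r ^ (2 * k)" using that by simp
    then show "max (r ^ (2 * k) * x) 0 = r ^ (2 * k) * max x 0" "max (- (r ^ (2 * k) * x)) 0 = r ^ (2 * k) * max (- x) 0"
      by (auto simp: max_def mult_le_0_iff zero_le_mult_iff)
  qed
  have cont: "continuous_on UNIV P" "continuous_on UNIV Q"
    unfolding P_def Q_def by (intro continuous_intros h)+
  have P: "integrable fock_volume (\<lambda>z. P z * fock_weight \<tau> z)"
    "(LINT z|fock_volume. P z * fock_weight \<tau> z) = fock_ratio CARD('n) \<tau> k * (LINT z|fock_volume. P z * fock_weight 0 z)"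
    and Q: "integrable fock_volume (\<lambda>z. Q z * fock_weight \<tau> z)"
    "(LINT z|fock_volume. Q z * fock_weight \<tau> z) = fock_ratio CARD('n) \<tau> k * (LINT z|fock_volume. Q z * fock_weight 0 z)"
    if "\<tau> / 2 < real (CARD('n) + k)" for \<tau>
    by (intro integral_fock_weight_nonneg[OF _ _ _ that] cont; simp add: P_def Q_def h(2) pos)+
  have 0: "0 / 2 < real (CARD('n) + k)" by (simp add: add_pos_nonneg)
  show "integrable fock_volume (\<lambda>z. h z * fock_weight \<sigma> z)"
    unfolding hPQ left_diff_distrib by (intro Bochner_Integration.integrable_diff P Q \<sigma>)
  show "(LINT z|fock_volume. h z * fock_weight \<sigma> z) = fock_ratio CARD('n) \<sigma> k * (LINT z|fock_volume. h z * fock_weight 0 z)"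
    unfolding hPQ left_diff_distrib
    by (subst (1 2) Bochner_Integration.integral_diff)
       (auto intro!: P(1) Q(1) \<sigma> 0 simp: P(2)[OF \<sigma>] Q(2)[OF \<sigma>] right_diff_distrib)
qed

lemma integral_fock_weight:
  fixes H :: "complex ^ 'n \<Rightarrow> complex"
  assumes H: "continuous_on UNIV H" "\<And>r z. 0 < r \<Longrightarrow> H (r *\<^sub>R z) = of_real (r ^ (2 * k)) * H z"
    and \<sigma>: "\<sigma> / 2 < real (CARD('n) + k)"
  shows "integrable fock_volume (\<lambda>z. H z * fock_weight \<sigma> z)"
    "(LINT z|fock_volume. H z * fock_weight \<sigma> z) = fock_ratio CARD('n) \<sigma> k * (LINT z|fock_volume. H z * fock_weight 0 z)"
proof -
  have 0: "0 / 2 < real (CARD('n) + k)" by (simp add: add_pos_nonneg)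
  have R: "integrable fock_volume (\<lambda>z. Re (H z) * fock_weight \<tau> z)"
    "(LINT z|fock_volume. Re (H z) * fock_weight \<tau> z) = fock_ratio CARD('n) \<tau> k * (LINT z|fock_volume. Re (H z) * fock_weight 0 z)"
    and I: "integrable fock_volume (\<lambda>z. Im (H z) * fock_weight \<tau> z)"
    "(LINT z|fock_volume. Im (H z) * fock_weight \<tau> z) = fock_ratio CARD('n) \<tau> k * (LINT z|fock_volume. Im (H z) * fock_weight 0 z)"
    if "\<tau> / 2 < real (CARD('n) + k)" for \<tau>
    by (intro integral_fock_weight_real[OF _ _ that] continuous_intros H; simp add: H(2) del: of_real_power)+
  have eq: "H z * fock_weight \<tau> z = complex_of_real (Re (H z) * fock_weight \<tau> z) + \<i> * complex_of_real (Im (H z) * fock_weight \<tau> z)" for z \<tau>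
    by (simp add: complex_eq_iff)
  have int: "integrable fock_volume (\<lambda>z. H z * fock_weight \<tau> z)"
    and val: "(LINT z|fock_volume. H z * fock_weight \<tau> z) = complex_of_real (LINT z|fock_volume. Re (H z) * fock_weight \<tau> z)
      + \<i> * complex_of_real (LINT z|fock_volume. Im (H z) * fock_weight \<tau> z)"
    if "\<tau> / 2 < real (CARD('n) + k)" for \<tau>
  proof -
    have a: "integrable fock_volume (\<lambda>z. complex_of_real (Re (H z) * fock_weight \<tau> z))"
      "integrable fock_volume (\<lambda>z. \<i> * complex_of_real (Im (H z) * fock_weight \<tau> z))"
      by (rule integrable_of_real[OF R(1)[OF that]])
         (rule integrable_mult_right[OF integrable_of_real[OF I(1)[OF that]]])
    show "integrable fock_volume (\<lambda>z. H z * fock_weight \<tau> z)"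
      unfolding eq using a by (rule Bochner_Integration.integrable_add)
    show "(LINT z|fock_volume. H z * fock_weight \<tau> z) = complex_of_real (LINT z|fock_volume. Re (H z) * fock_weight \<tau> z)
      + \<i> * complex_of_real (LINT z|fock_volume. Im (H z) * fock_weight \<tau> z)"
      unfolding eq Bochner_Integration.integral_add[OF a] by (simp only: integral_mult_right_zero integral_complex_of_real)
  qed
  show "integrable fock_volume (\<lambda>z. H z * fock_weight \<sigma> z)" by (rule int[OF \<sigma>])
  show "(LINT z|fock_volume. H z * fock_weight \<sigma> z) = fock_ratio CARD('n) \<sigma> k * (LINT z|fock_volume. H z * fock_weight 0 z)"
    unfolding val[OF \<sigma>] val[OF 0] R(2)[OF \<sigma>] I(2)[OF \<sigma>] by (simp add: distrib_left mult_ac)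
qed

section \<open>Homogeneous polynomials and the reproducing formula\<close>

lemma homogeneous_poly_growth:
  assumes "homogeneous_poly k q" obtains B where "B \<ge> 0" "\<And>z. norm (q z) \<le> B * norm z ^ k"
proof -
  have q: "entire q" by (rule homogeneous_poly_entire[OF assms])
  obtain B where B: "B \<ge> 0" "\<And>z. norm z \<le> 1 \<Longrightarrow> norm (q z) \<le> B"
    using entire_bounded_on_ball[OF q] by blast
  have "norm (q z) \<le> B * norm z ^ k" for z
  proof -
    define u where "u = of_real (1 / norm z) *s z"
    have z: "z = of_real (norm z) *s u"
      by (cases "z = 0") (simp_all add: u_def vector_smult_assoc)
    have u: "norm u \<le> 1" by (simp add: u_def norm_divide)
    show ?thesis
      using mult_right_mono[OF B(2)[OF u], of "norm z ^ k"]
      by (subst z) (simp add: homogeneous_poly_scale[OF assms] norm_mult norm_power mult.commute)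
  qed
  then show ?thesis using that B(1) by blast
qed

lemma fock_form_homogeneous:
  fixes q r :: "complex ^ 'n \<Rightarrow> complex"
  assumes q: "homogeneous_poly k q" and r: "homogeneous_poly k r"
    and \<sigma>: "\<sigma> / 2 < real (CARD('n) + k)"
  shows "integrable fock_volume (fock_form_integrand \<sigma> q r)"
    "fock_form \<sigma> q r = fock_ratio CARD('n) \<sigma> k * fock_form 0 q r"
proof -
  have 1: "continuous_on UNIV (\<lambda>z. q z * cnj (r z))"
    by (intro continuous_intros entire_continuous_on homogeneous_poly_entire[OF q] homogeneous_poly_entire[OF r])
  have 2: "q (s *\<^sub>R z) * cnj (r (s *\<^sub>R z)) = of_real (s ^ (2 * k)) * (q z * cnj (r z))" for s z
  proof -
    have "complex_of_real (s ^ (2 * k)) = of_real s ^ k * of_real s ^ k"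
      by (simp flip: power_add mult_2)
    then show ?thesis
      by (simp only: scaleR_eq_vector_smult homogeneous_poly_scale[OF q] homogeneous_poly_scale[OF r]
          complex_cnj_mult complex_cnj_power complex_cnj_complex_of_real mult_ac)
  qed
  show "integrable fock_volume (fock_form_integrand \<sigma> q r)"
    "fock_form \<sigma> q r = fock_ratio CARD('n) \<sigma> k * fock_form 0 q r"
    unfolding fock_form_def fock_form_integrand_eq[abs_def]
    using integral_fock_weight[OF 1 2 \<sigma>] by simp_all
qed

lemma AE_fock_volume_neq_0: "AE z in (fock_volume :: (complex ^ 'n) measure). z \<noteq> 0"
proof (rule AE_I')
  show "{0 :: complex ^ 'n} \<in> null_sets fock_volume"
    by (intro null_setsI) (simp_all add: emeasure_fock_volume)
qed auto

text \<open>Translation by \<open>z\<close> completes the square: kernel and Gaussian combine to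
  \<open>exp (- herm u z) * exp (- norm u ^ 2)\<close>, and the mean value property at 0 for the
  entire function \<open>F\<close> returns \<open>F 0 = q z\<close>.\<close>

lemma reproducing_formula:
  fixes q :: "complex ^ 'n \<Rightarrow> complex"
  assumes q: "homogeneous_poly k q"
  shows "(LINT w|fock_volume. q w * cnj (exp (herm w z)) * fock_weight 0 w) = q z"
proof -
  obtain B where B: "B \<ge> 0" "\<And>z. norm (q z) \<le> B * norm z ^ k"
    using homogeneous_poly_growth[OF q] by blast
  have qe: "entire q" by (rule homogeneous_poly_entire[OF q])
  have [measurable]: "q \<in> borel_measurable borel" by (rule entire_measurable[OF qe])
  have [measurable]: "(\<lambda>w. cnj (exp (herm w z))) \<in> borel_measurable borel"
    by (intro borel_measurable_cnj_of_real(1) entire_measurable entire_exp entire_herm)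
  have [measurable]: "(\<lambda>w :: complex ^ 'n. complex_of_real (exp (- (norm w)\<^sup>2))) \<in> borel_measurable borel"
    by (intro borel_measurable_cnj_of_real(2)) measurable
  define F where "F u = q (1 *s u + z) * exp (- 1 * herm u z)" for u
  have F: "entire F"
    unfolding F_def
    by (rule entire_mult[OF entire_affine[OF qe] entire_exp[OF entire_cmult[OF entire_herm]]])
  \<comment> \<open>\<open>fock_weight 0\<close> takes the value 0 at the origin, since
    \<open>0 powr 0 = 0\<close>, so it is the Gaussian only almost everywhere.\<close>
  have "(LINT w|fock_volume. q w * cnj (exp (herm w z)) * fock_weight 0 w)
    = (LINT w|fock_volume. q w * cnj (exp (herm w z)) * exp (- (norm w)\<^sup>2))"
  proof (rule integral_cong_AE)
    show "AE w in fock_volume. q w * cnj (exp (herm w z)) * fock_weight 0 w = q w * cnj (exp (herm w z)) * exp (- (norm w)\<^sup>2)"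
      using AE_fock_volume_neq_0 by eventually_elim (simp add: fock_weight_def)
  qed simp_all
  also have "\<dots> = (LINT u|fock_volume. q (u + z) * cnj (exp (herm (u + z) z)) * exp (- (norm (u + z))\<^sup>2))"
    by (rule integral_translate[symmetric]) measurable
  also have "\<dots> = (LINT u|fock_volume. F u * exp (- (norm u)\<^sup>2))"
  proof (rule Bochner_Integration.integral_cong)
    fix u :: "complex ^ 'n"
    have "cnj (herm (u + z) z) + of_real (- (norm (u + z))\<^sup>2) = - herm u z + of_real (- (norm u)\<^sup>2)"
      unfolding norm_diff_sq herm_simps herm_self by (simp add: complex_eq_iff)
    then have "exp (cnj (herm (u + z) z) + of_real (- (norm (u + z))\<^sup>2)) = exp (- herm u z + of_real (- (norm u)\<^sup>2))"
      by (rule arg_cong)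
    then have "cnj (exp (herm (u + z) z)) * exp (- (norm (u + z))\<^sup>2) = exp (- herm u z) * exp (- (norm u)\<^sup>2)"
      by (simp only: exp_add exp_of_real exp_cnj)
    then show "q (u + z) * cnj (exp (herm (u + z) z)) * exp (- (norm (u + z))\<^sup>2) = F u * exp (- (norm u)\<^sup>2)"
      by (simp add: F_def mult.assoc)
  qed simp
  also have "\<dots> = F 0 * complex_of_real (LINT u|(fock_volume :: (complex ^ 'n) measure). exp (- (norm u)\<^sup>2))"
  proof (rule integral_mean_value[OF F])
    define D where "D u = B * (1 + norm z) ^ k * ((1 + norm u) powr real k * exp (norm z * norm u) * exp (- 1 * (norm u)\<^sup>2))"
      for u :: "complex ^ 'n"
    show "integrable fock_volume D"
      unfolding D_def by (intro integrable_mult_right gauss_growth_integrable) simp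
    show "D (c *s u) = D u" if "norm c = 1" for c u using that by (simp add: D_def)
    show "norm (F u * exp (- (norm u)\<^sup>2)) \<le> D u" for u
    proof -
      have "norm (u + z) \<le> (1 + norm z) * (1 + norm u)"
      proof -
        have "(1 + norm z) * (1 + norm u) = 1 + norm u + norm z + norm u * norm z" by (simp add: algebra_simps)
        then show ?thesis using norm_triangle_ineq[of u z] mult_nonneg_nonneg[OF norm_ge_zero[of u] norm_ge_zero[of z]]
          by linarith
      qed
      then have "norm (u + z) ^ k \<le> ((1 + norm z) * (1 + norm u)) ^ k" by (rule power_mono) simp
      then have "norm (q (u + z)) \<le> B * ((1 + norm z) ^ k * (1 + norm u) ^ k)"
        using order_trans[OF B(2)[of "u + z"] mult_left_mono[OF _ B(1)]] by (simp add: power_mult_distrib)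
      moreover have "norm (exp (- herm u z)) \<le> exp (norm z * norm u)"
        using norm_herm_le[of u z] abs_Re_le_cmod[of "herm u z"] by (simp add: mult.commute)
      ultimately have "norm (q (u + z)) * norm (exp (- herm u z)) \<le> B * ((1 + norm z) ^ k * (1 + norm u) ^ k) * exp (norm z * norm u)"
        using B(1) by (intro mult_mono) auto
      then have "norm (q (u + z)) * norm (exp (- herm u z)) * exp (- (norm u)\<^sup>2) \<le> B * ((1 + norm z) ^ k * (1 + norm u) ^ k) * exp (norm z * norm u) * exp (- (norm u)\<^sup>2)"
        by (intro mult_right_mono) auto
      moreover have "(1 + norm u) powr real k = (1 + norm u) ^ k"
        by (rule powr_realpow) (simp add: add_pos_nonneg)
      ultimately show ?thesis
        by (simp add: F_def D_def norm_mult mult.assoc)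
    qed
  qed simp_all
  also have "(LINT u|(fock_volume :: (complex ^ 'n) measure). exp (- (norm u)\<^sup>2)) = 1"
    by (subst integral_eq_nn_integral) (simp_all add: fock_volume_normalized)
  finally show ?thesis by (simp add: F_def herm_simps)
qed

lemma homogeneous_poly_herm_power: "homogeneous_poly k (\<lambda>w. herm w z ^ k)"
proof (induction k)
  case 0 show ?case by (simp add: homogeneous_poly_const)
next
  case (Suc k)
  have "homogeneous_poly 1 (\<lambda>w. herm w z)"
    unfolding herm_def mult.commute[of _ "cnj _"]
    by (intro homogeneous_poly_sum homogeneous_poly_cmult homogeneous_poly_coord)
  from homogeneous_poly_mult[OF this Suc] show ?case by simp
qed

lemma homogeneous_expansion_exp_herm:
  "homogeneous_expansion (\<lambda>w. exp (herm w z)) (\<lambda>k w. herm w z ^ k / fact k)"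
  unfolding homogeneous_expansion_def
proof (intro conjI allI)
  show "homogeneous_poly k (\<lambda>w. herm w z ^ k / fact k)" for k
    using homogeneous_poly_cmult[OF homogeneous_poly_herm_power, of k "1 / fact k" z] by simp
  show "(\<lambda>k. herm w z ^ k / fact k) sums exp (herm w z)" for w
    using exp_converges[of "herm w z"] by (simp add: scaleR_conv_of_real divide_inverse mult.commute)
qed

text \<open>Orthogonality of degrees replaces the exponential kernel by its part of degree
  \<open>k\<close>, a finite sum of products in \<open>w\<close> and \<open>z\<close>.\<close>

lemma reproducing_formula_homogeneous:
  fixes q :: "complex ^ 'n \<Rightarrow> complex"
  assumes q: "homogeneous_poly k q"
  shows "(LINT w|fock_volume. q w * cnj (herm w z ^ k / fact k) * fock_weight 0 w) = q z"
proof -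
  obtain B where B: "B \<ge> 0" "\<And>z. norm (q z) \<le> B * norm z ^ k"
    using homogeneous_poly_growth[OF q] by blast
  define D where "D u = B * ((1 + norm u) powr real k * exp (norm z * norm u) * exp (- 1 * (norm u)\<^sup>2))"
    for u :: "complex ^ 'n"
  have "(LINT w|fock_volume. q w * cnj (exp (herm w z)) * fock_weight 0 w)
    = (LINT w|fock_volume. q w * cnj (herm w z ^ k / fact k) * fock_weight 0 w)"
  proof (rule integral_homogeneous_component[where D = D])
    show "integrable fock_volume D"
      unfolding D_def by (intro integrable_mult_right gauss_growth_integrable) simp
    show "D (c *s u) = D u" if "norm c = 1" for c u using that by (simp add: D_def)
    show "norm (q u * cnj (exp (herm u z)) * fock_weight 0 u) \<le> D u" for u
    proof -
      have "norm u ^ k \<le> (1 + norm u) powr real k"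
        by (subst powr_realpow) (auto intro: power_mono add_pos_nonneg)
      then have "norm (q u) \<le> B * (1 + norm u) powr real k"
        using order_trans[OF B(2)[of u] mult_left_mono[OF _ B(1)]] by blast
      moreover have "norm (cnj (exp (herm u z))) \<le> exp (norm z * norm u)"
        using norm_herm_le[of u z] abs_Re_le_cmod[of "herm u z"] by (simp add: mult.commute)
      moreover have "fock_weight 0 u \<le> exp (- (norm u)\<^sup>2)" by (simp add: fock_weight_def)
      ultimately have "norm (q u) * norm (cnj (exp (herm u z))) * fock_weight 0 u
        \<le> B * (1 + norm u) powr real k * exp (norm z * norm u) * exp (- (norm u)\<^sup>2)"
        using B(1) by (intro mult_mono) auto
      then show ?thesis by (simp add: D_def norm_mult mult.assoc)
    qed
    show "q (c *s w) = c ^ k * q w" for c w by (rule homogeneous_poly_scale[OF q])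
    show "q \<in> borel_measurable borel" by (intro entire_measurable homogeneous_poly_entire[OF q])
  qed (simp_all add: fock_weight_rotate homogeneous_expansion_exp_herm entire_exp entire_herm)
  then show ?thesis by (simp add: reproducing_formula[OF q])
qed

section \<open>Boundedness of the pairing\<close>

definition low_part :: "nat \<Rightarrow> (complex ^ 'n \<Rightarrow> complex) \<Rightarrow> complex ^ 'n \<Rightarrow> complex" where
  "low_part K f z = (\<Sum>k<K. homogeneous_part f k z)"

text \<open>A difference rather than a tail series, so that it is visibly entire;
  \<open>high_part_sums\<close> identifies it with the tail.\<close>

definition high_part :: "nat \<Rightarrow> (complex ^ 'n \<Rightarrow> complex) \<Rightarrow> complex ^ 'n \<Rightarrow> complex" where
  "high_part K f z = f z - low_part K f z"

text \<open>With the cut \<open>0\<close> below the threshold the two cases of the pairing become one.\<close>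

definition fock_cut :: "nat \<Rightarrow> real \<Rightarrow> nat" where
  "fock_cut n \<sigma> = (if \<sigma> < 2 * real n then 0 else nat \<lfloor>\<sigma> / 2\<rfloor> + 1)"

text \<open>Two factors of order \<open>k\<close> at the origin leave
  \<open>norm z powr (2 * k - \<sigma>)\<close>, and the inequality says that this is integrable
  there; it also makes the numerator of \<open>fock_ratio\<close> positive. The \<open>+ 1\<close>
  in \<open>fock_cut\<close> puts a degree equal to \<open>\<sigma> / 2\<close> into the low
  part.\<close>

lemma fock_cut_le: "fock_cut n \<sigma> \<le> k \<Longrightarrow> \<sigma> / 2 < real (n + k)"
  unfolding fock_cut_def by (auto split: if_splits) linarith

lemma homogeneous_part_homogeneous_poly: "entire f \<Longrightarrow> homogeneous_poly k (homogeneous_part f k)"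
  using homogeneous_expansion_homogeneous_part unfolding homogeneous_expansion_def by blast

lemma homogeneous_part_sums: "entire f \<Longrightarrow> (\<lambda>k. homogeneous_part f k z) sums f z"
  using homogeneous_expansion_homogeneous_part unfolding homogeneous_expansion_def by blast

lemma entire_homogeneous_part: "entire f \<Longrightarrow> entire (homogeneous_part f k)"
  by (rule homogeneous_poly_entire[OF homogeneous_part_homogeneous_poly])

lemma entire_low_part: "entire f \<Longrightarrow> entire (low_part K f)"
  unfolding low_part_def[abs_def] by (intro entire_sum entire_homogeneous_part)

lemma entire_high_part: "entire f \<Longrightarrow> entire (high_part K f)"
  unfolding high_part_def[abs_def] by (intro entire_diff entire_low_part)

lemma high_part_sums: "entire f \<Longrightarrow> (\<lambda>k. homogeneous_part f (k + K) z) sums high_part K f z"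
  unfolding high_part_def low_part_def by (rule sums_split_initial_segment[OF homogeneous_part_sums])

lemma lower_part_eq:
  assumes "s \<ge> 0" shows "lower_part s f = low_part (nat \<lfloor>s\<rfloor> + 1) f"
proof -
  have "{k. real k \<le> \<bar>s\<bar>} = {..<nat \<lfloor>s\<rfloor> + 1}" using assms by (auto; linarith)
  then show ?thesis by (simp add: fun_eq_iff lower_part_def low_part_def)
qed

lemma upper_part_eq:
  assumes "s \<ge> 0" "entire f" shows "upper_part s f = high_part (nat \<lfloor>s\<rfloor> + 1) f"
proof
  fix z
  have "(\<lambda>k. homogeneous_part f k z - (if k \<in> {..<nat \<lfloor>s\<rfloor> + 1} then homogeneous_part f k z else 0))
      sums (f z - (\<Sum>k<nat \<lfloor>s\<rfloor> + 1. homogeneous_part f k z))"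
    by (intro sums_diff homogeneous_part_sums assms sums_If_finite_set) simp
  moreover have "homogeneous_part f k z - (if k \<in> {..<nat \<lfloor>s\<rfloor> + 1} then homogeneous_part f k z else 0)
      = (if real k > \<bar>s\<bar> then homogeneous_part f k z else 0)" for k
  proof -
    have "k \<in> {..<nat \<lfloor>s\<rfloor> + 1} \<longleftrightarrow> \<not> real k > \<bar>s\<bar>" using assms(1) by (auto; linarith)
    then show ?thesis by auto
  qed
  ultimately show "upper_part s f z = high_part (nat \<lfloor>s\<rfloor> + 1) f z"
    by (simp add: upper_part_def high_part_def low_part_def sums_iff)
qed

lemma fock_pairing_eq:
  fixes f g :: "complex ^ 'n \<Rightarrow> complex" and \<sigma> :: real
  assumes "entire f" "entire g"
  defines "K \<equiv> fock_cut CARD('n) \<sigma>"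
  shows "fock_pairing \<sigma> f g = fock_form 0 (low_part K f) (low_part K g) + fock_form \<sigma> (high_part K f) (high_part K g)"
    "fock_pairing_well_defined \<sigma> f g \<longleftrightarrow> integrable fock_volume (fock_form_integrand 0 (low_part K f) (low_part K g))
      \<and> integrable fock_volume (fock_form_integrand \<sigma> (high_part K f) (high_part K g))"
proof -
  have 0: "low_part 0 f = (\<lambda>_. 0)" "high_part 0 f = f" for f :: "complex ^ 'n \<Rightarrow> complex"
    by (simp_all add: fun_eq_iff low_part_def high_part_def)
  show "fock_pairing \<sigma> f g = fock_form 0 (low_part K f) (low_part K g) + fock_form \<sigma> (high_part K f) (high_part K g)"
    using assms by (simp add: fock_pairing_def K_def fock_cut_def 0 lower_part_eq upper_part_eq)
       (simp add: fock_form_def fock_form_integrand_eq[abs_def])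
  show "fock_pairing_well_defined \<sigma> f g \<longleftrightarrow> integrable fock_volume (fock_form_integrand 0 (low_part K f) (low_part K g))
      \<and> integrable fock_volume (fock_form_integrand \<sigma> (high_part K f) (high_part K g))"
    using assms by (simp add: fock_pairing_well_defined_def K_def fock_cut_def 0 lower_part_eq upper_part_eq)
       (simp add: fock_form_integrand_eq[abs_def])
qed

text \<open>\<open>A\<close> is any bound and not the least one, so that estimates for successive
  operators compose by multiplying constants. It is used with exponent \<open>\<alpha>\<close> for
  elements of the Fock space, \<open>\<beta>\<close> for \<open>g\<close>, and
  \<open>- \<alpha>\<close> for the transform of a functional.\<close>

definition fock_growth :: "real \<Rightarrow> real \<Rightarrow> (complex ^ 'n \<Rightarrow> complex) \<Rightarrow> bool" where
  "fock_growth a A f \<longleftrightarrow> 0 \<le> A \<and> (\<forall>z. norm (f z) \<le> A * (exp ((norm z)\<^sup>2 / 2) * (1 + norm z) powr a))"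

text \<open>Bounds the growth factor on the ball of radius 2, whence \<open>2\<^sup>2 / 2\<close> in
  the exponent and the base \<open>1 + 2\<close>.\<close>

definition growth_const :: "real \<Rightarrow> real" where
  "growth_const a = exp 2 * 3 powr \<bar>a\<bar>"

lemma growth_const_pos: "growth_const a > 0"
  by (simp add: growth_const_def)

text \<open>Cauchy's estimate on the sphere of radius 2, one unit beyond the unit ball, so that the
  factor \<open>1 / 2 ^ k\<close> makes the parts summable there. The scale factor
  \<open>2 / norm z\<close> excludes \<open>z = 0\<close>.\<close>

lemma fock_growth_homogeneous_part:
  assumes "entire f" "fock_growth a A f"
  shows "norm (homogeneous_part f k z) \<le> A * growth_const a * (norm z / 2) ^ k"
proof -
  let ?q = "homogeneous_part f"
  have q: "homogeneous_expansion f ?q" by (rule homogeneous_expansion_homogeneous_part[OF assms(1)])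
  have A: "A \<ge> 0" using assms(2) by (simp add: fock_growth_def)
  have b: "norm (f w) \<le> A * growth_const a" if "norm w \<le> 2" for w
  proof -
    have "exp ((norm w)\<^sup>2 / 2) \<le> exp 2" using that power_mono[of "norm w" 2 2] by simp
    moreover have "(1 + norm w) powr a \<le> 3 powr \<bar>a\<bar>"
    proof -
      have "(1 + norm w) powr a \<le> (1 + norm w) powr \<bar>a\<bar>" by (intro powr_mono) auto
      also have "\<dots> \<le> 3 powr \<bar>a\<bar>" using that by (intro powr_mono2) auto
      finally show ?thesis .
    qed
    ultimately have "exp ((norm w)\<^sup>2 / 2) * (1 + norm w) powr a \<le> growth_const a"
      unfolding growth_const_def by (intro mult_mono) auto
    then show ?thesis using assms(2) A unfolding fock_growth_def by (meson mult_left_mono order_trans)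
  qed
  show ?thesis
  proof (cases "z = 0")
    case True
    have "?q k (0 *s z) = 0 ^ k * ?q k z"
      by (rule homogeneous_poly_scale[OF homogeneous_part_homogeneous_poly[OF assms(1)]])
    then have "k > 0 \<Longrightarrow> ?q k z = 0" using True by (simp add: zero_power)
    moreover have "norm (?q 0 z) \<le> A * growth_const a"
      using homogeneous_expansion_0[OF q] b[of 0] by simp
    ultimately show ?thesis using True by (cases "k = 0") (auto simp: zero_power)
  next
    case False
    have "norm (?q k z) \<le> (A * growth_const a) / (2 / norm z) ^ k"
      using False by (intro homogeneous_expansion_norm_le_scaled[OF q] b) auto
    then show ?thesis by (simp add: power_divide)
  qed
qed

lemma fock_growth_low_part:
  assumes "entire f" "fock_growth a A f"
  shows "norm (low_part K f z) \<le> real K * (A * growth_const a) * (1 + norm z) powr real K"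
proof -
  have AL: "A * growth_const a \<ge> 0" using assms(2) growth_const_pos[of a] by (simp add: fock_growth_def)
  have "norm (low_part K f z) \<le> (\<Sum>k<K. (A * growth_const a) * (1 + norm z) ^ K)"
    unfolding low_part_def
  proof (rule sum_norm_le)
    fix k assume k: "k \<in> {..<K}"
    have "(norm z / 2) ^ k \<le> (1 + norm z) ^ k" by (intro power_mono) auto
    also have "\<dots> \<le> (1 + norm z) ^ K" using k by (intro power_increasing) auto
    finally show "norm (homogeneous_part f k z) \<le> (A * growth_const a) * (1 + norm z) ^ K"
      using fock_growth_homogeneous_part[OF assms, of k z] AL by (meson mult_left_mono order_trans)
  qed
  moreover have "(1 + norm z) powr real K = (1 + norm z) ^ K"
    by (rule powr_realpow) (simp add: add_pos_nonneg)
  ultimately show ?thesis by (simp add: mult_ac)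
qed

text \<open>Vanishing to order \<open>K\<close> at the origin is what later compensates the
  singularity of the weight.\<close>

lemma fock_growth_high_part:
  assumes "entire f" "fock_growth a A f" "norm z \<le> 1"
  shows "norm (high_part K f z) \<le> 2 * (A * growth_const a) * norm z ^ K"
proof -
  define c where "c = A * growth_const a"
  have c: "c \<ge> 0" using assms(2) growth_const_pos[of a] by (simp add: c_def fock_growth_def)
  have b: "norm (homogeneous_part f (k + K) z) \<le> c * norm z ^ K * (1 / 2) ^ k" for k
  proof -
    have "norm z ^ k * norm z ^ K \<le> 1 * norm z ^ K" using assms(3) by (intro mult_right_mono power_le_one) auto
    moreover have "(1 / 2 :: real) ^ (k + K) \<le> (1 / 2) ^ k" by (intro power_decreasing) auto
    ultimately have "norm z ^ (k + K) * (1 / 2) ^ (k + K) \<le> norm z ^ K * (1 / 2) ^ k"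
      by (intro mult_mono) (auto simp: power_add)
    then have "c * (norm z / 2) ^ (k + K) \<le> c * (norm z ^ K * (1 / 2) ^ k)"
      using c by (intro mult_left_mono) (auto simp: power_divide)
    then show ?thesis
      using fock_growth_homogeneous_part[OF assms(1,2), of "k + K" z] by (simp add: c_def mult.assoc)
  qed
  have gs: "(\<lambda>k. c * norm z ^ K * (1 / 2) ^ k) sums (c * norm z ^ K * 2)"
    using sums_mult[OF geometric_sums[of "1/2::real"]] by simp
  have sm: "summable (\<lambda>k. norm (homogeneous_part f (k + K) z))"
    by (rule summable_comparison_test'[OF sums_summable[OF gs]]) (use b in auto)
  have "norm (high_part K f z) = norm (\<Sum>k. homogeneous_part f (k + K) z)"
    using high_part_sums[OF assms(1)] sums_unique by metis
  also have "\<dots> \<le> (\<Sum>k. norm (homogeneous_part f (k + K) z))" by (rule summable_norm[OF sm])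
  also have "\<dots> \<le> (\<Sum>k. c * norm z ^ K * (1 / 2) ^ k)" by (rule suminf_le[OF b sm sums_summable[OF gs]])
  also have "\<dots> = c * norm z ^ K * 2" using gs by (rule sums_unique[symmetric])
  finally show ?thesis by (simp add: c_def mult_ac)
qed

text \<open>A polynomial grows more slowly than the Gaussian, so the exponent of the weight can be
  changed from \<open>a\<close> to any \<open>b\<close> at the cost of a constant.\<close>

lemma fock_growth_low_part_any:
  "\<exists>C\<ge>0. \<forall>f :: complex ^ 'n \<Rightarrow> complex. \<forall>A. entire f \<longrightarrow> fock_growth a A f \<longrightarrow> fock_growth b (C * A) (low_part K f)"
proof -
  define E where "E = exp ((\<bar>real K - b\<bar> + \<bar>0\<bar>)\<^sup>2 / (4 * (1/2 :: real)))"
  define C where "C = real K * growth_const a * E"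
  have C: "C \<ge> 0" using growth_const_pos[of a] by (simp add: C_def E_def)
  have "fock_growth b (C * A) (low_part K f)" if f: "entire f" "fock_growth a A f" for f :: "complex ^ 'n \<Rightarrow> complex" and A
    unfolding fock_growth_def
  proof (intro conjI allI)
    have A: "A \<ge> 0" using f(2) by (simp add: fock_growth_def)
    then show "0 \<le> C * A" using C by simp
    fix z :: "complex ^ 'n"
    define G where "G = exp ((norm z)\<^sup>2 / 2) * (1 + norm z) powr b"
    have "(1 + norm z) powr (real K - b) * exp (0 * norm z) \<le> E * exp (1/2 * (norm z)\<^sup>2)"
      unfolding E_def by (rule powr_exp_le_gauss) auto
    then have "(1 + norm z) powr (real K - b) * (1 + norm z) powr b \<le> E * exp (1/2 * (norm z)\<^sup>2) * (1 + norm z) powr b"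
      by (intro mult_right_mono) auto
    moreover have "(1 + norm z) powr (real K - b) * (1 + norm z) powr b = (1 + norm z) powr real K"
      by (simp flip: powr_add)
    ultimately have "(1 + norm z) powr real K \<le> E * G"
      by (simp add: G_def mult.assoc)
    then have "real K * (A * growth_const a) * (1 + norm z) powr real K \<le> real K * (A * growth_const a) * (E * G)"
      using A growth_const_pos[of a] by (intro mult_left_mono) auto
    then have "norm (low_part K f z) \<le> real K * (A * growth_const a) * (E * G)"
      using fock_growth_low_part[OF f, of K z] by (rule order_trans[rotated])
    then show "norm (low_part K f z) \<le> C * A * (exp ((norm z)\<^sup>2 / 2) * (1 + norm z) powr b)"
      by (simp add: G_def C_def mult_ac)
  qed
  then show ?thesis using C by blast
qed

lemma fock_growth_high_part_global:
  "\<exists>C\<ge>0. \<forall>f :: complex ^ 'n \<Rightarrow> complex. \<forall>A. entire f \<longrightarrow> fock_growth a A f \<longrightarrow> fock_growth a (C * A) (high_part K f)"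
proof -
  obtain C where C: "C \<ge> 0" "\<And>f :: complex ^ 'n \<Rightarrow> complex. \<And>A. entire f \<Longrightarrow> fock_growth a A f \<Longrightarrow> fock_growth a (C * A) (low_part K f)"
    using fock_growth_low_part_any[of a a K, where 'n = 'n] by blast
  have "fock_growth a ((1 + C) * A) (high_part K f)" if f: "entire f" "fock_growth a A f" for f :: "complex ^ 'n \<Rightarrow> complex" and A
    unfolding fock_growth_def
  proof (intro conjI allI)
    show "0 \<le> (1 + C) * A" using f(2) C(1) by (simp add: fock_growth_def)
    fix z :: "complex ^ 'n"
    have "norm (high_part K f z) \<le> A * (exp ((norm z)\<^sup>2 / 2) * (1 + norm z) powr a) + C * A * (exp ((norm z)\<^sup>2 / 2) * (1 + norm z) powr a)"
      unfolding high_part_def using f(2) C(2)[OF f]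
      by (intro order_trans[OF norm_triangle_ineq4] add_mono) (auto simp: fock_growth_def)
    then show "norm (high_part K f z) \<le> (1 + C) * A * (exp ((norm z)\<^sup>2 / 2) * (1 + norm z) powr a)"
      by (simp add: distrib_right)
  qed
  then show ?thesis using C(1) by (intro exI[of _ "1 + C"]) auto
qed

lemma fock_weight_far:
  assumes "norm z \<ge> 1"
  shows "fock_weight \<sigma> z \<le> 2 powr \<bar>\<sigma>\<bar> * (1 + norm z) powr (- \<sigma>) * exp (- (norm z)\<^sup>2)"
proof -
  have "norm z powr (- \<sigma>) \<le> (1 + norm z) powr (- \<sigma>) * 2 powr \<bar>- \<sigma>\<bar>"
    using assms by (intro powr_quotient_le) auto
  then show ?thesis unfolding fock_weight_def by (simp add: mult_ac mult_left_mono)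
qed

lemma fock_weight_integrable:
  "\<tau> < 2 * real CARD('n) \<Longrightarrow> integrable fock_volume (fock_weight \<tau> :: complex ^ 'n \<Rightarrow> real)"
  using integral_fock_weight_nonneg(1)[of "\<lambda>_ :: complex ^ 'n. 1" 0 \<tau>] by simp

definition fock_density :: "real \<Rightarrow> (complex ^ 'n \<Rightarrow> complex) \<Rightarrow> complex ^ 'n \<Rightarrow> real" where
  "fock_density \<alpha> f z = norm (f z) * exp (- (norm z)\<^sup>2 / 2) * (1 + norm z) powr (- \<alpha>)"

text \<open>Since \<open>p \<le> 1\<close>, the pointwise bound upgrades the \<open>p\<close>-integral to an ordinary one.\<close>

lemma fock_density_integrable:
  assumes p: "0 < p" "p \<le> (1::real)"
  shows "\<exists>C\<ge>0. \<forall>f \<in> (fock_space p (\<alpha> * p) :: (complex ^ 'n \<Rightarrow> complex) set).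
    integrable fock_volume (fock_density \<alpha> f) \<and>
    (LINT z|fock_volume. fock_density \<alpha> f z) \<le> C * fock_norm p (\<alpha> * p) f \<and>
    fock_growth \<alpha> (C * fock_norm p (\<alpha> * p) f) f"
proof -
  obtain C where C: "C > 0" "\<And>f z. f \<in> fock_space p (\<alpha> * p) \<Longrightarrow>
    norm (f z) \<le> C * fock_norm p (\<alpha> * p) f * exp ((norm z)\<^sup>2 / 2) * (1 + norm (z :: complex ^ 'n)) powr \<alpha>"
    using fock_pointwise[OF p, of \<alpha>, where 'n = 'n] by blast
  \<comment> \<open>\<open>C\<close> serves the pointwise bound and \<open>C powr (1 - p)\<close>
    the integral, because
    \<open>(C * N) powr (1 - p) * N powr p = C powr (1 - p) * N\<close>.\<close>
  define C' where "C' = max C (C powr (1 - p))"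
  have *: "integrable fock_volume (fock_density \<alpha> f) \<and>
    (LINT z|fock_volume. fock_density \<alpha> f z) \<le> C' * fock_norm p (\<alpha> * p) f \<and>
    fock_growth \<alpha> (C' * fock_norm p (\<alpha> * p) f) f" if f: "f \<in> fock_space p (\<alpha> * p)" for f :: "complex ^ 'n \<Rightarrow> complex"
  proof (intro conjI)
    define N where "N = fock_norm p (\<alpha> * p) f"
    have N: "N \<ge> 0" by (simp add: N_def)
    have fe: "entire f" and fi: "integrable fock_volume (fock_integrand p (\<alpha> * p) f)"
      using f by (auto simp: fock_space_def)
    have [measurable]: "f \<in> borel_measurable borel" by (rule entire_measurable[OF fe])
    have d: "fock_density \<alpha> f z \<le> C * N" for z
    proof -
      have "fock_density \<alpha> f z \<le> C * N * exp ((norm z)\<^sup>2 / 2) * (1 + norm z) powr \<alpha> * exp (- (norm z)\<^sup>2 / 2) * (1 + norm z) powr (- \<alpha>)"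
        unfolding fock_density_def N_def using C(2)[OF f, of z] by (intro mult_right_mono) auto
      also have "\<dots> = C * N * (exp ((norm z)\<^sup>2 / 2) * exp (- (norm z)\<^sup>2 / 2)) * ((1 + norm z) powr \<alpha> * (1 + norm z) powr (- \<alpha>))"
        by (simp only: mult_ac)
      also have "\<dots> = C * N" by (simp add: add_nonneg_eq_0_iff flip: exp_add powr_add)
      finally show ?thesis .
    qed
    have d0: "0 \<le> fock_density \<alpha> f z" for z by (simp add: fock_density_def)
    have dp: "fock_density \<alpha> f z powr p = fock_integrand p (\<alpha> * p) f z" for z
      by (simp add: fock_density_def fock_integrand_def norm_mult powr_mult powr_powr)
    have b: "fock_density \<alpha> f z \<le> (C * N) powr (1 - p) * fock_integrand p (\<alpha> * p) f z" for z
    proof -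
      have "fock_density \<alpha> f z = fock_density \<alpha> f z powr (1 - p) * fock_density \<alpha> f z powr p"
        using d0[of z] by (cases "fock_density \<alpha> f z = 0") (auto simp flip: powr_add)
      also have "\<dots> \<le> (C * N) powr (1 - p) * fock_density \<alpha> f z powr p"
        using p d d0 by (intro mult_right_mono powr_mono2) auto
      finally show ?thesis by (simp only: dp)
    qed
    have bi: "integrable fock_volume (\<lambda>z. (C * N) powr (1 - p) * fock_integrand p (\<alpha> * p) f z)"
      by (intro integrable_mult_right fi)
    show int: "integrable fock_volume (fock_density \<alpha> f)"
    proof (rule Bochner_Integration.integrable_bound[OF bi])
      have "(\<lambda>z :: complex ^ 'n. exp (- (norm z)\<^sup>2 / 2)) \<in> borel_measurable borel" by measurable
      moreover have "(\<lambda>z :: complex ^ 'n. (1 + norm z) powr (- \<alpha>)) \<in> borel_measurable borel" by measurable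
      ultimately show "fock_density \<alpha> f \<in> borel_measurable fock_volume"
        unfolding fock_density_def[abs_def] measurable_fock_volume
        by (intro borel_measurable_times borel_measurable_norm) auto
    qed (use b d0 in \<open>auto intro!: order_trans[OF b abs_ge_self]\<close>)
    have "(LINT z|fock_volume. fock_density \<alpha> f z) \<le> (LINT z|fock_volume. (C * N) powr (1 - p) * fock_integrand p (\<alpha> * p) f z)"
      by (rule integral_mono[OF int bi b])
    also have "\<dots> = (C * N) powr (1 - p) * N powr p"
      using p by (simp add: integral_fock_integrand N_def)
    also have "\<dots> = C powr (1 - p) * N"
      using N C(1) by (cases "N = 0") (auto simp: powr_mult mult.assoc simp flip: powr_add)
    also have "\<dots> \<le> C' * N" using N by (intro mult_right_mono) (auto simp: C'_def)
    finally show "(LINT z|fock_volume. fock_density \<alpha> f z) \<le> C' * fock_norm p (\<alpha> * p) f" by (simp add: N_def)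
    show "fock_growth \<alpha> (C' * fock_norm p (\<alpha> * p) f) f"
      unfolding fock_growth_def
    proof (intro conjI allI)
      show "0 \<le> C' * fock_norm p (\<alpha> * p) f" using C(1) by (simp add: C'_def)
      fix z :: "complex ^ 'n"
      have "C * N * (exp ((norm z)\<^sup>2 / 2) * (1 + norm z) powr \<alpha>) \<le> C' * N * (exp ((norm z)\<^sup>2 / 2) * (1 + norm z) powr \<alpha>)"
        using N by (intro mult_right_mono) (auto simp: C'_def)
      then show "norm (f z) \<le> C' * fock_norm p (\<alpha> * p) f * (exp ((norm z)\<^sup>2 / 2) * (1 + norm z) powr \<alpha>)"
        using C(2)[OF f, of z] by (simp add: N_def mult.assoc)
    qed
  qed
  have "C' \<ge> 0" using C(1) by (simp add: C'_def)
  then show ?thesis using * by blast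
qed

lemma fock_form_bound:
  assumes [measurable]: "f \<in> borel_measurable borel" "g \<in> borel_measurable borel"
    and D: "integrable fock_volume D" "\<And>z :: complex ^ 'n. norm (f z) * norm (g z) * fock_weight \<sigma> z \<le> D z"
  shows "integrable fock_volume (fock_form_integrand \<sigma> f g)" "norm (fock_form \<sigma> f g) \<le> (LINT z|fock_volume. D z)"
proof -
  have n: "norm (fock_form_integrand \<sigma> f g z) \<le> D z" for z
    using D(2)[of z] by (simp add: fock_form_integrand_eq norm_mult)
  have m: "fock_form_integrand \<sigma> f g \<in> borel_measurable borel"
    unfolding fock_form_integrand_eq[abs_def] by measurable
  show i: "integrable fock_volume (fock_form_integrand \<sigma> f g)"
    by (rule Bochner_Integration.integrable_bound[OF D(1)])
       (use m n in \<open>auto intro!: order_trans[OF n abs_ge_self]\<close>)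
  have "norm (fock_form \<sigma> f g) \<le> (LINT z|fock_volume. norm (fock_form_integrand \<sigma> f g z))"
    unfolding fock_form_def by (rule integral_norm_bound)
  also have "\<dots> \<le> (LINT z|fock_volume. D z)"
    using i D(1) n by (intro integral_mono) auto
  finally show "norm (fock_form \<sigma> f g) \<le> (LINT z|fock_volume. D z)" .
qed

lemma fock_form_low_bound:
  fixes a b :: real
  shows "\<exists>C\<ge>0. \<forall>f g :: complex ^ 'n \<Rightarrow> complex. \<forall>A B. entire f \<longrightarrow> entire g \<longrightarrow> fock_growth a A f \<longrightarrow> fock_growth b B g \<longrightarrow>
    integrable fock_volume (fock_form_integrand 0 (low_part K f) (low_part K g)) \<and>
    norm (fock_form 0 (low_part K f) (low_part K g)) \<le> C * A * B"
proof -
  define I where "I = (LINT z|(fock_volume :: (complex ^ 'n) measure). (1 + norm z) powr (real K + real K) * exp (0 * norm z) * exp (- 1 * (norm z)\<^sup>2))"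
  define L where "L = real K * growth_const a * (real K * growth_const b)"
  have L: "L \<ge> 0" using growth_const_pos[of a] growth_const_pos[of b] by (simp add: L_def)
  have I: "I \<ge> 0" unfolding I_def by (rule integral_nonneg_AE) simp
  have "integrable fock_volume (fock_form_integrand 0 (low_part K f) (low_part K g)) \<and>
    norm (fock_form 0 (low_part K f) (low_part K g)) \<le> L * I * A * B"
    if f: "entire f" "fock_growth a A f" and g: "entire g" "fock_growth b B g" for f g :: "complex ^ 'n \<Rightarrow> complex" and A B
  proof -
    have AB: "A \<ge> 0" "B \<ge> 0" using f g by (auto simp: fock_growth_def)
    define D where "D z = L * A * B * ((1 + norm z) powr (real K + real K) * exp (0 * norm z) * exp (- 1 * (norm z)\<^sup>2))" for z :: "complex ^ 'n"
    have D: "integrable fock_volume D"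
      unfolding D_def by (intro integrable_mult_right gauss_growth_integrable) simp
    have le: "norm (low_part K f z) * norm (low_part K g z) * fock_weight 0 z \<le> D z" for z
    proof -
      have "fock_weight 0 z \<le> exp (- (norm z)\<^sup>2)" by (simp add: fock_weight_def)
      then have "norm (low_part K f z) * norm (low_part K g z) * fock_weight 0 z
        \<le> (real K * (A * growth_const a) * (1 + norm z) powr real K) * (real K * (B * growth_const b) * (1 + norm z) powr real K) * exp (- (norm z)\<^sup>2)"
        using AB growth_const_pos[of a] growth_const_pos[of b]
        by (intro mult_mono fock_growth_low_part f g) auto
      also have "\<dots> = D z" unfolding D_def L_def powr_add by (simp add: mult_ac)
      finally show ?thesis .
    qed
    have "(LINT z|fock_volume. D z) = L * I * A * B" unfolding D_def I_def by simp
    then show ?thesis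
      using fock_form_bound[OF entire_measurable[OF entire_low_part[OF f(1)]] entire_measurable[OF entire_low_part[OF g(1)]] D le]
      by simp
  qed
  then show ?thesis using L I by (intro exI[of _ "L * I"]) auto
qed

text \<open>In the unit ball both high parts vanish to order \<open>K\<close>, leaving the
  integrable weight \<open>fock_weight (\<sigma> - 2 * K)\<close>. Outside it, since
  \<open>\<sigma> = \<alpha> + \<beta>\<close>, the growth of \<open>g\<close> times the weight is
  at most a multiple of \<open>exp (- norm z ^ 2 / 2) * (1 + norm z) powr (- \<alpha>)\<close>; with
  \<open>f\<close> this is the integrable \<open>fock_density\<close>, and with the polynomial
  \<open>low_part K f\<close> it is a Gaussian integral.\<close>

lemma fock_form_high_bound:
  fixes p \<alpha> \<beta> :: real
  assumes p: "0 < p" "p \<le> 1"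
  defines "\<sigma> \<equiv> \<alpha> + \<beta>" and "K \<equiv> fock_cut CARD('n) (\<alpha> + \<beta>)"
  shows "\<exists>C\<ge>0. \<forall>f \<in> fock_space p (\<alpha> * p). \<forall>g :: complex ^ 'n \<Rightarrow> complex. \<forall>B. entire g \<longrightarrow> fock_growth \<beta> B g \<longrightarrow>
    integrable fock_volume (fock_form_integrand \<sigma> (high_part K f) (high_part K g)) \<and>
    norm (fock_form \<sigma> (high_part K f) (high_part K g)) \<le> C * fock_norm p (\<alpha> * p) f * B"
proof -
  obtain C1 where C1: "C1 \<ge> 0" "\<And>f :: complex ^ 'n \<Rightarrow> complex. f \<in> fock_space p (\<alpha> * p) \<Longrightarrow>
    integrable fock_volume (fock_density \<alpha> f) \<and>
    (LINT z|fock_volume. fock_density \<alpha> f z) \<le> C1 * fock_norm p (\<alpha> * p) f \<and>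
    fock_growth \<alpha> (C1 * fock_norm p (\<alpha> * p) f) f"
    using fock_density_integrable[OF p, of \<alpha>, where 'n = 'n] by blast
  obtain C2 where C2: "C2 \<ge> 0" "\<And>g :: complex ^ 'n \<Rightarrow> complex. \<And>B. entire g \<Longrightarrow> fock_growth \<beta> B g \<Longrightarrow> fock_growth \<beta> (C2 * B) (high_part K g)"
    using fock_growth_high_part_global[of \<beta> K, where 'n = 'n] by blast
  define W where "W = (fock_weight (\<sigma> - 2 * real K) :: complex ^ 'n \<Rightarrow> real)"
  have W: "integrable fock_volume W" unfolding W_def
    using fock_cut_le[of "CARD('n)" \<sigma> K] by (intro fock_weight_integrable) (simp add: K_def \<sigma>_def)
  define V where "V z = (1 + norm z) powr (real K - \<alpha>) * exp (0 * norm z) * exp (- (1/2) * (norm z)\<^sup>2)" for z :: "complex ^ 'n"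
  have V: "integrable fock_volume V" unfolding V_def by (rule gauss_growth_integrable) simp
  define m1 where "m1 = 4 * growth_const \<alpha> * growth_const \<beta> * C1"
  define m2 where "m2 = C2 * 2 powr \<bar>\<sigma>\<bar>"
  define m3 where "m3 = C1 * real K * growth_const \<alpha>"
  have m: "m1 \<ge> 0" "m2 \<ge> 0" "m3 \<ge> 0"
    using C1 C2 growth_const_pos[of \<alpha>] growth_const_pos[of \<beta>] by (auto simp: m1_def m2_def m3_def)
  define IW where "IW = (LINT z|fock_volume. W z)"
  define IV where "IV = (LINT z|fock_volume. V z)"
  have I: "IW \<ge> 0" "IV \<ge> 0" unfolding IW_def IV_def
    by (auto intro!: integral_nonneg_AE simp: W_def V_def)
  define C where "C = m1 * IW + m2 * (C1 + m3 * IV)"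
  have C: "C \<ge> 0" using m I C1 by (simp add: C_def)
  have "integrable fock_volume (fock_form_integrand \<sigma> (high_part K f) (high_part K g)) \<and>
    norm (fock_form \<sigma> (high_part K f) (high_part K g)) \<le> C * fock_norm p (\<alpha> * p) f * B"
    if f: "f \<in> fock_space p (\<alpha> * p)" and g: "entire g" "fock_growth \<beta> B g" for f g :: "complex ^ 'n \<Rightarrow> complex" and B
  proof -
    define N where "N = fock_norm p (\<alpha> * p) f"
    have N: "N \<ge> 0" by (simp add: N_def)
    have B: "B \<ge> 0" using g by (auto simp: fock_growth_def)
    have fe: "entire f" using f by (auto simp: fock_space_def)
    have fg: "fock_growth \<alpha> (C1 * N) f" and fd: "integrable fock_volume (fock_density \<alpha> f)"
      "(LINT z|fock_volume. fock_density \<alpha> f z) \<le> C1 * N" using C1(2)[OF f] by (auto simp: N_def)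
    \<comment> \<open>The first summand dominates in the unit ball, the second outside it.\<close>
    define D where "D z = m1 * N * B * W z + m2 * B * (fock_density \<alpha> f z + m3 * N * V z)" for z
    have D: "integrable fock_volume D"
      unfolding D_def by (intro Bochner_Integration.integrable_add integrable_mult_right W V fd)
    have d0: "0 \<le> fock_density \<alpha> f z" "0 \<le> W z" "0 \<le> V z" for z by (auto simp: fock_density_def W_def V_def)
    have le: "norm (high_part K f z) * norm (high_part K g z) * fock_weight \<sigma> z \<le> D z" for z
    proof (cases "norm z \<le> 1")
      case True
      have "norm (high_part K f z) * norm (high_part K g z) * fock_weight \<sigma> z
        \<le> (2 * (C1 * N * growth_const \<alpha>) * norm z ^ K) * (2 * (B * growth_const \<beta>) * norm z ^ K) * fock_weight \<sigma> z"
        using B N C1(1) growth_const_pos[of \<alpha>] growth_const_pos[of \<beta>]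
        by (intro mult_right_mono mult_mono fock_growth_high_part fe fg g True) auto
      also have "\<dots> = m1 * N * B * (norm z ^ K * norm z ^ K * fock_weight \<sigma> z)" by (simp add: m1_def mult_ac)
      also have "norm z ^ K * norm z ^ K * fock_weight \<sigma> z = W z"
      proof (cases "z = 0")
        case False
        then have "norm z ^ K * norm z ^ K = norm z powr (2 * real K)" by (simp add: powr_realpow[symmetric] flip: powr_add)
        then show ?thesis using False by (simp add: W_def fock_weight_def mult_ac flip: powr_add)
      qed (simp add: W_def fock_weight_def)
      also have "m1 * N * B * W z \<le> D z"
        unfolding D_def using m N B d0 by (simp add: mult_nonneg_nonneg)
      finally show ?thesis .
    next
      case False
      define G where "G = exp (- (norm z)\<^sup>2 / 2) * (1 + norm z) powr (- \<alpha>)"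
      have "norm (high_part K g z) * fock_weight \<sigma> z \<le>
        (C2 * B * (exp ((norm z)\<^sup>2 / 2) * (1 + norm z) powr \<beta>)) * (2 powr \<bar>\<sigma>\<bar> * (1 + norm z) powr (- \<sigma>) * exp (- (norm z)\<^sup>2))"
        using C2(2)[OF g] False unfolding fock_growth_def by (intro mult_mono fock_weight_far) auto
      also have "\<dots> = m2 * B * ((exp ((norm z)\<^sup>2 / 2) * exp (- (norm z)\<^sup>2)) * ((1 + norm z) powr \<beta> * (1 + norm z) powr (- \<sigma>)))"
        by (simp add: m2_def mult_ac)
      also have "exp ((norm z)\<^sup>2 / 2) * exp (- (norm z)\<^sup>2) = exp (- (norm z)\<^sup>2 / 2)"
        by (simp flip: exp_add)
      also have "(1 + norm z) powr \<beta> * (1 + norm z) powr (- \<sigma>) = (1 + norm z) powr (- \<alpha>)"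
        by (simp add: \<sigma>_def flip: powr_add)
      finally have 1: "norm (high_part K g z) * fock_weight \<sigma> z \<le> m2 * B * G" by (simp add: G_def)
      have "norm (high_part K f z) \<le> norm (f z) + real K * (C1 * N * growth_const \<alpha>) * (1 + norm z) powr real K"
        unfolding high_part_def by (intro order_trans[OF norm_triangle_ineq4] add_left_mono fock_growth_low_part fe fg)
      then have "norm (high_part K f z) * G \<le> (norm (f z) + real K * (C1 * N * growth_const \<alpha>) * (1 + norm z) powr real K) * G"
        by (intro mult_right_mono) (auto simp: G_def)
      also have "\<dots> = norm (f z) * G + m3 * N * ((1 + norm z) powr real K * G)" by (simp add: m3_def algebra_simps)
      also have "norm (f z) * G = fock_density \<alpha> f z" by (simp add: G_def fock_density_def mult_ac)
      also have "(1 + norm z) powr real K * G = V z" unfolding G_def V_def diff_conv_add_uminus powr_add by simp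
      finally have 2: "norm (high_part K f z) * G \<le> fock_density \<alpha> f z + m3 * N * V z" .
      have "norm (high_part K f z) * norm (high_part K g z) * fock_weight \<sigma> z
        = norm (high_part K f z) * (norm (high_part K g z) * fock_weight \<sigma> z)" by (simp add: mult.assoc)
      also have "\<dots> \<le> norm (high_part K f z) * (m2 * B * G)" by (intro mult_left_mono 1) simp
      also have "\<dots> = m2 * B * (norm (high_part K f z) * G)" by (simp only: mult_ac)
      also have "\<dots> \<le> m2 * B * (fock_density \<alpha> f z + m3 * N * V z)"
        using m B by (intro mult_left_mono 2) auto
      also have "\<dots> \<le> D z" unfolding D_def using m N B d0 by (simp add: mult_nonneg_nonneg)
      finally show ?thesis .
    qed
    have "(LINT z|fock_volume. D z) = m1 * N * B * IW + m2 * B * ((LINT z|fock_volume. fock_density \<alpha> f z) + m3 * N * IV)"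
      unfolding D_def IW_def IV_def using W V fd(1)
      by (simp add: Bochner_Integration.integral_add Bochner_Integration.integrable_add integrable_mult_right)
    also have "\<dots> \<le> m1 * N * B * IW + m2 * B * (C1 * N + m3 * N * IV)"
      using m B fd(2) by (intro add_left_mono mult_left_mono add_right_mono) auto
    also have "\<dots> = C * N * B" by (simp add: C_def algebra_simps)
    finally show ?thesis
      using fock_form_bound[OF entire_measurable[OF entire_high_part[OF fe]] entire_measurable[OF entire_high_part[OF g(1)]] D le]
      unfolding N_def by auto
  qed
  then show ?thesis using C by (intro exI[of _ C]) auto
qed

lemma fock_pairing_bound:
  fixes p \<alpha> \<beta> :: real
  assumes p: "0 < p" "p \<le> 1"
  shows "\<exists>C\<ge>0. \<forall>f \<in> fock_space p (\<alpha> * p). \<forall>g :: complex ^ 'n \<Rightarrow> complex. \<forall>B. entire g \<longrightarrow> fock_growth \<beta> B g \<longrightarrow>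
    fock_pairing_well_defined (\<alpha> + \<beta>) f g \<and>
    norm (fock_pairing (\<alpha> + \<beta>) f g) \<le> C * fock_norm p (\<alpha> * p) f * B"
proof -
  define \<sigma> where "\<sigma> = \<alpha> + \<beta>"
  define K where "K = fock_cut CARD('n) \<sigma>"
  obtain C1 where C1: "C1 \<ge> 0" "\<And>f :: complex ^ 'n \<Rightarrow> complex. f \<in> fock_space p (\<alpha> * p) \<Longrightarrow>
    fock_growth \<alpha> (C1 * fock_norm p (\<alpha> * p) f) f"
    using fock_density_integrable[OF p, of \<alpha>, where 'n = 'n] by blast
  obtain C2 where C2: "C2 \<ge> 0" "\<And>f g :: complex ^ 'n \<Rightarrow> complex. \<And>A B. entire f \<Longrightarrow> entire g \<Longrightarrow> fock_growth \<alpha> A f \<Longrightarrow> fock_growth \<beta> B g \<Longrightarrow>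
    integrable fock_volume (fock_form_integrand 0 (low_part K f) (low_part K g)) \<and>
    norm (fock_form 0 (low_part K f) (low_part K g)) \<le> C2 * A * B"
    using fock_form_low_bound[of \<alpha> \<beta> K, where 'n = 'n] by blast
  obtain C3 where C3: "C3 \<ge> 0" "\<And>f g :: complex ^ 'n \<Rightarrow> complex. \<And>B. f \<in> fock_space p (\<alpha> * p) \<Longrightarrow> entire g \<Longrightarrow> fock_growth \<beta> B g \<Longrightarrow>
    integrable fock_volume (fock_form_integrand \<sigma> (high_part K f) (high_part K g)) \<and>
    norm (fock_form \<sigma> (high_part K f) (high_part K g)) \<le> C3 * fock_norm p (\<alpha> * p) f * B"
    using fock_form_high_bound[OF p, of \<alpha> \<beta>, where 'n = 'n] unfolding \<sigma>_def K_def by blast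
  have "fock_pairing_well_defined \<sigma> f g \<and> norm (fock_pairing \<sigma> f g) \<le> (C2 * C1 + C3) * fock_norm p (\<alpha> * p) f * B"
    if f: "f \<in> fock_space p (\<alpha> * p)" and g: "entire g" "fock_growth \<beta> B g" for f g :: "complex ^ 'n \<Rightarrow> complex" and B
  proof -
    have fe: "entire f" using f by (auto simp: fock_space_def)
    note eq = fock_pairing_eq[OF fe g(1), of \<sigma>, folded K_def]
    have "norm (fock_pairing \<sigma> f g) \<le> C2 * (C1 * fock_norm p (\<alpha> * p) f) * B + C3 * fock_norm p (\<alpha> * p) f * B"
      unfolding eq using C2(2)[OF fe g(1) C1(2)[OF f] g(2)] C3(2)[OF f g]
      by (intro norm_triangle_mono) auto
    also have "\<dots> = (C2 * C1 + C3) * fock_norm p (\<alpha> * p) f * B" by (simp add: algebra_simps)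
    finally show ?thesis
      using eq C2(2)[OF fe g(1) C1(2)[OF f] g(2)] C3(2)[OF f g] by auto
  qed
  then show ?thesis using C1 C2 C3 unfolding \<sigma>_def by (intro exI[of _ "C2 * C1 + C3"]) auto
qed

section \<open>Fractional multipliers\<close>

lemma fock_growth_bounded_on_balls:
  fixes f :: "complex ^ 'n \<Rightarrow> complex"
  assumes "fock_growth a A f" shows "\<exists>B. \<forall>z. norm z \<le> R \<longrightarrow> norm (f z) \<le> B"
proof (intro exI allI impI)
  fix z :: "complex ^ 'n" assume z: "norm z \<le> R"
  have "exp ((norm z)\<^sup>2 / 2) \<le> exp (R\<^sup>2 / 2)" using z by (simp add: power_mono)
  moreover have "(1 + norm z) powr a \<le> (1 + R) powr \<bar>a\<bar>"
  proof -
    have "(1 + norm z) powr a \<le> (1 + norm z) powr \<bar>a\<bar>" by (intro powr_mono) auto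
    also have "\<dots> \<le> (1 + R) powr \<bar>a\<bar>" using z by (intro powr_mono2) auto
    finally show ?thesis .
  qed
  ultimately have "exp ((norm z)\<^sup>2 / 2) * (1 + norm z) powr a \<le> exp (R\<^sup>2 / 2) * (1 + R) powr \<bar>a\<bar>"
    by (intro mult_mono) auto
  then show "norm (f z) \<le> A * (exp (R\<^sup>2 / 2) * (1 + R) powr \<bar>a\<bar>)"
    using assms unfolding fock_growth_def by (meson mult_left_mono order_trans)
qed

lemma entire_if_expansion_growth:
  assumes "homogeneous_expansion f q" "fock_growth a A f" shows "entire f"
  using assms(1) by (rule entire_if_homogeneous_expansion) (rule fock_growth_bounded_on_balls[OF assms(2)])

lemma fock_growth_add:
  assumes "fock_growth a A f" "fock_growth a B g" shows "fock_growth a (A + B) (\<lambda>z. f z + g z)"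
  unfolding fock_growth_def
proof (intro conjI allI)
  show "0 \<le> A + B" using assms by (simp add: fock_growth_def)
  show "norm (f z + g z) \<le> (A + B) * (exp ((norm z)\<^sup>2 / 2) * (1 + norm z) powr a)" for z
    using assms norm_triangle_mono[of "f z" _ "g z"] unfolding fock_growth_def by (simp add: distrib_right)
qed

lemma powser_derivative_sums:
  fixes c :: "nat \<Rightarrow> complex"
  assumes F: "\<And>w. (\<lambda>k. c k * w ^ k) sums F w"
  shows "(\<lambda>k. of_nat k * c k) sums deriv F 1"
proof -
  have sm: "summable (\<lambda>k. c k * w ^ k)" for w using sums_summable[OF F] .
  have "F = (\<lambda>w. \<Sum>k. c k * w ^ k)" using F sums_unique by blast
  moreover have "((\<lambda>w. \<Sum>k. c k * w ^ k) has_field_derivative (\<Sum>k. diffs c k * 1 ^ k)) (at 1)"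
    by (rule termdiffs_strong_converges_everywhere[OF sm])
  ultimately have "(F has_field_derivative (\<Sum>k. diffs c k * 1 ^ k)) (at 1)"
    by (simp only:)
  then have "deriv F 1 = (\<Sum>k. diffs c k * 1 ^ k)" by (rule DERIV_imp_deriv)
  moreover have "summable (\<lambda>k. diffs c k * 1 ^ k)" by (rule termdiff_converges_all[OF sm])
  ultimately show ?thesis using diffs_equiv[of c 1] by simp
qed

text \<open>The radial derivative, estimated by Cauchy's inequality on the circle of radius \<open>(1 + norm z) powr (-2)\<close>
  around \<open>1\<close> in the complex line through \<open>z\<close>, where the Gaussian changes by a bounded factor only.\<close>

lemma fock_growth_radial_derivative:
  "\<exists>C\<ge>0. \<forall>(H :: complex ^ 'n \<Rightarrow> complex) h A. homogeneous_expansion H h \<longrightarrow> fock_growth a A H \<longrightarrow>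
    (\<exists>H'. homogeneous_expansion H' (\<lambda>k z. (of_nat k + of_real c) * h k z) \<and> fock_growth (a + 2) (C * A) H')"
proof -
  \<comment> \<open>On the circle used below \<open>norm z ^ 2\<close> grows by at most
    \<open>2 * 1 + 1 * 1\<close>, hence \<open>3/2\<close> after halving;
    \<open>\<bar>c\<bar>\<close> pays for the term of order zero.\<close>
  define C where "C = exp (3/2) * 2 powr \<bar>a\<bar> + \<bar>c\<bar>"
  have "\<exists>H'. homogeneous_expansion H' (\<lambda>k z. (of_nat k + of_real c) * h k z) \<and> fock_growth (a + 2) (C * A) H'"
    if H: "homogeneous_expansion H h" "fock_growth a A H" for H :: "complex ^ 'n \<Rightarrow> complex" and h A
  proof -
    have He: "entire H" by (rule entire_if_expansion_growth[OF H])
    have A: "A \<ge> 0" using H(2) by (simp add: fock_growth_def)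
    \<comment> \<open>Euler's operator: differentiating \<open>\<lambda>w. H (w *s z)\<close> at
      \<open>w = 1\<close> multiplies the part of degree \<open>k\<close> by
      \<open>k\<close>.\<close>
    define H' where "H' z = deriv (\<lambda>w. H (w *s z)) 1 + of_real c * H z" for z
    have s: "(\<lambda>k. of_nat k * h k z + of_real c * h k z) sums H' z" for z
      unfolding H'_def
      using powser_derivative_sums[OF homogeneous_expansion_line_sums[OF H(1)]] H(1)
      by (intro sums_add sums_mult) (auto simp: homogeneous_expansion_def)
    then have 1: "homogeneous_expansion H' (\<lambda>k z. (of_nat k + of_real c) * h k z)"
      using H(1) s[folded distrib_right] unfolding homogeneous_expansion_def
      by (intro conjI allI homogeneous_poly_cmult) auto
    have "norm (H' z) \<le> C * A * (exp ((norm z)\<^sup>2 / 2) * (1 + norm z) powr (a + 2))" for z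
    proof -
      define r where "r = norm z"
      have r: "r \<ge> 0" by (simp add: r_def)
      define \<rho> where "\<rho> = 1 / (1 + r)\<^sup>2"
      have \<rho>: "\<rho> > 0" "r * \<rho> \<le> 1" "r\<^sup>2 * \<rho> \<le> 1" "\<rho> \<le> 1"
      proof -
        have "r \<le> (1 + r)\<^sup>2" "r\<^sup>2 \<le> (1 + r)\<^sup>2" "1 \<le> (1 + r)\<^sup>2" using r by (auto simp: power2_eq_square algebra_simps)
        then show "\<rho> > 0" "r * \<rho> \<le> 1" "r\<^sup>2 * \<rho> \<le> 1" "\<rho> \<le> 1" using r by (auto simp: \<rho>_def divide_le_eq)
      qed
      define G where "G = exp (r\<^sup>2 / 2) * (1 + r) powr a"
      have G0: "G \<ge> 0" by (simp add: G_def)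
      have b: "norm (H (w *s z)) \<le> A * (exp (3/2) * 2 powr \<bar>a\<bar> * G)" if w: "norm (1 - w) = \<rho>" for w
      proof -
        have w1: "norm w \<le> 1 + \<rho>" using norm_triangle_ineq3[of 1 w] w by simp
        have w2: "1 - \<rho> \<le> norm w" using norm_triangle_ineq3[of 1 w] w by simp
        have "(norm (w *s z))\<^sup>2 \<le> ((1 + \<rho>) * r)\<^sup>2" using w1 by (intro power_mono) (auto simp: r_def mult_right_mono)
        also have "\<dots> = r\<^sup>2 + 2 * (r\<^sup>2 * \<rho>) + (r\<^sup>2 * \<rho>) * \<rho>" by (simp add: power2_eq_square algebra_simps)
        also have "\<dots> \<le> r\<^sup>2 + 2 * 1 + 1 * 1" using \<rho> by (intro add_mono mult_mono) auto
        finally have e: "exp ((norm (w *s z))\<^sup>2 / 2) \<le> exp (3/2) * exp (r\<^sup>2 / 2)" by (simp flip: exp_add)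
        have n: "norm (w *s z) \<le> r + 1" "r \<le> norm (w *s z) + 1"
          using mult_right_mono[OF w1 r] mult_right_mono[OF w2 r] \<rho>(2) by (auto simp: r_def algebra_simps)
        have "(1 + norm (w *s z)) powr a \<le> (1 + r) powr a * 2 powr \<bar>a\<bar>"
          using n r norm_ge_zero[of "w *s z"]
          by (intro powr_quotient_le) (simp_all del: norm_vector_smult norm_ge_zero)
        then have "exp ((norm (w *s z))\<^sup>2 / 2) * (1 + norm (w *s z)) powr a \<le> exp (3/2) * exp (r\<^sup>2 / 2) * ((1 + r) powr a * 2 powr \<bar>a\<bar>)"
          using e by (intro mult_mono) auto
        also have "\<dots> = exp (3/2) * 2 powr \<bar>a\<bar> * G" by (simp add: G_def mult_ac)
        finally show ?thesis using H(2) A unfolding fock_growth_def by (meson mult_left_mono order_trans)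
      qed
      have "norm ((deriv ^^ 1) (\<lambda>w. H (w *s z)) 1) \<le> fact 1 * (A * (exp (3/2) * 2 powr \<bar>a\<bar> * G)) / \<rho> ^ 1"
      proof (rule Cauchy_inequality)
        have "(\<lambda>w. H (w *s z)) holomorphic_on S" for S using entire_line_holomorphic[OF He, of 0 z] by simp
        then show "(\<lambda>w. H (w *s z)) holomorphic_on ball 1 \<rho>" "continuous_on (cball 1 \<rho>) (\<lambda>w. H (w *s z))"
          using holomorphic_on_imp_continuous_on by auto
      qed (use \<rho> b in auto)
      then have "norm (deriv (\<lambda>w. H (w *s z)) 1) \<le> A * (exp (3/2) * 2 powr \<bar>a\<bar> * G) * (1 + r)\<^sup>2"
        by (simp add: \<rho>_def)
      moreover have "norm (of_real c * H z) \<le> \<bar>c\<bar> * (A * G * (1 + r)\<^sup>2)"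
      proof -
        have "norm (H z) \<le> A * G" using H(2) by (simp add: fock_growth_def G_def r_def)
        also have "\<dots> \<le> A * G * (1 + r)\<^sup>2"
          using mult_left_mono[of 1 "(1 + r)\<^sup>2" "A * G"] A G0 r by simp
        finally show ?thesis by (simp add: norm_mult mult_left_mono)
      qed
      ultimately have "norm (H' z) \<le> A * (exp (3/2) * 2 powr \<bar>a\<bar> * G) * (1 + r)\<^sup>2 + \<bar>c\<bar> * (A * G * (1 + r)\<^sup>2)"
        unfolding H'_def by (rule norm_triangle_mono)
      also have "\<dots> = C * A * (G * (1 + r)\<^sup>2)" by (simp add: C_def algebra_simps)
      also have "G * (1 + r)\<^sup>2 = exp (r\<^sup>2 / 2) * (1 + r) powr (a + 2)" using r by (simp add: G_def powr_add)
      finally show ?thesis by (simp add: r_def)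
    qed
    moreover have "0 \<le> C * A" using A by (simp add: C_def)
    ultimately show ?thesis using 1 unfolding fock_growth_def by blast
  qed
  moreover have "C \<ge> 0" by (simp add: C_def)
  ultimately show ?thesis by blast
qed

lemma fock_growth_iterated_radial_derivative:
  "\<exists>C\<ge>0. \<forall>(H :: complex ^ 'n \<Rightarrow> complex) h A. homogeneous_expansion H h \<longrightarrow> fock_growth a A H \<longrightarrow>
    (\<exists>H'. homogeneous_expansion H' (\<lambda>k z. (\<Prod>j<N. of_nat k + of_real (c j)) * h k z) \<and> fock_growth (a + 2 * real N) (C * A) H')"
proof (induction N)
  case 0
  show ?case by (intro exI[of _ 1]) auto
next
  case (Suc N)
  obtain C where C: "C \<ge> 0" "\<And>(H :: complex ^ 'n \<Rightarrow> complex) h A. homogeneous_expansion H h \<Longrightarrow> fock_growth a A H \<Longrightarrow>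
    (\<exists>H'. homogeneous_expansion H' (\<lambda>k z. (\<Prod>j<N. of_nat k + of_real (c j)) * h k z) \<and> fock_growth (a + 2 * real N) (C * A) H')"
    using Suc by blast
  obtain D where D: "D \<ge> 0" "\<And>(H :: complex ^ 'n \<Rightarrow> complex) h A. homogeneous_expansion H h \<Longrightarrow> fock_growth (a + 2 * real N) A H \<Longrightarrow>
    (\<exists>H'. homogeneous_expansion H' (\<lambda>k z. (of_nat k + of_real (c N)) * h k z) \<and> fock_growth (a + 2 * real N + 2) (D * A) H')"
    using fock_growth_radial_derivative[of "a + 2 * real N" "c N", where 'n = 'n] by blast
  have "\<exists>H'. homogeneous_expansion H' (\<lambda>k z. (\<Prod>j<Suc N. of_nat k + of_real (c j)) * h k z) \<and> fock_growth (a + 2 * real (Suc N)) (D * C * A) H'"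
    if H: "homogeneous_expansion H h" "fock_growth a A H" for H :: "complex ^ 'n \<Rightarrow> complex" and h A
  proof -
    obtain H1 where H1: "homogeneous_expansion H1 (\<lambda>k z. (\<Prod>j<N. of_nat k + of_real (c j)) * h k z)" "fock_growth (a + 2 * real N) (C * A) H1"
      using C(2)[OF H] by blast
    show ?thesis using D(2)[OF H1] by (simp add: mult_ac add_ac)
  qed
  then show ?case using C(1) D(1) by (intro exI[of _ "D * C"]) auto
qed

section \<open>Fractional integration along segments\<close>

definition beta_weight :: "real \<Rightarrow> real \<Rightarrow> real \<Rightarrow> real" where
  "beta_weight a b \<tau> = indicator {0..1} \<tau> * (\<tau> powr (a - 1) * (1 - \<tau>) powr (b - 1))"

lemma beta_weight_nonneg [simp]: "0 \<le> beta_weight a b \<tau>"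
  by (simp add: beta_weight_def)

lemma beta_weight_integral:
  assumes "a > 0" "b > 0" shows "has_bochner_integral lborel (beta_weight a b) (Beta a b)"
proof -
  have "Beta a b > 0" using assms by (simp add: Beta_def)
  moreover have "(\<integral>\<^sup>+\<tau>. ennreal (beta_weight a b \<tau>) \<partial>lborel) = ennreal (Beta a b)"
    unfolding beta_weight_def by (rule nn_integral_has_integral_lebesgue[OF _ has_integral_Beta_real[OF assms]]) simp
  moreover have "beta_weight a b \<in> borel_measurable borel"
    unfolding beta_weight_def[abs_def] by measurable
  ultimately show ?thesis by (intro has_bochner_integral_nn_integral) auto
qed

text \<open>Majorant for the Beta weight combined with the Gaussian decay along a segment. It
  extends to negative \<open>\<tau>\<close> so that the substitution
  \<open>x = R * (1 - \<tau>)\<close> gives a complete Gamma integral, whose size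
  \<open>R powr (- t)\<close> carries the gain.\<close>

definition gamma_weight :: "real \<Rightarrow> real \<Rightarrow> real \<Rightarrow> real" where
  "gamma_weight t R \<tau> = indicator {..1} \<tau> * ((1 - \<tau>) powr (t - 1) * exp (- (1 - \<tau>) * R))"

lemma gamma_weight_integral:
  assumes "t > 0" "R > 0" shows "has_bochner_integral lborel (gamma_weight t R) (Gamma t / R powr t)"
proof -
  define \<phi> where "\<phi> x = ennreal (indicator {0..} x * x powr (t - 1) / exp x)" for x :: real
  have [measurable]: "\<phi> \<in> borel_measurable borel" unfolding \<phi>_def[abs_def] by measurable
  have "ennreal (Gamma t) = (\<integral>\<^sup>+x. \<phi> x \<partial>lborel)"
    unfolding \<phi>_def by (rule Gamma_conv_nn_integral_real[OF assms(1)])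
  also have "\<dots> = ennreal \<bar>- R\<bar> * (\<integral>\<^sup>+\<tau>. \<phi> (R + (- R) * \<tau>) \<partial>lborel)"
    using assms by (intro nn_integral_real_affine) auto
  also have "(\<lambda>\<tau>. \<phi> (R + (- R) * \<tau>)) = (\<lambda>\<tau>. ennreal (R powr (t - 1)) * ennreal (gamma_weight t R \<tau>))"
  proof
    fix \<tau> :: real
    have *: "R + (- R) * \<tau> = R * (1 - \<tau>)" by (simp add: algebra_simps)
    have "indicator {0..} (R * (1 - \<tau>)) = (indicator {..1} \<tau> :: real)"
      using assms by (auto simp: indicator_def zero_le_mult_iff)
    then have "indicator {0..} (R * (1 - \<tau>)) * (R * (1 - \<tau>)) powr (t - 1) / exp (R * (1 - \<tau>)) = R powr (t - 1) * gamma_weight t R \<tau>"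
    proof -
      have "exp (- (1 - \<tau>) * R) = inverse (exp (R * (1 - \<tau>)))" by (simp add: algebra_simps flip: exp_minus)
      moreover have "\<tau> \<le> 1 \<Longrightarrow> (R * (1 - \<tau>)) powr (t - 1) = R powr (t - 1) * (1 - \<tau>) powr (t - 1)"
        using assms by (intro powr_mult)
      ultimately show ?thesis using \<open>indicator {0..} (R * (1 - \<tau>)) = _\<close>
        by (cases "\<tau> \<le> 1") (simp_all only: gamma_weight_def divide_inverse, simp_all)
    qed
    then show "\<phi> (R + (- R) * \<tau>) = ennreal (R powr (t - 1)) * ennreal (gamma_weight t R \<tau>)"
      unfolding * \<phi>_def by (simp add: ennreal_mult' gamma_weight_def)
  qed
  also have "(\<integral>\<^sup>+\<tau>. ennreal (R powr (t - 1)) * ennreal (gamma_weight t R \<tau>) \<partial>lborel)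
      = ennreal (R powr (t - 1)) * (\<integral>\<^sup>+\<tau>. ennreal (gamma_weight t R \<tau>) \<partial>lborel)"
    by (rule nn_integral_cmult) (simp add: gamma_weight_def)
  also have "ennreal \<bar>- R\<bar> * (ennreal (R powr (t - 1)) * (\<integral>\<^sup>+\<tau>. ennreal (gamma_weight t R \<tau>) \<partial>lborel))
     = ennreal (R powr t) * (\<integral>\<^sup>+\<tau>. ennreal (gamma_weight t R \<tau>) \<partial>lborel)"
  proof -
    have "R powr t = R * R powr (t - 1)" using assms by (simp add: powr_diff)
    then show ?thesis using assms by (simp add: ennreal_mult mult.assoc)
  qed
  finally have "ennreal (1 / R powr t) * ennreal (Gamma t) = ennreal (1 / R powr t) * (ennreal (R powr t) * (\<integral>\<^sup>+\<tau>. ennreal (gamma_weight t R \<tau>) \<partial>lborel))"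
    by simp
  also have "\<dots> = (\<integral>\<^sup>+\<tau>. ennreal (gamma_weight t R \<tau>) \<partial>lborel)"
    using assms by (simp flip: mult.assoc ennreal_mult)
  finally have "(\<integral>\<^sup>+\<tau>. ennreal (gamma_weight t R \<tau>) \<partial>lborel) = ennreal (Gamma t / R powr t)"
    using assms by (simp flip: ennreal_mult')
  moreover have "Gamma t > 0" using assms by (intro Gamma_real_pos)
  moreover have "gamma_weight t R \<in> borel_measurable borel"
    unfolding gamma_weight_def[abs_def] by measurable
  ultimately show ?thesis using assms
    by (intro has_bochner_integral_nn_integral) (auto simp: gamma_weight_def)
qed

text \<open>With \<open>x = 1 - \<tau>\<close>, moving from \<open>r\<close> to
  \<open>\<tau> * r\<close> lowers the Gaussian exponent by at least
  \<open>x * r\<^sup>2 / 2\<close>. Half of this absorbs the change of the polynomial weight, at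
  most \<open>(1 + x * r) powr \<bar>a\<bar>\<close>; the other half gives the decay in
  \<open>x\<close>, where \<open>(1 - r)\<^sup>2 \<ge> 0\<close> replaces \<open>r\<^sup>2\<close>
  by \<open>(1 + r)\<^sup>2 / 2\<close> at the cost of \<open>exp (1/4)\<close>.\<close>

lemma fock_growth_segment:
  assumes r: "0 \<le> r" and \<tau>: "0 \<le> \<tau>" "\<tau> \<le> (1::real)"
  shows "exp ((\<tau> * r)\<^sup>2 / 2) * (1 + \<tau> * r) powr a
    \<le> exp (\<bar>a\<bar>\<^sup>2) * exp (1/4) * (exp (r\<^sup>2 / 2) * (1 + r) powr a) * exp (- (1 - \<tau>) * ((1 + r)\<^sup>2 / 8))"
proof -
  define x where "x = 1 - \<tau>"
  have x: "0 \<le> x" "x \<le> 1" using \<tau> by (auto simp: x_def)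
  have "(1 + \<tau> * r) powr a \<le> (1 + r) powr a * (1 + x * r) powr \<bar>a\<bar>"
  proof (rule powr_quotient_le)
    have nn: "0 \<le> x * r" "0 \<le> \<tau> * r" "0 \<le> x * r * r" "0 \<le> x * r * (\<tau> * r)" using x r \<tau> by auto
    have xr: "\<tau> * r + x * r = r" by (simp add: x_def algebra_simps)
    have "(1 + r) * (1 + x * r) = 1 + r + x * r + x * r * r" by (simp add: algebra_simps)
    then show "1 + \<tau> * r \<le> (1 + r) * (1 + x * r)" using nn xr by linarith
    have "(1 + \<tau> * r) * (1 + x * r) = 1 + \<tau> * r + x * r + x * r * (\<tau> * r)" by (simp add: algebra_simps)
    then show "1 + r \<le> (1 + \<tau> * r) * (1 + x * r)" using nn xr by linarith
  qed (use r x \<tau> in \<open>auto intro: add_pos_nonneg\<close>)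
  also have "(1 + x * r) powr \<bar>a\<bar> \<le> exp (\<bar>a\<bar>\<^sup>2) * exp (1/4 * (x * r)\<^sup>2)"
    using powr_exp_le_gauss[of "x * r" "1/4" "\<bar>a\<bar>" 0] x r by simp
  also have "exp (1/4 * (x * r)\<^sup>2) \<le> exp (x * r\<^sup>2 / 4)"
  proof -
    have "x\<^sup>2 \<le> x" using x by (simp add: power2_eq_square mult_left_le)
    then have "x\<^sup>2 * r\<^sup>2 \<le> x * r\<^sup>2" by (rule mult_right_mono) simp
    then show ?thesis by (simp add: power_mult_distrib)
  qed
  finally have 1: "(1 + \<tau> * r) powr a \<le> (1 + r) powr a * (exp (\<bar>a\<bar>\<^sup>2) * exp (x * r\<^sup>2 / 4))"
    by (simp add: mult_left_mono)
  have "(\<tau> * r)\<^sup>2 / 2 + x * r\<^sup>2 / 4 \<le> 1/4 + r\<^sup>2 / 2 - x * ((1 + r)\<^sup>2 / 8)"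
  proof -
    have "0 \<le> x * \<tau> * r\<^sup>2" "0 \<le> x * (1 - r)\<^sup>2" using x \<tau> by auto
    moreover have "r\<^sup>2 / 2 - (\<tau> * r)\<^sup>2 / 2 - x * r\<^sup>2 / 2 = x * \<tau> * r\<^sup>2 / 2"
      by (simp add: x_def power2_eq_square field_simps)
    moreover have "x * r\<^sup>2 / 4 + x / 4 - x * ((1 + r)\<^sup>2 / 8) = x * (1 - r)\<^sup>2 / 8"
      by (simp add: power2_eq_square algebra_simps)
    ultimately show ?thesis using x(2) by linarith
  qed
  then have 2: "exp ((\<tau> * r)\<^sup>2 / 2) * exp (x * r\<^sup>2 / 4) \<le> exp (1/4) * exp (r\<^sup>2 / 2) * exp (- x * ((1 + r)\<^sup>2 / 8))"
    by (simp flip: exp_add)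
  have "exp ((\<tau> * r)\<^sup>2 / 2) * (1 + \<tau> * r) powr a \<le> exp ((\<tau> * r)\<^sup>2 / 2) * ((1 + r) powr a * (exp (\<bar>a\<bar>\<^sup>2) * exp (x * r\<^sup>2 / 4)))"
    by (intro mult_left_mono 1) simp
  also have "\<dots> = exp (\<bar>a\<bar>\<^sup>2) * (1 + r) powr a * (exp ((\<tau> * r)\<^sup>2 / 2) * exp (x * r\<^sup>2 / 4))" by (simp only: mult_ac)
  also have "\<dots> \<le> exp (\<bar>a\<bar>\<^sup>2) * (1 + r) powr a * (exp (1/4) * exp (r\<^sup>2 / 2) * exp (- x * ((1 + r)\<^sup>2 / 8)))"
    by (intro mult_left_mono 2) simp
  finally show ?thesis by (simp add: x_def mult_ac)
qed

text \<open>Multiplication of the \<open>k\<close>-th homogeneous part by a Beta function is integration along the segment from \<open>0\<close> to \<open>z\<close>.\<close>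

lemma fock_growth_fractional_integral:
  assumes t: "t > 0" and n: "n > 0"
  shows "\<exists>C\<ge>0. \<forall>(H :: complex ^ 'n \<Rightarrow> complex) h A. homogeneous_expansion H h \<longrightarrow> fock_growth a A H \<longrightarrow>
    (\<exists>H'. homogeneous_expansion H' (\<lambda>k z. of_real (Beta (real (n + k)) t) * h k z) \<and> fock_growth (a - 2 * t) (C * A) H')"
proof -
  define C where "C = exp (\<bar>a\<bar>\<^sup>2) * exp (1/4) * Gamma t * 8 powr t"
  have Gt: "Gamma t > 0" using t by (rule Gamma_real_pos)
  have C: "C \<ge> 0" using Gt by (simp add: C_def)
  define w where "w k = beta_weight (real (n + k)) t" for k
  define b where "b k = Beta (real (n + k)) t" for k
  have wb: "integrable lborel (w k)" "(LINT \<tau>|lborel. w k \<tau>) = b k" for k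
    using beta_weight_integral[of "real (n + k)" t] n t by (auto simp: w_def b_def has_bochner_integral_iff)
  \<comment> \<open>This is why a Beta multiplier is an integral over the segment:
    \<open>\<tau> ^ k * h k z\<close> is the value of \<open>h k\<close> at
    \<open>\<tau> *s z\<close>. At \<open>\<tau> = 0\<close> both weights vanish by the convention
    for \<open>powr\<close>.\<close>
  have wk: "w k \<tau> = \<tau> ^ k * w 0 \<tau>" for k \<tau>
  proof (cases "0 < \<tau> \<and> \<tau> \<le> 1")
    case True
    have "real (n + k) - 1 = real k + (real n - 1)" by simp
    then have "\<tau> powr (real (n + k) - 1) = \<tau> ^ k * \<tau> powr (real n - 1)"
      using True by (simp only: powr_add powr_realpow)
    then show ?thesis by (simp add: w_def beta_weight_def)
  next
    case False
    then have "\<tau> = 0 \<or> \<tau> \<notin> {0..1}" by auto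
    then show ?thesis by (auto simp: w_def beta_weight_def)
  qed
  have w0: "w k \<tau> \<ge> 0" for k \<tau> by (simp add: w_def)
  have b0: "0 \<le> b k" "b k \<le> b 0" for k
  proof -
    show "0 \<le> b k" unfolding wb(2)[symmetric] using w0 by (intro integral_nonneg_AE) auto
    show "b k \<le> b 0" unfolding wb(2)[symmetric]
    proof (rule integral_mono[OF wb(1) wb(1)])
      show "w k \<tau> \<le> w 0 \<tau>" for \<tau>
      proof (cases "\<tau> \<in> {0..1}")
        case True
        then show ?thesis using w0[of 0 \<tau>] by (simp add: wk[of k] mult_left_le_one_le power_le_one)
      qed (simp add: w_def beta_weight_def)
    qed
  qed
  have "\<exists>H'. homogeneous_expansion H' (\<lambda>k z. of_real (b k) * h k z) \<and> fock_growth (a - 2 * t) (C * A) H'"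
    if H: "homogeneous_expansion H h" "fock_growth a A H" for H :: "complex ^ 'n \<Rightarrow> complex" and h A
  proof -
    have A: "A \<ge> 0" using H(2) by (simp add: fock_growth_def)
    have sm: "summable (\<lambda>k. norm (h k z))" for z by (rule homogeneous_expansion_summable[OF H(1)])
    define H' where "H' z = (\<Sum>k. of_real (b k) * h k z)" for z
    have smb: "summable (\<lambda>k. of_real (b k) * h k z)" for z
    proof (rule summable_comparison_test'[OF summable_mult[OF sm, of "b 0"]])
      show "norm (of_real (b k) * h k z) \<le> b 0 * norm (h k z)" for k
        using b0 by (simp add: norm_mult mult_right_mono)
    qed
    have "homogeneous_expansion H' (\<lambda>k z. of_real (b k) * h k z)"
      using H(1) summable_sums[OF smb] unfolding homogeneous_expansion_def H'_def
      by (auto intro: homogeneous_poly_cmult)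
    moreover have "norm (H' z) \<le> C * A * (exp ((norm z)\<^sup>2 / 2) * (1 + norm z) powr (a - 2 * t))" for z
    proof -
      define r where "r = norm z"
      have r: "r \<ge> 0" by (simp add: r_def)
      define R where "R = (1 + r)\<^sup>2 / 8"
      have R: "R > 0" using r by (simp add: R_def)
      define \<epsilon> where "\<epsilon> M = (\<Sum>k. norm (h (k + M) z))" for M
      define X where "X = A * exp (\<bar>a\<bar>\<^sup>2) * exp (1/4) * (exp (r\<^sup>2 / 2) * (1 + r) powr a)"
      have X: "X \<ge> 0" using A by (simp add: X_def)
      \<comment> \<open>Only finite sums are integrated. Replacing \<open>H\<close> by its partial
        sum \<open>F\<close> on the segment costs at most the tail \<open>\<epsilon> M\<close>,
        which disappears as \<open>M\<close> grows.\<close>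
      have partial: "norm (\<Sum>k<M. of_real (b k) * h k z) \<le> X * (Gamma t / R powr t) + \<epsilon> M * b 0" for M
      proof -
        define F where "F \<tau> = (\<Sum>k<M. h k z * of_real \<tau> ^ k)" for \<tau> :: real
        have F: "norm (F \<tau>) \<le> norm (H (of_real \<tau> *s z)) + \<epsilon> M" if "0 \<le> \<tau>" "\<tau> \<le> 1" for \<tau>
        proof -
          let ?c = "\<lambda>k. h k z * of_real \<tau> ^ k"
          have s: "?c sums H (of_real \<tau> *s z)" by (rule homogeneous_expansion_line_sums[OF H(1)])
          have le: "norm (?c (k + M)) \<le> norm (h (k + M) z)" for k
            using that by (simp add: norm_mult norm_power mult_left_le power_le_one)
          have sM: "summable (\<lambda>k. norm (h (k + M) z))" using sm summable_iff_shift[of "\<lambda>k. norm (h k z)" M] by simp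
          have sM': "summable (\<lambda>k. norm (?c (k + M)))"
            by (rule summable_comparison_test'[OF sM]) (use le in auto)
          have "(\<lambda>k. ?c (k + M)) sums (H (of_real \<tau> *s z) - F \<tau>)"
            unfolding F_def by (rule sums_split_initial_segment[OF s])
          then have "norm (H (of_real \<tau> *s z) - F \<tau>) = norm (\<Sum>k. ?c (k + M))" by (simp add: sums_iff)
          also have "\<dots> \<le> (\<Sum>k. norm (?c (k + M)))" by (rule summable_norm[OF sM'])
          also have "\<dots> \<le> \<epsilon> M" unfolding \<epsilon>_def by (rule suminf_le[OF le sM' sM])
          finally show ?thesis using norm_triangle_ineq3[of "H (of_real \<tau> *s z)" "F \<tau>"] by linarith
        qed
        have \<epsilon>0: "\<epsilon> M \<ge> 0" unfolding \<epsilon>_def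
          using sm summable_iff_shift[of "\<lambda>k. norm (h k z)" M] by (intro suminf_nonneg) auto
        have maj: "norm (F \<tau>) * w 0 \<tau> \<le> X * gamma_weight t R \<tau> + \<epsilon> M * w 0 \<tau>" for \<tau>
        proof (cases "\<tau> \<in> {0..1}")
          case True
          have "norm (H (of_real \<tau> *s z)) \<le> A * (exp ((\<tau> * r)\<^sup>2 / 2) * (1 + \<tau> * r) powr a)"
            using H(2) True unfolding fock_growth_def by (auto simp: r_def dest!: spec[of _ "of_real \<tau> *s z"])
          also have "\<dots> \<le> A * (exp (\<bar>a\<bar>\<^sup>2) * exp (1/4) * (exp (r\<^sup>2 / 2) * (1 + r) powr a) * exp (- (1 - \<tau>) * R))"
            unfolding R_def using True A r by (intro mult_left_mono fock_growth_segment) auto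
          also have "\<dots> = X * exp (- (1 - \<tau>) * R)" by (simp add: X_def mult_ac)
          finally have 1: "norm (H (of_real \<tau> *s z)) * w 0 \<tau> \<le> X * exp (- (1 - \<tau>) * R) * w 0 \<tau>"
            by (intro mult_right_mono w0)
          have "w 0 \<tau> \<le> (1 - \<tau>) powr (t - 1)"
          proof -
            have "\<tau> powr (real n - 1) \<le> 1" using True n by (intro powr_le1) auto
            then show ?thesis using True by (simp add: w_def beta_weight_def mult_left_le_one_le)
          qed
          then have "X * exp (- (1 - \<tau>) * R) * w 0 \<tau> \<le> X * exp (- (1 - \<tau>) * R) * (1 - \<tau>) powr (t - 1)"
            using X by (intro mult_left_mono) auto
          also have "\<dots> = X * gamma_weight t R \<tau>" using True by (simp add: gamma_weight_def mult_ac)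
          finally have 2: "norm (H (of_real \<tau> *s z)) * w 0 \<tau> \<le> X * gamma_weight t R \<tau>" using 1 by linarith
          have "norm (F \<tau>) * w 0 \<tau> \<le> (norm (H (of_real \<tau> *s z)) + \<epsilon> M) * w 0 \<tau>"
            using F True by (intro mult_right_mono w0) auto
          then show ?thesis using 2 by (simp add: distrib_right)
        next
          case False
          then show ?thesis using X by (simp add: w_def beta_weight_def gamma_weight_def)
        qed
        have Fw: "of_real (w 0 \<tau>) * F \<tau> = (\<Sum>k<M. of_real (w k \<tau>) * h k z)" for \<tau>
          unfolding F_def sum_distrib_left
        proof (rule sum.cong)
          fix k
          have "complex_of_real (w k \<tau>) = of_real \<tau> ^ k * of_real (w 0 \<tau>)" by (subst wk) simp
          then show "of_real (w 0 \<tau>) * (h k z * of_real \<tau> ^ k) = of_real (w k \<tau>) * h k z" by (simp only: mult_ac)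
        qed simp
        have iw: "integrable lborel (\<lambda>\<tau>. of_real (w k \<tau>) * h k z)" for k
          by (intro integrable_mult_left integrable_of_real wb)
        have "(\<Sum>k<M. of_real (b k) * h k z) = (\<Sum>k<M. LINT \<tau>|lborel. of_real (w k \<tau>) * h k z)"
          by (simp add: wb)
        also have "\<dots> = (LINT \<tau>|lborel. of_real (w 0 \<tau>) * F \<tau>)"
          unfolding Fw by (rule Bochner_Integration.integral_sum[symmetric]) (rule iw)
        finally have "norm (\<Sum>k<M. of_real (b k) * h k z) \<le> (LINT \<tau>|lborel. norm (of_real (w 0 \<tau>) * F \<tau>))"
          using integral_norm_bound by simp
        also have "\<dots> \<le> (LINT \<tau>|lborel. X * gamma_weight t R \<tau> + \<epsilon> M * w 0 \<tau>)"
        proof (rule integral_mono)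
          show "integrable lborel (\<lambda>\<tau>. norm (of_real (w 0 \<tau>) * F \<tau>))"
            unfolding Fw by (intro integrable_norm Bochner_Integration.integrable_sum iw)
          show "integrable lborel (\<lambda>\<tau>. X * gamma_weight t R \<tau> + \<epsilon> M * w 0 \<tau>)"
            using gamma_weight_integral[OF t R] wb(1)
            by (intro Bochner_Integration.integrable_add integrable_mult_right) (auto simp: has_bochner_integral_iff)
          show "norm (of_real (w 0 \<tau>) * F \<tau>) \<le> X * gamma_weight t R \<tau> + \<epsilon> M * w 0 \<tau>" for \<tau>
            using maj[of \<tau>] w0[of 0 \<tau>] by (simp add: norm_mult mult.commute)
        qed
        also have "\<dots> = X * (Gamma t / R powr t) + \<epsilon> M * b 0"
          using gamma_weight_integral[OF t R] wb
          by (subst Bochner_Integration.integral_add) (auto simp: has_bochner_integral_iff intro: integrable_mult_right)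
        finally show ?thesis .
      qed
      have "norm (H' z) \<le> X * (Gamma t / R powr t) + 0 * b 0"
      proof (rule LIMSEQ_le)
        show "(\<lambda>M. norm (\<Sum>k<M. of_real (b k) * h k z)) \<longlonglongrightarrow> norm (H' z)"
          unfolding H'_def by (intro tendsto_norm summable_LIMSEQ smb)
        show "(\<lambda>M. X * (Gamma t / R powr t) + \<epsilon> M * b 0) \<longlonglongrightarrow> X * (Gamma t / R powr t) + 0 * b 0"
          unfolding \<epsilon>_def by (intro tendsto_intros tail_suminf_tendsto sm)
      qed (use partial in blast)
      \<comment> \<open>Here the exponent drops by \<open>2 * t\<close>: \<open>R powr t\<close> is
        \<open>(1 + r) powr (2 * t) / 8 powr t\<close>.\<close>
      also have "\<dots> = C * A * (exp (r\<^sup>2 / 2) * (1 + r) powr (a - 2 * t))"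
      proof -
        have "R powr t = (1 + r) powr (2 * t) / 8 powr t"
          using r by (simp add: R_def powr_divide powr_powr flip: powr_numeral)
        then show ?thesis using r by (simp add: X_def C_def powr_diff mult_ac)
      qed
      finally show ?thesis by (simp add: r_def)
    qed
    moreover have "0 \<le> C * A" using A C by simp
    ultimately show ?thesis unfolding fock_growth_def by blast
  qed
  then show ?thesis using C unfolding b_def by blast
qed

section \<open>Inverting the multiplier of the pairing\<close>

lemma Gamma_falling_product:
  "x - real N > 0 \<Longrightarrow> Gamma x = (\<Prod>j<N. x - real (Suc j)) * Gamma (x - real N)"
proof (induction N)
  case (Suc N)
  have "Gamma (x - real N) = (x - real (Suc N)) * Gamma (x - real (Suc N))"
    using Gamma_plus1[of "x - real (Suc N)"] Suc.prems by (simp add: algebra_simps nonpos_Ints_def)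
  then show ?case using Suc by simp
qed simp

lemma homogeneous_expansion_high_part:
  assumes "entire f"
  shows "homogeneous_expansion (high_part K f) (\<lambda>k z. if k < K then 0 else homogeneous_part f k z)"
  unfolding homogeneous_expansion_def
proof (intro conjI allI)
  show "homogeneous_poly k (\<lambda>z. if k < K then 0 else homogeneous_part f k z)" for k
    using homogeneous_part_homogeneous_poly[OF assms] by (cases "k < K") auto
  fix z
  have "(\<lambda>k. homogeneous_part f k z - (if k \<in> {..<K} then homogeneous_part f k z else 0))
      sums (f z - (\<Sum>k<K. homogeneous_part f k z))"
    by (intro sums_diff homogeneous_part_sums assms sums_If_finite_set) simp
  moreover have "(\<lambda>k. homogeneous_part f k z - (if k \<in> {..<K} then homogeneous_part f k z else 0))
    = (\<lambda>k. if k < K then 0 else homogeneous_part f k z)" by auto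
  ultimately show "(\<lambda>k. if k < K then 0 else homogeneous_part f k z) sums high_part K f z"
    by (simp add: high_part_def low_part_def)
qed

lemma homogeneous_expansion_low_part:
  assumes "entire f"
  shows "homogeneous_expansion (low_part K f) (\<lambda>k z. if k < K then homogeneous_part f k z else 0)"
  unfolding homogeneous_expansion_def
proof (intro conjI allI)
  show "homogeneous_poly k (\<lambda>z. if k < K then homogeneous_part f k z else 0)" for k
    using homogeneous_part_homogeneous_poly[OF assms] by (cases "k < K") auto
  show "(\<lambda>k. if k < K then homogeneous_part f k z else 0) sums low_part K f z" for z
    using sums_If_finite_set[of "{..<K}" "\<lambda>k. homogeneous_part f k z"] by (simp add: low_part_def)
qed

lemma homogeneous_expansion_add:
  assumes "homogeneous_expansion f q" "homogeneous_expansion g r"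
  shows "homogeneous_expansion (\<lambda>z. f z + g z) (\<lambda>k z. q k z + r k z)"
  using assms unfolding homogeneous_expansion_def by (auto intro: homogeneous_poly_add sums_add)

lemma homogeneous_expansion_cmult:
  assumes "homogeneous_expansion f q"
  shows "homogeneous_expansion (\<lambda>z. c * f z) (\<lambda>k z. c * q k z)"
  using assms unfolding homogeneous_expansion_def by (auto intro: homogeneous_poly_cmult sums_mult)

text \<open>The eigenvalue of the pairing in degree \<open>k\<close>, relative to the unweighted
  one; it is 1 below the cut, where no weight is applied.\<close>

definition pairing_ratio :: "nat \<Rightarrow> real \<Rightarrow> nat \<Rightarrow> real" where
  "pairing_ratio n \<sigma> k = (if k < fock_cut n \<sigma> then 1 else fock_ratio n \<sigma> k)"

lemma pairing_ratio_pos: "n > 0 \<Longrightarrow> pairing_ratio n \<sigma> k > 0"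
  unfolding pairing_ratio_def by (auto intro!: fock_ratio_pos fock_cut_le)

text \<open>\<open>1 / fock_ratio\<close> is a Beta multiplier of order \<open>t\<close> followed by \<open>N\<close> radial derivatives, where \<open>N - t = \<sigma> / 2\<close>.\<close>

lemma fock_growth_inverse_ratio:
  fixes \<alpha> \<beta> :: real
  defines "\<sigma> \<equiv> \<alpha> + \<beta>"
  shows "\<exists>C\<ge>0. \<forall>(G :: complex ^ 'n \<Rightarrow> complex) A. entire G \<longrightarrow> fock_growth (- \<alpha>) A G \<longrightarrow>
    (\<exists>g. entire g \<and> fock_growth \<beta> (C * A) g \<and>
      (\<forall>k z. of_real (pairing_ratio CARD('n) \<sigma> k) * homogeneous_part g k z = homogeneous_part G k z))"
proof -
  define n where "n = CARD('n)"
  have n: "n > 0" by (simp add: n_def)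
  define K where "K = fock_cut n \<sigma>"
  \<comment> \<open>The least natural number exceeding \<open>\<sigma> / 2\<close>, so that
    \<open>t\<close> is positive; for negative \<open>\<sigma>\<close> it is 0 and there are no
    derivatives.\<close>
  define N where "N = nat (\<lfloor>\<sigma> / 2\<rfloor> + 1)"
  define t where "t = real N - \<sigma> / 2"
  have t: "t > 0" unfolding t_def N_def by linarith
  have Gt: "Gamma t > 0" using t by (rule Gamma_real_pos)
  obtain C0 where C0: "C0 \<ge> 0" "\<And>(f :: complex ^ 'n \<Rightarrow> complex) A. entire f \<Longrightarrow> fock_growth (- \<alpha>) A f \<Longrightarrow> fock_growth \<beta> (C0 * A) (low_part K f)"
    using fock_growth_low_part_any[of "- \<alpha>" \<beta> K, where 'n = 'n] by blast
  obtain C1 where C1: "C1 \<ge> 0" "\<And>(f :: complex ^ 'n \<Rightarrow> complex) A. entire f \<Longrightarrow> fock_growth (- \<alpha>) A f \<Longrightarrow> fock_growth (- \<alpha>) (C1 * A) (high_part K f)"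
    using fock_growth_high_part_global[of "- \<alpha>" K, where 'n = 'n] by blast
  obtain C2 where C2: "C2 \<ge> 0" "\<And>(H :: complex ^ 'n \<Rightarrow> complex) h A. homogeneous_expansion H h \<Longrightarrow> fock_growth (- \<alpha>) A H \<Longrightarrow>
    (\<exists>H'. homogeneous_expansion H' (\<lambda>k z. of_real (Beta (real (n + k)) t) * h k z) \<and> fock_growth (- \<alpha> - 2 * t) (C2 * A) H')"
    using fock_growth_fractional_integral[OF t n, of "- \<alpha>", where 'n = 'n] by blast
  \<comment> \<open>The factors \<open>k + c j\<close> are the falling product that leads from
    \<open>Gamma (n + k + t)\<close>, the denominator of the Beta function, down to
    \<open>Gamma (n + k - \<sigma> / 2)\<close>, the numerator of \<open>fock_ratio\<close>.\<close>
  define c where "c j = real n + t - real (Suc j)" for j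
  obtain C3 where C3: "C3 \<ge> 0" "\<And>(H :: complex ^ 'n \<Rightarrow> complex) h A. homogeneous_expansion H h \<Longrightarrow> fock_growth (- \<alpha> - 2 * t) A H \<Longrightarrow>
    (\<exists>H'. homogeneous_expansion H' (\<lambda>k z. (\<Prod>j<N. of_nat k + of_real (c j)) * h k z) \<and> fock_growth (- \<alpha> - 2 * t + 2 * real N) (C3 * A) H')"
    using fock_growth_iterated_radial_derivative[where a = "- \<alpha> - 2 * t" and N = N and c = c and 'n = 'n] by blast
  \<comment> \<open>The gain of the fractional integral and the loss of the derivatives differ by
    exactly \<open>\<sigma>\<close>.\<close>
  have ab: "- \<alpha> - 2 * t + 2 * real N = \<beta>" by (simp add: t_def \<sigma>_def field_simps)
  define C where "C = C0 + (1 / Gamma t) * (C3 * (C2 * C1))"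
  have C: "C \<ge> 0" using C0 C1 C2 C3 Gt by (simp add: C_def)
  have mult: "fock_ratio n \<sigma> k * ((1 / Gamma t) * ((\<Prod>j<N. real k + c j) * Beta (real (n + k)) t)) = 1" if "K \<le> k" for k
  proof -
    have s: "\<sigma> / 2 < real (n + k)" using that unfolding K_def by (rule fock_cut_le)
    define x where "x = real (n + k) + t"
    have xN: "x - real N = real (n + k) - \<sigma> / 2" by (simp add: x_def t_def)
    have "Gamma x = (\<Prod>j<N. x - real (Suc j)) * Gamma (x - real N)"
      using s xN by (intro Gamma_falling_product) simp
    then have "Gamma x = (\<Prod>j<N. real k + c j) * Gamma (real (n + k) - \<sigma> / 2)"
      unfolding xN by (simp add: x_def c_def algebra_simps)
    moreover define P where "P = (\<Prod>j<N. real k + c j)"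
    ultimately have 1: "Gamma x = P * Gamma (real (n + k) - \<sigma> / 2)" by simp
    have pos: "Gamma x > 0" "Gamma (real (n + k) - \<sigma> / 2) > 0" "Gamma (real (n + k)) > 0"
      using s n t by (auto intro!: Gamma_real_pos simp: x_def)
    have "Beta (real (n + k)) t = Gamma (real (n + k)) * Gamma t / Gamma x" by (simp add: Beta_def x_def)
    then have "(1 / Gamma t) * (P * Beta (real (n + k)) t) = P * Gamma (real (n + k)) / Gamma x"
      using Gt by simp
    moreover have "P \<noteq> 0" using pos(1) 1 by auto
    ultimately have "fock_ratio n \<sigma> k * ((1 / Gamma t) * (P * Beta (real (n + k)) t)) = 1"
      using pos(2,3) unfolding fock_ratio_def 1 by simp
    then show ?thesis unfolding P_def .
  qed
  have "\<exists>g. entire g \<and> fock_growth \<beta> (C * A) g \<and>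
      (\<forall>k z. of_real (pairing_ratio n \<sigma> k) * homogeneous_part g k z = homogeneous_part G k z)"
    if G: "entire G" "fock_growth (- \<alpha>) A G" for G :: "complex ^ 'n \<Rightarrow> complex" and A
  proof -
    let ?h = "\<lambda>k z. if k < K then 0 else homogeneous_part G k z"
    obtain H1 where H1: "homogeneous_expansion H1 (\<lambda>k z. of_real (Beta (real (n + k)) t) * ?h k z)" "fock_growth (- \<alpha> - 2 * t) (C2 * (C1 * A)) H1"
      using C2(2)[OF homogeneous_expansion_high_part[OF G(1)] C1(2)[OF G]] by blast
    obtain H2 where H2: "homogeneous_expansion H2 (\<lambda>k z. (\<Prod>j<N. of_nat k + of_real (c j)) * (of_real (Beta (real (n + k)) t) * ?h k z))"
      "fock_growth \<beta> (C3 * (C2 * (C1 * A))) H2"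
      using C3(2)[OF H1] unfolding ab by blast
    \<comment> \<open>Below the cut the multiplier is 1, so those degrees of \<open>G\<close> are
      kept as they are.\<close>
    define g where "g z = low_part K G z + of_real (1 / Gamma t) * H2 z" for z
    have ex: "homogeneous_expansion g (\<lambda>k z. (if k < K then homogeneous_part G k z else 0)
        + of_real (1 / Gamma t) * ((\<Prod>j<N. of_nat k + of_real (c j)) * (of_real (Beta (real (n + k)) t) * ?h k z)))"
      unfolding g_def[abs_def]
      by (intro homogeneous_expansion_add homogeneous_expansion_cmult homogeneous_expansion_low_part G H2)
    have "fock_growth \<beta> ((1 / Gamma t) * (C3 * (C2 * (C1 * A)))) (\<lambda>z. of_real (1 / Gamma t) * H2 z)"
      using H2(2) Gt unfolding fock_growth_def by (auto simp: norm_mult norm_divide divide_right_mono)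
    then have "fock_growth \<beta> (C0 * A + (1 / Gamma t) * (C3 * (C2 * (C1 * A)))) g"
      unfolding g_def[abs_def] by (intro fock_growth_add C0(2) G)
    then have gr: "fock_growth \<beta> (C * A) g" by (simp add: C_def algebra_simps)
    have "of_real (pairing_ratio n \<sigma> k) * homogeneous_part g k z = homogeneous_part G k z" for k z
    proof (cases "k < K")
      case True
      then show ?thesis by (simp add: homogeneous_part_eq[OF ex] pairing_ratio_def K_def)
    next
      case False
      have "of_real (pairing_ratio n \<sigma> k) * homogeneous_part g k z
        = of_real (fock_ratio n \<sigma> k * ((1 / Gamma t) * ((\<Prod>j<N. real k + c j) * Beta (real (n + k)) t))) * homogeneous_part G k z"
        using False by (simp add: homogeneous_part_eq[OF ex] pairing_ratio_def K_def mult.assoc)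
      also have "\<dots> = homogeneous_part G k z" using False by (simp only: mult not_less) simp
      finally show ?thesis .
    qed
    then show ?thesis using gr entire_if_expansion_growth[OF ex gr] by blast
  qed
  then show ?thesis using C unfolding n_def by blast
qed

section \<open>Approximation by polynomials in the Fock spaces\<close>

text \<open>After division by \<open>x + y\<close> this is \<open>s \<le> s powr p\<close> on the
  unit interval, applied to two numbers with sum 1. It replaces the triangle inequality for the
  \<open>p\<close>-th power of the norm.\<close>

lemma powr_add_subadditive:
  fixes x y p :: real
  assumes "0 \<le> x" "0 \<le> y" "0 < p" "p \<le> 1"
  shows "(x + y) powr p \<le> x powr p + y powr p"
proof (cases "x + y = 0")
  case False
  then have s: "x + y > 0" using assms by simp
  have le: "t \<le> t powr p" if "0 \<le> t" "t \<le> 1" for t :: real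
    using powr_mono'[of p 1 t] that assms by (cases "t = 0") auto
  have "x / (x + y) \<le> (x / (x + y)) powr p" "y / (x + y) \<le> (y / (x + y)) powr p"
    using s assms by (intro le; simp)+
  moreover have "x / (x + y) + y / (x + y) = 1" using s by (simp flip: add_divide_distrib)
  ultimately have "1 \<le> x powr p / (x + y) powr p + y powr p / (x + y) powr p"
    using s assms by (simp add: powr_divide)
  then show ?thesis using s by (simp add: le_divide_eq flip: add_divide_distrib)
qed (use assms in auto)

lemma fock_integrand_add:
  assumes "0 < p" "p \<le> 1"
  shows "fock_integrand p \<gamma> (\<lambda>z. f z + h z) z \<le> fock_integrand p \<gamma> f z + fock_integrand p \<gamma> h z"
proof -
  define e where "e = complex_of_real (exp (- (norm z)\<^sup>2 / 2))"
  have "norm ((f z + h z) * e) powr p \<le> (norm (f z * e) + norm (h z * e)) powr p"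
    using assms by (intro powr_mono2) (auto simp: distrib_right norm_triangle_ineq)
  also have "\<dots> \<le> norm (f z * e) powr p + norm (h z * e) powr p"
    using assms by (intro powr_add_subadditive) auto
  finally show ?thesis
    unfolding fock_integrand_def e_def[symmetric] distrib_right[symmetric] by (rule mult_right_mono) simp
qed

lemma fock_integrand_cmult:
  "fock_integrand p \<gamma> (\<lambda>z. c * f z) z = norm c powr p * fock_integrand p \<gamma> f z"
  by (simp add: fock_integrand_def norm_mult powr_mult mult_ac)

lemma fock_space_entire: "f \<in> fock_space p \<gamma> \<Longrightarrow> entire f"
  by (simp add: fock_space_def)

lemma fock_space_add:
  assumes "0 < p" "p \<le> 1" "f \<in> fock_space p \<gamma>" "h \<in> fock_space p \<gamma>"
  shows "(\<lambda>z. f z + h z) \<in> fock_space p \<gamma>"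
proof -
  have e: "entire (\<lambda>z. f z + h z)" using assms by (intro entire_add fock_space_entire)
  have "integrable fock_volume (fock_integrand p \<gamma> (\<lambda>z. f z + h z))"
  proof (rule Bochner_Integration.integrable_bound)
    show "integrable fock_volume (\<lambda>z. fock_integrand p \<gamma> f z + fock_integrand p \<gamma> h z)"
      using assms by (intro Bochner_Integration.integrable_add) (auto simp: fock_space_def)
    show "fock_integrand p \<gamma> (\<lambda>z. f z + h z) \<in> borel_measurable fock_volume"
      unfolding measurable_fock_volume by (rule fock_integrand_measurable[OF entire_measurable[OF e]])
  qed (use fock_integrand_add[OF assms(1,2)] in \<open>auto intro!: AE_I2\<close>)
  then show ?thesis using e by (simp add: fock_space_def)
qed

lemma fock_space_cmult:
  assumes "f \<in> fock_space p \<gamma>" shows "(\<lambda>z. c * f z) \<in> fock_space p \<gamma>"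
proof -
  have "integrable fock_volume (\<lambda>z. norm c powr p * fock_integrand p \<gamma> f z)"
    using assms by (intro integrable_mult_right) (simp add: fock_space_def)
  moreover have "fock_integrand p \<gamma> (\<lambda>z. c * f z) = (\<lambda>z. norm c powr p * fock_integrand p \<gamma> f z)"
    by (simp add: fun_eq_iff fock_integrand_cmult)
  ultimately show ?thesis using assms by (simp add: fock_space_def entire_cmult)
qed

lemma fock_norm_cmult:
  assumes "p > 0" shows "fock_norm p \<gamma> (\<lambda>z. c * f z) = norm c * fock_norm p \<gamma> f"
  using assms by (simp add: fock_norm_def fock_integrand_cmult powr_mult powr_powr)

lemma fock_space_diff:
  assumes "0 < p" "p \<le> 1" "f \<in> fock_space p \<gamma>" "h \<in> fock_space p \<gamma>"
  shows "(\<lambda>z. f z - h z) \<in> fock_space p \<gamma>"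
  using fock_space_add[OF assms(1-3) fock_space_cmult[OF assms(4), of "-1"]] by simp

lemma fock_space_sum:
  fixes f :: "'i \<Rightarrow> complex ^ 'n \<Rightarrow> complex"
  assumes "0 < p" "p \<le> 1" "finite I" "\<And>i. i \<in> I \<Longrightarrow> f i \<in> fock_space p \<gamma>"
  shows "(\<lambda>z. \<Sum>i\<in>I. f i z) \<in> fock_space p \<gamma>"
  using assms(3,4)
proof (induction I rule: finite_induct)
  case empty
  have "fock_integrand p \<gamma> (\<lambda>_ :: complex ^ 'n. 0) = (\<lambda>_. 0)" by (simp add: fock_integrand_def fun_eq_iff)
  then show ?case by (simp add: fock_space_def)
qed (use fock_space_add[OF assms(1,2)] in auto)

text \<open>Since \<open>b < 1\<close>, part of the Gaussian weight survives and dominates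
  everything else. The constant \<open>M\<close> depends neither on \<open>f\<close> nor on
  \<open>C\<close>, so a small \<open>C\<close> means a small norm.\<close>

lemma fock_space_if_subgaussian:
  assumes p: "0 < p" and b: "b < 1"
  shows "\<exists>M\<ge>0. \<forall>f :: complex ^ 'n \<Rightarrow> complex. \<forall>C. entire f \<longrightarrow> 0 \<le> C \<longrightarrow> (\<forall>z. norm (f z) \<le> C * exp (b * (norm z)\<^sup>2 / 2)) \<longrightarrow>
    f \<in> fock_space p \<gamma> \<and> fock_norm p \<gamma> f \<le> C * M"
proof -
  define V where "V z = (1 + norm z) powr (- \<gamma>) * exp (0 * norm z) * exp (- (p * (1 - b) / 2) * (norm z)\<^sup>2)" for z :: "complex ^ 'n"
  have V: "integrable fock_volume V"
    unfolding V_def using assms by (intro gauss_growth_integrable) simp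
  define J where "J = (LINT z|fock_volume. V z)"
  have J: "J \<ge> 0" unfolding J_def V_def by (rule integral_nonneg_AE) simp
  have "f \<in> fock_space p \<gamma> \<and> fock_norm p \<gamma> f \<le> C * J powr (1 / p)"
    if f: "entire f" "0 \<le> C" "\<And>z. norm (f z) \<le> C * exp (b * (norm z)\<^sup>2 / 2)" for f :: "complex ^ 'n \<Rightarrow> complex" and C
  proof -
    have le: "fock_integrand p \<gamma> f z \<le> C powr p * V z" for z
    proof -
      have "norm (f z * of_real (exp (- (norm z)\<^sup>2 / 2))) \<le> C * exp (b * (norm z)\<^sup>2 / 2) * exp (- (norm z)\<^sup>2 / 2)"
        using f(3)[of z] by (simp add: norm_mult mult_right_mono)
      also have "\<dots> = C * exp (- ((1 - b) / 2) * (norm z)\<^sup>2)"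
        by (simp add: mult.assoc flip: exp_add) (simp add: field_simps)
      finally have "norm (f z * of_real (exp (- (norm z)\<^sup>2 / 2))) powr p \<le> (C * exp (- ((1 - b) / 2) * (norm z)\<^sup>2)) powr p"
        using p by (intro powr_mono2) auto
      also have "\<dots> = C powr p * exp (- (p * (1 - b) / 2) * (norm z)\<^sup>2)"
        using f(2) by (simp add: powr_mult exp_powr_real mult_ac)
      finally have "fock_integrand p \<gamma> f z \<le> C powr p * exp (- (p * (1 - b) / 2) * (norm z)\<^sup>2) * (1 + norm z) powr (- \<gamma>)"
        unfolding fock_integrand_def by (intro mult_right_mono) auto
      then show ?thesis by (simp add: V_def mult_ac)
    qed
    have i: "integrable fock_volume (fock_integrand p \<gamma> f)"
    proof (rule Bochner_Integration.integrable_bound)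
      show "integrable fock_volume (\<lambda>z. C powr p * V z)" by (intro integrable_mult_right V)
      show "fock_integrand p \<gamma> f \<in> borel_measurable fock_volume"
        unfolding measurable_fock_volume by (rule fock_integrand_measurable[OF entire_measurable[OF f(1)]])
    qed (use le in \<open>auto intro!: order_trans[OF le abs_ge_self]\<close>)
    have "(LINT z|fock_volume. fock_integrand p \<gamma> f z) \<le> (LINT z|fock_volume. C powr p * V z)"
      by (intro integral_mono i integrable_mult_right V le)
    also have "\<dots> = C powr p * J" by (simp add: J_def)
    finally have "fock_norm p \<gamma> f \<le> (C powr p * J) powr (1 / p)"
      unfolding fock_norm_def using p by (intro powr_mono2) (auto intro: integral_nonneg_AE)
    also have "\<dots> = C * J powr (1 / p)" using p f(2) J by (simp add: powr_mult powr_powr)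
    finally show ?thesis using i f(1) by (simp add: fock_space_def)
  qed
  then show ?thesis by (intro exI[of _ "J powr (1 / p)"]) auto
qed

lemma homogeneous_poly_fock_space:
  assumes "0 < p" "homogeneous_poly k q" shows "q \<in> fock_space p \<gamma>"
proof -
  obtain B where B: "B \<ge> 0" "\<And>z. norm (q z) \<le> B * norm z ^ k"
    using homogeneous_poly_growth[OF assms(2)] by blast
  define E where "E = exp ((\<bar>real k\<bar> + \<bar>0\<bar>)\<^sup>2 / (4 * (1/4 :: real)))"
  have "norm (q z) \<le> (B * E) * exp (1/2 * (norm z)\<^sup>2 / 2)" for z
  proof -
    have "norm z ^ k \<le> (1 + norm z) powr real k"
      by (subst powr_realpow) (auto intro: power_mono add_pos_nonneg)
    also have "\<dots> \<le> E * exp (1/4 * (norm z)\<^sup>2)"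
      unfolding E_def using powr_exp_le_gauss[of "norm z" "1/4" "real k" 0] by simp
    finally have "B * norm z ^ k \<le> B * (E * exp (1/4 * (norm z)\<^sup>2))" using B(1) by (rule mult_left_mono)
    then show ?thesis using B(2)[of z] by (simp add: mult.assoc)
  qed
  moreover have "0 \<le> B * E" using B(1) by (simp add: E_def)
  ultimately show ?thesis
    using fock_space_if_subgaussian[OF assms(1), of "1/2" \<gamma>] homogeneous_poly_entire[OF assms(2)] by fastforce
qed

text \<open>Cauchy's estimate on the sphere of radius \<open>norm z / \<theta>\<close> gives a
  factor \<open>\<theta> ^ k\<close> at the price of raising the Gaussian rate from \<open>b\<close>
  to \<open>b'\<close>. The remainders are then subgaussian with geometrically small
  constants.\<close>

lemma fock_taylor_convergence:
  fixes f :: "complex ^ 'n \<Rightarrow> complex"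
  assumes p: "0 < p" and b: "0 < b" "b < 1" and q: "homogeneous_expansion f q" and f: "entire f"
    and C: "0 \<le> C" "\<And>z. norm (f z) \<le> C * exp (b * (norm z)\<^sup>2 / 2)"
  shows "(\<lambda>M. fock_norm p \<gamma> (\<lambda>z. f z - (\<Sum>k<M. q k z))) \<longlonglongrightarrow> 0"
proof -
  \<comment> \<open>This is \<open>b / \<theta>\<^sup>2\<close>; it stays below 1 because
    \<open>\<theta>\<^sup>2\<close> is the midpoint of \<open>b\<close> and 1.\<close>
  define b' where "b' = 2 * b / (1 + b)"
  define \<theta> where "\<theta> = sqrt ((1 + b) / 2)"
  have \<theta>: "0 < \<theta>" "\<theta> < 1" "\<theta>\<^sup>2 = (1 + b) / 2" using b by (auto simp: \<theta>_def)
  have b': "b' < 1" using b by (simp add: b'_def)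
  obtain M where M: "M \<ge> 0" "\<And>(f :: complex ^ 'n \<Rightarrow> complex) C. entire f \<Longrightarrow> 0 \<le> C \<Longrightarrow> (\<And>z. norm (f z) \<le> C * exp (b' * (norm z)\<^sup>2 / 2)) \<Longrightarrow>
    fock_norm p \<gamma> f \<le> C * M"
    using fock_space_if_subgaussian[OF p b', of \<gamma>, where 'n = 'n] by blast
  have qk: "norm (q k z) \<le> C * exp (b' * (norm z)\<^sup>2 / 2) * \<theta> ^ k" for k z
  proof -
    have "norm (q k z) \<le> (C * exp (b' * (norm z)\<^sup>2 / 2)) / (1 / \<theta>) ^ k"
    proof (rule homogeneous_expansion_norm_le_scaled[OF q])
      fix w :: "complex ^ 'n" assume w: "norm w = 1 / \<theta> * norm z"
      have "b * (norm w)\<^sup>2 = b' * (norm z)\<^sup>2"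
        unfolding w power_mult_distrib power_divide \<theta>(3) using b by (simp add: b'_def)
      then show "norm (f w) \<le> C * exp (b' * (norm z)\<^sup>2 / 2)" using C(2)[of w] by simp
    qed (use \<theta> in simp)
    then show ?thesis by (simp add: power_divide)
  qed
  have le: "fock_norm p \<gamma> (\<lambda>z. f z - (\<Sum>k<N. q k z)) \<le> (C * \<theta> ^ N / (1 - \<theta>)) * M" for N
  proof (rule M(2))
    show "entire (\<lambda>z. f z - (\<Sum>k<N. q k z))"
      using q homogeneous_poly_entire unfolding homogeneous_expansion_def
      by (intro entire_diff entire_sum f) blast
    show "0 \<le> C * \<theta> ^ N / (1 - \<theta>)" using C(1) \<theta> by simp
    fix z :: "complex ^ 'n"
    define e where "e = C * exp (b' * (norm z)\<^sup>2 / 2)"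
    have gs: "(\<lambda>k. e * \<theta> ^ N * \<theta> ^ k) sums (e * \<theta> ^ N * (1 / (1 - \<theta>)))"
      using \<theta> by (intro sums_mult geometric_sums) simp
    have b: "norm (q (k + N) z) \<le> e * \<theta> ^ N * \<theta> ^ k" for k
      using qk[of "k + N" z] by (simp add: e_def power_add mult_ac)
    have sm: "summable (\<lambda>k. norm (q (k + N) z))"
      by (rule summable_comparison_test'[OF sums_summable[OF gs]]) (use b in auto)
    have "(\<lambda>k. q (k + N) z) sums (f z - (\<Sum>k<N. q k z))"
      using q unfolding homogeneous_expansion_def by (intro sums_split_initial_segment) blast
    then have "norm (f z - (\<Sum>k<N. q k z)) = norm (\<Sum>k. q (k + N) z)" by (simp add: sums_iff)
    also have "\<dots> \<le> (\<Sum>k. norm (q (k + N) z))" by (rule summable_norm[OF sm])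
    also have "\<dots> \<le> (\<Sum>k. e * \<theta> ^ N * \<theta> ^ k)" by (rule suminf_le[OF b sm sums_summable[OF gs]])
    also have "\<dots> = e * \<theta> ^ N * (1 / (1 - \<theta>))" using gs by (rule sums_unique[symmetric])
    finally show "norm (f z - (\<Sum>k<N. q k z)) \<le> C * \<theta> ^ N / (1 - \<theta>) * exp (b' * (norm z)\<^sup>2 / 2)"
      by (simp add: e_def mult_ac)
  qed
  have "(\<lambda>N. (C * \<theta> ^ N / (1 - \<theta>)) * M) \<longlonglongrightarrow> (C * 0 / (1 - \<theta>)) * M"
    using \<theta> by (intro tendsto_intros LIMSEQ_realpow_zero) auto
  then have lim: "(\<lambda>N. (C * \<theta> ^ N / (1 - \<theta>)) * M) \<longlonglongrightarrow> 0" by simp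
  show ?thesis
    by (rule tendsto_sandwich[OF _ _ tendsto_const lim]) (use le in auto)
qed

text \<open>For \<open>p < 1\<close> there is no triangle inequality, so the dilates are shown to converge by splitting
  \<open>d \<le> u\<^sub>j + u\<close> into \<open>min d (2 u)\<close>, which is dominated, and the excess of \<open>u\<^sub>j\<close> over \<open>u\<close>.\<close>

lemma fock_dilation_convergence:
  fixes f :: "complex ^ 'n \<Rightarrow> complex" and p \<gamma> :: real
  assumes p: "0 < p" "p \<le> 1" and f: "f \<in> fock_space p \<gamma>"
    and r: "\<And>j. 1/2 \<le> r j" "\<And>j. r j \<le> 1" "r \<longlonglongrightarrow> 1"
  shows "(\<lambda>j. fock_norm p \<gamma> (\<lambda>z. f (of_real (r j) *s z) - f z)) \<longlonglongrightarrow> 0"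
proof -
  have fe: "entire f" and fi: "integrable fock_volume (fock_integrand p \<gamma> f)"
    using f by (auto simp: fock_space_def)
  have r0: "0 < r j" for j using r(1)[of j] by simp
  have fr: "entire (\<lambda>z. f (of_real (r j) *s z))" for j using entire_affine[OF fe, of _ 0] by simp
  define u where "u = fock_integrand p \<gamma> f"
  define U where "U j = fock_integrand p \<gamma> (\<lambda>z. f (of_real (r j) *s z))" for j
  define d where "d j = fock_integrand p \<gamma> (\<lambda>z. f (of_real (r j) *s z) - f z)" for j
  have nn: "0 \<le> u z" "0 \<le> U j z" "0 \<le> d j z" for j z by (simp_all add: u_def U_def d_def)
  have um [measurable]: "u \<in> borel_measurable borel" unfolding u_def by (rule fock_integrand_measurable[OF entire_measurable[OF fe]])
  have Um [measurable]: "U j \<in> borel_measurable borel" for j unfolding U_def by (rule fock_integrand_measurable[OF entire_measurable[OF fr]])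
  have dm [measurable]: "d j \<in> borel_measurable borel" for j
    unfolding d_def by (intro fock_integrand_measurable entire_measurable entire_diff fr fe)
  have rz: "(\<lambda>j. of_real (r j) *s z) \<longlonglongrightarrow> z" for z :: "complex ^ 'n"
  proof -
    have "(\<lambda>j. r j *\<^sub>R z) \<longlonglongrightarrow> 1 *\<^sub>R z" by (intro tendsto_intros r)
    then show ?thesis by (simp add: scaleR_eq_vector_smult)
  qed
  have frz: "(\<lambda>j. f (of_real (r j) *s z)) \<longlonglongrightarrow> f z" for z
    using entire_continuous_on[OF fe, of UNIV] rz[of z] by (auto simp: continuous_on_def elim!: isCont_tendsto_compose[rotated] simp flip: isCont_def)
  have Ulim: "(\<lambda>j. U j z) \<longlonglongrightarrow> u z" for z
    unfolding U_def u_def fock_integrand_def using p by (intro tendsto_intros frz) auto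
  have dlim: "(\<lambda>j. d j z) \<longlonglongrightarrow> 0" for z
  proof -
    have "(\<lambda>j. norm ((f (of_real (r j) *s z) - f z) * of_real (exp (- (norm z)\<^sup>2 / 2))) powr p * (1 + norm z) powr (- \<gamma>))
      \<longlonglongrightarrow> norm ((f z - f z) * of_real (exp (- (norm z)\<^sup>2 / 2))) powr p * (1 + norm z) powr (- \<gamma>)"
      using p by (intro tendsto_intros tendsto_powr' frz) auto
    then show ?thesis by (simp add: d_def fock_integrand_def)
  qed
  \<comment> \<open>The integrand \<open>U j\<close> in the variable
    \<open>w = r j *\<^sub>R z\<close>. The change of variables moves the dilation from
    \<open>f\<close> to the weight, so that \<open>v j\<close> is dominated by a multiple of
    \<open>u\<close>; this yields the convergence of the integrals of \<open>U j\<close>.\<close>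
  define v where "v j w = norm (f w * of_real (exp (- (norm w / r j)\<^sup>2 / 2))) powr p * (1 + norm w / r j) powr (- \<gamma>)" for j w
  have vU: "v j (r j *\<^sub>R z) = U j z" for j z
    using r0[of j] by (simp add: v_def U_def fock_integrand_def scaleR_eq_vector_smult)
  have vle: "v j w \<le> 2 powr \<bar>\<gamma>\<bar> * u w" for j w
  proof -
    have "norm w \<le> norm w / r j"
      using r0[of j] r(2)[of j] by (simp add: le_divide_eq mult_left_le)
    then have 1: "norm (f w * of_real (exp (- (norm w / r j)\<^sup>2 / 2))) \<le> norm (f w * of_real (exp (- (norm w)\<^sup>2 / 2)))"
      by (auto simp: norm_mult intro!: mult_left_mono power_mono)
    have "norm w / r j \<le> 2 * norm w"
    proof -
      have "norm w * 1 \<le> norm w * (2 * r j)" using r(1)[of j] by (intro mult_left_mono) auto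
      then show ?thesis using r0[of j] by (simp add: divide_le_eq mult_ac)
    qed
    moreover have "(1 + y) powr (- \<gamma>) \<le> (1 + norm w) powr (- \<gamma>) * 2 powr \<bar>- \<gamma>\<bar>" if "norm w \<le> y" "y \<le> 2 * norm w" for y
      using that by (intro powr_quotient_le) (auto intro: add_pos_nonneg order_trans[OF norm_ge_zero])
    ultimately have "(1 + norm w / r j) powr (- \<gamma>) \<le> (1 + norm w) powr (- \<gamma>) * 2 powr \<bar>- \<gamma>\<bar>"
      using \<open>norm w \<le> norm w / r j\<close> by blast
    then have "v j w \<le> norm (f w * of_real (exp (- (norm w)\<^sup>2 / 2))) powr p * ((1 + norm w) powr (- \<gamma>) * 2 powr \<bar>- \<gamma>\<bar>)"
      unfolding v_def using 1 p by (intro mult_mono powr_mono2) auto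
    then show ?thesis by (simp add: u_def fock_integrand_def mult_ac)
  qed
  have v0: "0 \<le> v j w" for j w by (simp add: v_def)
  have vm: "v j \<in> borel_measurable borel" for j
  proof -
    have "v j = (\<lambda>w. U j ((1 / r j) *\<^sub>R w))" using vU[of j "(1 / r j) *\<^sub>R _"] r0[of j] by (auto simp: fun_eq_iff)
    then show ?thesis by simp
  qed
  have vi: "integrable fock_volume (v j)" for j
  proof (rule Bochner_Integration.integrable_bound)
    show "integrable fock_volume (\<lambda>w. 2 powr \<bar>\<gamma>\<bar> * u w)" unfolding u_def by (intro integrable_mult_right fi)
  qed (use vle v0 vm in \<open>auto intro!: order_trans[OF vle abs_ge_self]\<close>)
  have Ui: "integrable fock_volume (U j)" and Uint: "(LINT z|fock_volume. v j z) = r j ^ (2 * CARD('n)) * (LINT z|fock_volume. U j z)" for j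
    using has_bochner_integral_scale[OF r0[of j] vi[of j]] by (simp_all add: vU)
  have ui: "integrable fock_volume u" by (simp add: u_def fi)
  have vlim: "(\<lambda>j. LINT z|fock_volume. v j z) \<longlonglongrightarrow> (LINT z|fock_volume. u z)"
  proof (rule integral_dominated_convergence[where w = "\<lambda>w. 2 powr \<bar>\<gamma>\<bar> * u w"])
    show "AE w in fock_volume. (\<lambda>j. v j w) \<longlonglongrightarrow> u w"
    proof (rule AE_I2)
      fix w :: "complex ^ 'n"
      have "(\<lambda>j. v j w) \<longlonglongrightarrow> norm (f w * of_real (exp (- (norm w / 1)\<^sup>2 / 2))) powr p * (1 + norm w / 1) powr (- \<gamma>)"
        unfolding v_def using p by (intro tendsto_intros tendsto_powr' r) (auto simp: add_nonneg_eq_0_iff)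
      then show "(\<lambda>j. v j w) \<longlonglongrightarrow> u w" by (simp add: u_def fock_integrand_def)
    qed
    show "integrable fock_volume (\<lambda>w. 2 powr \<bar>\<gamma>\<bar> * u w)" by (intro integrable_mult_right ui)
  qed (use um vm vle v0 in auto)
  have Ulim': "(\<lambda>j. LINT z|fock_volume. U j z) \<longlonglongrightarrow> (LINT z|fock_volume. u z)"
  proof -
    have "(\<lambda>j. (LINT z|fock_volume. v j z) / r j ^ (2 * CARD('n))) \<longlonglongrightarrow> (LINT z|fock_volume. u z) / 1 ^ (2 * CARD('n))"
      by (intro tendsto_intros vlim r) simp
    moreover have "(LINT z|fock_volume. v j z) / r j ^ (2 * CARD('n)) = (LINT z|fock_volume. U j z)" for j
      using Uint[of j] r0[of j] by simp
    ultimately show ?thesis by simp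
  qed
  define m1 where "m1 j z = min (d j z) (2 * u z)" for j z
  define m2 where "m2 j z = max (u z - U j z) 0" for j z
  have m1i: "integrable fock_volume (m1 j)" and m2i: "integrable fock_volume (m2 j)" for j
  proof -
    show "integrable fock_volume (m1 j)"
      by (rule Bochner_Integration.integrable_bound[of _ "\<lambda>z. 2 * u z"]) (use ui nn in \<open>auto simp: m1_def[abs_def]\<close>)
    show "integrable fock_volume (m2 j)"
      unfolding m2_def by (intro integrable_max Bochner_Integration.integrable_diff ui Ui) simp
  qed
  have m1lim: "(\<lambda>j. LINT z|fock_volume. m1 j z) \<longlonglongrightarrow> (LINT z|(fock_volume :: (complex ^ 'n) measure). 0)"
  proof (rule integral_dominated_convergence[where w = "\<lambda>z. 2 * u z"])
    show "AE z in fock_volume. (\<lambda>j. m1 j z) \<longlonglongrightarrow> 0"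
    proof (rule AE_I2)
      fix z
      have "(\<lambda>j. m1 j z) \<longlonglongrightarrow> min 0 (2 * u z)" unfolding m1_def by (intro tendsto_intros dlim)
      then show "(\<lambda>j. m1 j z) \<longlonglongrightarrow> 0" using nn(1)[of z] by (simp add: min_def)
    qed
    show "integrable fock_volume (\<lambda>z. 2 * u z)" by (intro integrable_mult_right ui)
  qed (use m1i nn in \<open>auto simp: m1_def\<close>)
  have m2lim: "(\<lambda>j. LINT z|fock_volume. m2 j z) \<longlonglongrightarrow> (LINT z|(fock_volume :: (complex ^ 'n) measure). 0)"
  proof (rule integral_dominated_convergence[where w = u])
    show "AE z in fock_volume. (\<lambda>j. m2 j z) \<longlonglongrightarrow> 0"
    proof (rule AE_I2)
      fix z
      have "(\<lambda>j. m2 j z) \<longlonglongrightarrow> max (u z - u z) 0" unfolding m2_def by (intro tendsto_intros Ulim)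
      then show "(\<lambda>j. m2 j z) \<longlonglongrightarrow> 0" by simp
    qed
  qed (use m2i ui nn in \<open>auto simp: m2_def\<close>)
  have dUu: "d j z \<le> U j z + u z" for j z
  proof -
    have "d j z = fock_integrand p \<gamma> (\<lambda>z. f (of_real (r j) *s z) + (-1) * f z) z" by (simp add: d_def)
    also have "\<dots> \<le> U j z + fock_integrand p \<gamma> (\<lambda>z. (-1) * f z) z"
      unfolding U_def by (rule fock_integrand_add[OF p])
    also have "fock_integrand p \<gamma> (\<lambda>z. (-1) * f z) z = u z" unfolding fock_integrand_cmult u_def by simp
    finally show ?thesis .
  qed
  \<comment> \<open>The bracket equals \<open>\<bar>U j z - u z\<bar>\<close>. Hence
    \<open>D\<close> dominates \<open>d\<close>: either \<open>m1\<close> is \<open>d\<close>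
    itself, or \<open>d - 2 * u \<le> U - u\<close>. In this form, as in Scheffe's lemma, each term
    has a limit: \<open>m1\<close> and \<open>m2\<close> are dominated by multiples of
    \<open>u\<close>, and the integral of \<open>U j - u\<close> tends to 0.\<close>
  define D where "D j z = m1 j z + ((U j z - u z) + 2 * m2 j z)" for j z
  have dD: "d j z \<le> D j z" for j z
    using dUu[of j z] unfolding D_def m1_def m2_def by (auto simp: min_def max_def)
  have Di: "integrable fock_volume (D j)" for j
    unfolding D_def by (intro Bochner_Integration.integrable_add Bochner_Integration.integrable_diff integrable_mult_right m1i m2i Ui ui)
  have di: "integrable fock_volume (d j)" for j
    by (rule Bochner_Integration.integrable_bound[OF Di]) (use dD dm nn in \<open>auto intro!: order_trans[OF dD abs_ge_self]\<close>)
  have Dint: "(LINT z|fock_volume. D j z) = (LINT z|fock_volume. m1 j z) + (((LINT z|fock_volume. U j z) - (LINT z|fock_volume. u z)) + 2 * (LINT z|fock_volume. m2 j z))" for j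
    unfolding D_def using m1i m2i Ui ui by simp
  have "(\<lambda>j. LINT z|fock_volume. D j z) \<longlonglongrightarrow> 0 + (((LINT z|fock_volume. u z) - (LINT z|fock_volume. u z)) + 2 * 0)"
    unfolding Dint using m1lim m2lim by (intro tendsto_intros Ulim') simp_all
  then have Dlim: "(\<lambda>j. LINT z|fock_volume. D j z) \<longlonglongrightarrow> 0" by simp
  have "(\<lambda>j. LINT z|fock_volume. d j z) \<longlonglongrightarrow> 0"
  proof (rule tendsto_sandwich[OF _ _ tendsto_const Dlim])
    show "\<forall>\<^sub>F j in sequentially. 0 \<le> (LINT z|fock_volume. d j z)"
      using nn by (intro always_eventually allI integral_nonneg_AE) auto
    show "\<forall>\<^sub>F j in sequentially. (LINT z|fock_volume. d j z) \<le> (LINT z|fock_volume. D j z)"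
      by (intro always_eventually allI integral_mono di Di dD)
  qed
  then have "(\<lambda>j. (LINT z|fock_volume. d j z) powr (1 / p)) \<longlonglongrightarrow> 0 powr (1 / p)"
    using p nn by (intro tendsto_powr' tendsto_const) (auto intro!: always_eventually integral_nonneg_AE)
  then show ?thesis by (simp add: fock_norm_def d_def)
qed

text \<open>Dilation lowers the Gaussian rate from 1 to \<open>r\<^sup>2\<close>. With
  \<open>b\<close> halfway between these two, the remaining room, measured by \<open>c\<close>,
  absorbs the polynomial weight.\<close>

lemma fock_dilation_subgaussian:
  fixes f :: "complex ^ 'n \<Rightarrow> complex"
  assumes "fock_growth a A f" "0 < r" "r < 1"
  shows "\<exists>b C. 0 < b \<and> b < 1 \<and> 0 \<le> C \<and> (\<forall>z. norm (f (of_real r *s z)) \<le> C * exp (b * (norm z)\<^sup>2 / 2))"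
proof -
  define b where "b = (1 + r\<^sup>2) / 2"
  have r2: "0 < r\<^sup>2" "r\<^sup>2 < 1" using assms by (auto simp: power_less_one_iff)
  have b: "0 < b" "b < 1" using r2 add_pos_pos[OF zero_less_one r2(1)] by (simp_all add: b_def)
  have A: "A \<ge> 0" using assms(1) by (simp add: fock_growth_def)
  define c where "c = (1 - r\<^sup>2) / 4"
  have c: "c > 0" using r2 by (simp add: c_def)
  define E where "E = exp ((\<bar>\<bar>a\<bar>\<bar> + \<bar>0\<bar>)\<^sup>2 / (4 * c))"
  have "norm (f (of_real r *s z)) \<le> (A * E) * exp (b * (norm z)\<^sup>2 / 2)" for z
  proof -
    have "(1 + r * norm z) powr a \<le> (1 + r * norm z) powr \<bar>a\<bar>" using assms by (intro powr_mono) auto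
    also have "\<dots> \<le> (1 + norm z) powr \<bar>a\<bar>"
      using assms by (intro powr_mono2) (auto simp: mult_left_le_one_le)
    also have "\<dots> \<le> E * exp (c * (norm z)\<^sup>2)"
      unfolding E_def using powr_exp_le_gauss[of "norm z" c "\<bar>a\<bar>" 0] c by simp
    finally have "exp ((r * norm z)\<^sup>2 / 2) * (1 + r * norm z) powr a \<le> exp ((r * norm z)\<^sup>2 / 2) * (E * exp (c * (norm z)\<^sup>2))"
      by (intro mult_left_mono) auto
    also have "\<dots> = E * exp ((r * norm z)\<^sup>2 / 2 + c * (norm z)\<^sup>2)" by (simp add: exp_add)
    also have "(r * norm z)\<^sup>2 / 2 + c * (norm z)\<^sup>2 = b * (norm z)\<^sup>2 / 2"
      by (simp add: b_def c_def power_mult_distrib field_simps)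
    finally have "exp ((r * norm z)\<^sup>2 / 2) * (1 + r * norm z) powr a \<le> E * exp (b * (norm z)\<^sup>2 / 2)" .
    then have "A * (exp ((r * norm z)\<^sup>2 / 2) * (1 + r * norm z) powr a) \<le> A * (E * exp (b * (norm z)\<^sup>2 / 2))"
      using A by (rule mult_left_mono)
    moreover have "norm (f (of_real r *s z)) \<le> A * (exp ((r * norm z)\<^sup>2 / 2) * (1 + r * norm z) powr a)"
    proof -
      have n: "norm (of_real r *s z) = r * norm z" using assms by simp
      show ?thesis using assms(1) unfolding fock_growth_def n[symmetric] by blast
    qed
    ultimately show ?thesis by (simp only: mult.assoc)
  qed
  then show ?thesis using b A by (intro exI[of _ b] exI[of _ "A * E"]) (auto simp: E_def)
qed

section \<open>Bounded functionals\<close>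

lemma fock_functional_add:
  "fock_bounded_functional p \<gamma> \<nu> \<Longrightarrow> f \<in> fock_space p \<gamma> \<Longrightarrow> h \<in> fock_space p \<gamma> \<Longrightarrow>
    \<nu> (\<lambda>z. f z + h z) = \<nu> f + \<nu> h"
  by (simp add: fock_bounded_functional_def)

lemma fock_functional_cmult:
  "fock_bounded_functional p \<gamma> \<nu> \<Longrightarrow> f \<in> fock_space p \<gamma> \<Longrightarrow> \<nu> (\<lambda>z. c * f z) = c * \<nu> f"
  by (simp add: fock_bounded_functional_def)

lemma fock_functional_zero:
  assumes "fock_bounded_functional p \<gamma> \<nu>" "0 < p" "p \<le> 1" shows "\<nu> (\<lambda>_. 0) = 0"
proof -
  have "(\<lambda>_. 0) \<in> fock_space p \<gamma>" using fock_space_sum[OF assms(2,3), of "{}"] by simp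
  then have "\<nu> (\<lambda>z. 0 * 0) = 0 * \<nu> (\<lambda>_. 0)"
    by (rule fock_functional_cmult[OF assms(1)])
  then show ?thesis by simp
qed

lemma fock_functional_sum:
  assumes \<nu>: "fock_bounded_functional p \<gamma> \<nu>" and p: "0 < p" "p \<le> 1"
    and "finite I" "\<And>i. i \<in> I \<Longrightarrow> f i \<in> fock_space p \<gamma>"
  shows "\<nu> (\<lambda>z. \<Sum>i\<in>I. c i * f i z) = (\<Sum>i\<in>I. c i * \<nu> (f i))"
  using assms(4,5)
proof (induction I rule: finite_induct)
  case empty
  show ?case using fock_functional_zero[OF \<nu> p] by simp
next
  case (insert i I)
  have "(\<lambda>z. c i * f i z) \<in> fock_space p \<gamma>" "(\<lambda>z. \<Sum>i\<in>I. c i * f i z) \<in> fock_space p \<gamma>"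
    using insert by (auto intro!: fock_space_cmult fock_space_sum p)
  then have "\<nu> (\<lambda>z. c i * f i z + (\<Sum>i\<in>I. c i * f i z)) = \<nu> (\<lambda>z. c i * f i z) + \<nu> (\<lambda>z. \<Sum>i\<in>I. c i * f i z)"
    by (rule fock_functional_add[OF \<nu>])
  moreover have "\<nu> (\<lambda>z. c i * f i z) = c i * \<nu> (f i)"
    using insert by (intro fock_functional_cmult[OF \<nu>]) simp
  ultimately show ?case using insert by simp
qed

lemma fock_functional_diff:
  assumes \<nu>: "fock_bounded_functional p \<gamma> \<nu>" and p: "0 < p" "p \<le> 1"
    and f: "f \<in> fock_space p \<gamma>" and h: "h \<in> fock_space p \<gamma>"
  shows "\<nu> (\<lambda>z. f z - h z) = \<nu> f - \<nu> h"
proof -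
  have "\<nu> (\<lambda>z. f z + (-1) * h z) = \<nu> f + \<nu> (\<lambda>z. (-1) * h z)"
    by (rule fock_functional_add[OF \<nu> f fock_space_cmult[OF h, of "-1"]])
  also have "\<nu> (\<lambda>z. (-1) * h z) = (-1) * \<nu> h"
    by (rule fock_functional_cmult[OF \<nu> h])
  finally show ?thesis by simp
qed

lemma fock_functional_tendsto:
  assumes \<nu>: "fock_bounded_functional p \<gamma> \<nu>" and p: "0 < p" "p \<le> 1"
    and f: "f \<in> fock_space p \<gamma>" and h: "\<And>j. h j \<in> fock_space p \<gamma>"
    and lim: "(\<lambda>j::nat. fock_norm p \<gamma> (\<lambda>z. h j z - f z)) \<longlonglongrightarrow> 0"
  shows "(\<lambda>j. \<nu> (h j)) \<longlonglongrightarrow> \<nu> f"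
proof -
  obtain B where B: "\<And>f. f \<in> fock_space p \<gamma> \<Longrightarrow> norm (\<nu> f) \<le> B * fock_norm p \<gamma> f"
    using \<nu> unfolding fock_bounded_functional_def by blast
  have "(\<lambda>j. \<nu> (h j) - \<nu> f) \<longlonglongrightarrow> 0"
  proof (rule Lim_null_comparison)
    show "\<forall>\<^sub>F j in sequentially. norm (\<nu> (h j) - \<nu> f) \<le> B * fock_norm p \<gamma> (\<lambda>z. h j z - f z)"
      using B[OF fock_space_diff[OF p h f]] by (simp add: fock_functional_diff[OF \<nu> p h f])
    show "(\<lambda>j. B * fock_norm p \<gamma> (\<lambda>z. h j z - f z)) \<longlonglongrightarrow> 0"
      using tendsto_mult_left[OF lim, of B] by simp
  qed
  then show ?thesis by (simp add: LIM_zero_iff)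
qed

lemma fock_norm_minus: "fock_norm p \<gamma> (\<lambda>z. f z - g z) = fock_norm p \<gamma> (\<lambda>z. g z - f z)"
proof -
  have "fock_integrand p \<gamma> (\<lambda>z. f z - g z) z = fock_integrand p \<gamma> (\<lambda>z. g z - f z) z" for z
    by (simp add: fock_integrand_def norm_mult norm_minus_commute)
  then show ?thesis by (simp add: fock_norm_def)
qed

lemma fock_functional_expansion_sums:
  fixes f :: "complex ^ 'n \<Rightarrow> complex"
  assumes \<nu>: "fock_bounded_functional p \<gamma> \<nu>" and p: "0 < p" "p \<le> 1"
    and b: "0 < b" "b < 1" and q: "homogeneous_expansion f q" and f: "entire f"
    and C: "0 \<le> C" "\<And>z. norm (f z) \<le> C * exp (b * (norm z)\<^sup>2 / 2)"
  shows "f \<in> fock_space p \<gamma>" "(\<lambda>k. \<nu> (q k)) sums \<nu> f"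
proof -
  show fS: "f \<in> fock_space p \<gamma>"
    using fock_space_if_subgaussian[OF p(1) b(2), of \<gamma>] f C by blast
  have qk: "q k \<in> fock_space p \<gamma>" for k
    using q unfolding homogeneous_expansion_def by (intro homogeneous_poly_fock_space p) blast
  have "(\<lambda>M. \<nu> (\<lambda>z. \<Sum>k<M. q k z)) \<longlonglongrightarrow> \<nu> f"
    by (rule fock_functional_tendsto[OF \<nu> p fS fock_space_sum[OF p _ qk]])
       (use fock_taylor_convergence[OF p(1) b q f C, of \<gamma>] in \<open>simp_all add: fock_norm_minus[of _ _ f]\<close>)
  moreover have "\<nu> (\<lambda>z. \<Sum>k<M. q k z) = (\<Sum>k<M. \<nu> (q k))" for M
    using fock_functional_sum[OF \<nu> p, of "{..<M}" q "\<lambda>_. 1"] qk by simp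
  ultimately show "(\<lambda>k. \<nu> (q k)) sums \<nu> f" by (simp add: sums_def)
qed

text \<open>Density of the polynomials in two stages: Taylor series are controlled above only for
  subgaussian functions, so \<open>f\<close> is first approximated by its dilates, and each dilate
  by its Taylor polynomials.\<close>

lemma fock_functional_eqI:
  fixes \<mu> \<nu> :: "(complex ^ 'n \<Rightarrow> complex) \<Rightarrow> complex"
  assumes p: "0 < p" "p \<le> 1" and \<mu>: "fock_bounded_functional p (\<alpha> * p) \<mu>" and \<nu>: "fock_bounded_functional p (\<alpha> * p) \<nu>"
    and eq: "\<And>k q. homogeneous_poly k q \<Longrightarrow> \<mu> q = \<nu> q" and f: "f \<in> fock_space p (\<alpha> * p)"
  shows "\<mu> f = \<nu> f"
proof -
  have fe: "entire f" by (rule fock_space_entire[OF f])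
  obtain A where A: "fock_growth \<alpha> A f"
    using fock_density_integrable[OF p, of \<alpha>] f by blast
  \<comment> \<open>The shift by 2 keeps the factors in the interval from \<open>1/2\<close> to 1,
    as \<open>fock_dilation_convergence\<close> demands.\<close>
  define r where "r j = 1 - 1 / (real j + 2)" for j
  have r: "1/2 \<le> r j" "0 < r j" "r j < 1" "r j \<le> 1" for j by (simp_all add: r_def field_simps)
  have rlim: "r \<longlonglongrightarrow> 1" unfolding r_def by real_asymp
  define fr where "fr j z = f (of_real (r j) *s z)" for j z
  have fre: "entire (fr j)" for j unfolding fr_def[abs_def] using entire_affine[OF fe, of _ 0] by simp
  have *: "fr j \<in> fock_space p (\<alpha> * p) \<and> \<mu> (fr j) = \<nu> (fr j)" for j
  proof -
    obtain b C where b: "0 < b" "b < 1" and C: "0 \<le> C" "\<And>z. norm (fr j z) \<le> C * exp (b * (norm z)\<^sup>2 / 2)"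
      using fock_dilation_subgaussian[OF A r(2,3)[of j]] unfolding fr_def by blast
    note q = homogeneous_expansion_homogeneous_part[OF fre[of j]]
    have "(\<lambda>k. \<mu> (homogeneous_part (fr j) k)) sums \<mu> (fr j)"
      by (rule fock_functional_expansion_sums(2)[OF \<mu> p b q fre C])
    moreover have "(\<lambda>k. \<nu> (homogeneous_part (fr j) k)) sums \<nu> (fr j)"
      by (rule fock_functional_expansion_sums(2)[OF \<nu> p b q fre C])
    moreover have "\<mu> (homogeneous_part (fr j) k) = \<nu> (homogeneous_part (fr j) k)" for k
      by (rule eq[OF homogeneous_part_homogeneous_poly[OF fre]])
    ultimately show ?thesis
      using fock_functional_expansion_sums(1)[OF \<mu> p b q fre C] sums_unique2 by auto
  qed
  have lim: "(\<lambda>j. fock_norm p (\<alpha> * p) (\<lambda>z. fr j z - f z)) \<longlonglongrightarrow> 0"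
    unfolding fr_def by (rule fock_dilation_convergence[OF p f r(1,4) rlim])
  have "(\<lambda>j. \<mu> (fr j)) \<longlonglongrightarrow> \<mu> f"
    by (rule fock_functional_tendsto[OF \<mu> p f _ lim]) (use * in simp)
  moreover have "(\<lambda>j. \<nu> (fr j)) \<longlonglongrightarrow> \<nu> f"
    by (rule fock_functional_tendsto[OF \<nu> p f _ lim]) (use * in simp)
  moreover have "(\<lambda>j. \<mu> (fr j)) = (\<lambda>j. \<nu> (fr j))" using * by simp
  ultimately show ?thesis using LIMSEQ_unique by metis
qed

section \<open>The exponential kernel and the transform of a functional\<close>

lemma exp_herm_subgaussian:
  "norm (exp (herm z w)) \<le> exp ((norm w)\<^sup>2) * exp (1/2 * (norm z)\<^sup>2 / 2)"
proof -
  have "norm (exp (herm z w)) \<le> exp (norm w * norm z)"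
    using norm_herm_le[of z w] abs_Re_le_cmod[of "herm z w"] by (simp add: mult.commute)
  also have "\<dots> \<le> exp ((norm w)\<^sup>2) * exp (1/4 * (norm z)\<^sup>2)"
    using powr_exp_le_gauss[of "norm z" "1/4" 0 "norm w"] by (simp add: add_nonneg_eq_0_iff)
  finally show ?thesis by simp
qed

lemma fock_space_exp_herm:
  assumes "0 < p" shows "(\<lambda>z. exp (herm z w)) \<in> fock_space p \<gamma>"
proof -
  have "(1/2 :: real) < 1" by simp
  from fock_space_if_subgaussian[OF assms this] show ?thesis
    using entire_exp[OF entire_herm] exp_herm_subgaussian[of _ w] exp_ge_zero[of "(norm w)\<^sup>2"] by blast
qed

text \<open>Completing the square shows that the kernel with its Fock weight is
  \<open>exp (norm w ^ 2 / 2)\<close> times a Gaussian bump centred at \<open>w\<close>. The factor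
  \<open>(1 + norm z) powr (- (\<alpha> * p))\<close> is therefore essentially evaluated at
  \<open>w\<close>, with Peetre's inequality controlling the deviation; this is the origin of the
  exponent \<open>- \<alpha>\<close>.\<close>

lemma fock_norm_exp_herm:
  assumes p: "0 < p"
  shows "\<exists>C\<ge>0. \<forall>w :: complex ^ 'n. fock_norm p (\<alpha> * p) (\<lambda>z. exp (herm z w)) \<le> C * (exp ((norm w)\<^sup>2 / 2) * (1 + norm w) powr (- \<alpha>))"
proof -
  define V where "V u = (1 + norm u) powr \<bar>- (\<alpha> * p)\<bar> * exp (0 * norm u) * exp (- (p / 2) * (norm u)\<^sup>2)" for u :: "complex ^ 'n"
  have V: "integrable fock_volume V"
    unfolding V_def using p by (intro gauss_growth_integrable) simp
  define J where "J = (LINT u|fock_volume. V u)"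
  have J: "J \<ge> 0" unfolding J_def V_def by (rule integral_nonneg_AE) simp
  have "fock_norm p (\<alpha> * p) (\<lambda>z. exp (herm z w)) \<le> J powr (1 / p) * (exp ((norm w)\<^sup>2 / 2) * (1 + norm w) powr (- \<alpha>))" for w :: "complex ^ 'n"
  proof -
    define E where "E = (\<lambda>z. exp (herm z w))"
    have Ee: "entire E" unfolding E_def by (intro entire_exp entire_herm)
    define c where "c = exp (p * (norm w)\<^sup>2 / 2) * (1 + norm w) powr (- (\<alpha> * p))"
    have c: "c \<ge> 0" by (simp add: c_def)
    have ES: "E \<in> fock_space p (\<alpha> * p)"
      unfolding E_def by (rule fock_space_exp_herm[OF p])
    then have Ei: "integrable fock_volume (fock_integrand p (\<alpha> * p) E)" by (simp add: fock_space_def)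
    have le: "fock_integrand p (\<alpha> * p) E (u + w) \<le> c * V u" for u
    proof -
      have "norm (E (u + w) * of_real (exp (- (norm (u + w))\<^sup>2 / 2))) = exp ((norm w)\<^sup>2 / 2) * exp (- ((norm u)\<^sup>2 / 2))"
        unfolding norm_diff_sq E_def herm_simps herm_self
        by (simp add: norm_mult flip: exp_add) (simp add: field_simps)
      then have "fock_integrand p (\<alpha> * p) E (u + w)
        = exp (p * (norm w)\<^sup>2 / 2) * exp (- (p / 2) * (norm u)\<^sup>2) * (1 + norm (u + w)) powr (- (\<alpha> * p))"
        by (simp add: fock_integrand_def powr_mult exp_powr_real mult_ac)
      also have "\<dots> \<le> exp (p * (norm w)\<^sup>2 / 2) * exp (- (p / 2) * (norm u)\<^sup>2) * ((1 + norm w) powr (- (\<alpha> * p)) * (1 + norm u) powr \<bar>- (\<alpha> * p)\<bar>)"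
        by (intro mult_left_mono peetre) simp
      finally show ?thesis by (simp add: c_def V_def mult_ac)
    qed
    have "(LINT z|fock_volume. fock_integrand p (\<alpha> * p) E z) = (LINT u|fock_volume. fock_integrand p (\<alpha> * p) E (u + w))"
      by (rule integral_translate[symmetric]) (rule fock_integrand_measurable[OF entire_measurable[OF Ee]])
    also have "\<dots> \<le> (LINT u|fock_volume. c * V u)"
      by (intro integral_mono le integrable_translate[OF Ei] integrable_mult_right V)
    also have "\<dots> = c * J" by (simp add: J_def)
    finally have "fock_norm p (\<alpha> * p) E \<le> (c * J) powr (1 / p)"
      unfolding fock_norm_def using p by (intro powr_mono2) (auto intro: integral_nonneg_AE)
    also have "\<dots> = J powr (1 / p) * (exp ((norm w)\<^sup>2 / 2) * (1 + norm w) powr (- \<alpha>))"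
      using p J c by (simp add: c_def powr_mult powr_powr exp_powr_real mult_ac)
    finally show ?thesis by (simp add: E_def)
  qed
  then show ?thesis by (intro exI[of _ "J powr (1 / p)"]) auto
qed

text \<open>Monomials indexed by words instead of multi-indices, so that powers of
  \<open>herm z w\<close> expand without multinomial coefficients.\<close>

fun mono_list :: "'n list \<Rightarrow> complex ^ 'n \<Rightarrow> complex" where
  "mono_list [] z = 1"
| "mono_list (i # L) z = z $ i * mono_list L z"

lemma homogeneous_poly_mono_list: "homogeneous_poly (length L) (mono_list L)"
proof (induction L)
  case Nil
  show ?case using homogeneous_poly_const[of 1] by simp
next
  case (Cons i L)
  then show ?case using homogeneous_poly_mult[OF homogeneous_poly_coord[of i] Cons] by simp
qed

lemma finite_lists_length: "finite {L :: 'n::finite list. length L = k}"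
  using finite_lists_length_eq[of "UNIV :: 'n set" k] by simp

lemma herm_power_mono_list:
  fixes z w :: "complex ^ 'n"
  shows "herm z w ^ k = (\<Sum>L\<in>{L. length L = k}. mono_list L z * cnj (mono_list L w))"
proof (induction k)
  case 0
  have "{L :: 'n list. length L = 0} = {[]}" by auto
  then show ?case by simp
next
  case (Suc k)
  let ?S = "{L :: 'n list. length L = k}"
  have "{L :: 'n list. length L = Suc k} = (\<lambda>(i, L). i # L) ` (UNIV \<times> ?S)"
    by (auto simp: length_Suc_conv image_iff)
  moreover have "inj_on (\<lambda>(i, L). i # L) (UNIV \<times> ?S)" by (auto simp: inj_on_def)
  ultimately have "(\<Sum>L\<in>{L :: 'n list. length L = Suc k}. mono_list L z * cnj (mono_list L w))
    = (\<Sum>(i, L)\<in>UNIV \<times> ?S. (z $ i * cnj (w $ i)) * (mono_list L z * cnj (mono_list L w)))"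
    by (simp add: sum.reindex case_prod_unfold mult_ac)
  also have "\<dots> = (\<Sum>i\<in>UNIV. z $ i * cnj (w $ i)) * (\<Sum>L\<in>?S. mono_list L z * cnj (mono_list L w))"
    by (simp add: sum_product sum.cartesian_product)
  finally show ?case using Suc by (simp add: herm_def)
qed

text \<open>The function \<open>G w = cnj (\<nu> (exp (herm \<cdot> w)))\<close> represents \<open>\<nu>\<close> with respect to the unweighted pairing.\<close>

lemma fock_functional_transform:
  fixes \<alpha> p :: real
  assumes p: "0 < p" "p \<le> 1"
  shows "\<exists>C\<ge>0. \<forall>(\<nu> :: (complex ^ 'n \<Rightarrow> complex) \<Rightarrow> complex) B. fock_bounded_functional p (\<alpha> * p) \<nu> \<longrightarrow> 0 \<le> B \<longrightarrow>
     (\<forall>f\<in>fock_space p (\<alpha> * p). norm (\<nu> f) \<le> B * fock_norm p (\<alpha> * p) f) \<longrightarrow>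
     (\<exists>G. entire G \<and> fock_growth (- \<alpha>) (C * B) G \<and> (\<forall>k q. homogeneous_poly k q \<longrightarrow> \<nu> q = fock_form 0 q (homogeneous_part G k)))"
proof -
  obtain C where C: "C \<ge> 0" "\<And>w :: complex ^ 'n. fock_norm p (\<alpha> * p) (\<lambda>z. exp (herm z w)) \<le> C * (exp ((norm w)\<^sup>2 / 2) * (1 + norm w) powr (- \<alpha>))"
    using fock_norm_exp_herm[OF p(1), of \<alpha>, where 'n = 'n] by blast
  have "\<exists>G. entire G \<and> fock_growth (- \<alpha>) (C * B) G \<and> (\<forall>k q. homogeneous_poly k q \<longrightarrow> \<nu> q = fock_form 0 q (homogeneous_part G k))"
    if \<nu>: "fock_bounded_functional p (\<alpha> * p) \<nu>" and B: "0 \<le> B" "\<And>f. f \<in> fock_space p (\<alpha> * p) \<Longrightarrow> norm (\<nu> f) \<le> B * fock_norm p (\<alpha> * p) f"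
    for \<nu> :: "(complex ^ 'n \<Rightarrow> complex) \<Rightarrow> complex" and B
  proof -
    define G where "G w = cnj (\<nu> (\<lambda>z. exp (herm z w)))" for w
    define g where "g k w = cnj (\<nu> (\<lambda>z. herm z w ^ k / fact k))" for k w
    have exp_sums: "(\<lambda>z. exp (herm z w)) \<in> fock_space p (\<alpha> * p)" "(\<lambda>k. \<nu> (\<lambda>z. herm z w ^ k / fact k)) sums \<nu> (\<lambda>z. exp (herm z w))" for w
      using fock_functional_expansion_sums[OF \<nu> p _ _ homogeneous_expansion_exp_herm entire_exp[OF entire_herm] _ exp_herm_subgaussian]
      by auto
    have mono: "mono_list L \<in> fock_space p (\<alpha> * p)" for L
      by (rule homogeneous_poly_fock_space[OF p(1) homogeneous_poly_mono_list])
    \<comment> \<open>The kernel of degree \<open>k\<close> is a finite sum of products of a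
      monomial in \<open>z\<close> and a conjugate monomial in \<open>w\<close>, so linearity alone
      exhibits \<open>g k\<close> as a homogeneous polynomial in \<open>w\<close>.\<close>
    have \<nu>_herm: "\<nu> (\<lambda>z. herm z w ^ k / fact k) = (\<Sum>L\<in>{L. length L = k}. (cnj (mono_list L w) / fact k) * \<nu> (mono_list L))" for k w
    proof -
      have "(\<lambda>z. herm z w ^ k / fact k) = (\<lambda>z. \<Sum>L\<in>{L. length L = k}. (cnj (mono_list L w) / fact k) * mono_list L z)"
        by (simp add: herm_power_mono_list sum_divide_distrib mult.commute)
      then show ?thesis
        by (simp only:) (intro fock_functional_sum[OF \<nu> p finite_lists_length] mono)
    qed
    have ex: "homogeneous_expansion G g"
      unfolding homogeneous_expansion_def
    proof (intro conjI allI)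
      fix k
      have "g k = (\<lambda>w. \<Sum>L\<in>{L. length L = k}. (cnj (\<nu> (mono_list L)) / fact k) * mono_list L w)"
        by (simp add: g_def fun_eq_iff \<nu>_herm mult_ac)
      moreover have "homogeneous_poly k (\<lambda>w. \<Sum>L\<in>{L. length L = k}. (cnj (\<nu> (mono_list L)) / fact k) * mono_list L w)"
        using homogeneous_poly_mono_list by (intro homogeneous_poly_sum homogeneous_poly_cmult) auto
      ultimately show "homogeneous_poly k (g k)" by simp
      show "(\<lambda>k. g k w) sums G w" for w
        unfolding G_def g_def sums_cnj by (rule exp_sums)
    qed
    have gr: "fock_growth (- \<alpha>) (C * B) G"
      unfolding fock_growth_def
    proof (intro conjI allI)
      show "0 \<le> C * B" using C B by simp
      fix w
      have "norm (G w) \<le> B * fock_norm p (\<alpha> * p) (\<lambda>z. exp (herm z w))"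
        unfolding G_def using B(2)[OF exp_sums(1)] by simp
      also have "\<dots> \<le> B * (C * (exp ((norm w)\<^sup>2 / 2) * (1 + norm w) powr (- \<alpha>)))"
        by (intro mult_left_mono C B)
      finally show "norm (G w) \<le> C * B * (exp ((norm w)\<^sup>2 / 2) * (1 + norm w) powr (- \<alpha>))" by (simp add: mult_ac)
    qed
    \<comment> \<open>The reproducing formula writes \<open>q\<close> as a combination of the words
      of length \<open>k\<close> with integrals as coefficients. \<open>\<nu>\<close> is applied to
      this finite sum and the sum is folded back, so that exchanging \<open>\<nu>\<close> with the
      integral is pure linear algebra.\<close>
    have "\<nu> q = fock_form 0 q (g k)" if q: "homogeneous_poly k q" for k q
    proof -
      define I where "I L = (LINT w|fock_volume. q w * cnj (mono_list L w) * fock_weight 0 w)" for L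
      have qS: "q \<in> fock_space p (\<alpha> * p)" by (rule homogeneous_poly_fock_space[OF p(1) q])
      have int: "integrable fock_volume (\<lambda>w. q w * cnj (mono_list L w) * fock_weight 0 w)" if "length L = k" for L
        using fock_form_homogeneous(1)[OF q, of "mono_list L" 0] homogeneous_poly_mono_list[of L] that
        by (simp add: fock_form_integrand_eq[abs_def] add_pos_nonneg)
      have "q z = (\<Sum>L\<in>{L. length L = k}. (I L / fact k) * mono_list L z)" for z
      proof -
        have "q z = (LINT w|fock_volume. q w * cnj (herm w z ^ k / fact k) * fock_weight 0 w)"
          by (rule reproducing_formula_homogeneous[OF q, symmetric])
        also have "\<dots> = (LINT w|fock_volume. (\<Sum>L\<in>{L. length L = k}. (mono_list L z / fact k) * (q w * cnj (mono_list L w) * fock_weight 0 w)))"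
          by (simp add: herm_power_mono_list sum_divide_distrib sum_distrib_left sum_distrib_right mult_ac)
        also have "\<dots> = (\<Sum>L\<in>{L. length L = k}. (mono_list L z / fact k) * I L)"
          unfolding I_def by (subst Bochner_Integration.integral_sum) (auto intro!: integrable_mult_right int)
        finally show ?thesis by (simp add: mult_ac)
      qed
      then have "\<nu> q = \<nu> (\<lambda>z. \<Sum>L\<in>{L. length L = k}. (I L / fact k) * mono_list L z)" by presburger
      also have "\<dots> = (\<Sum>L\<in>{L. length L = k}. (I L / fact k) * \<nu> (mono_list L))"
        by (intro fock_functional_sum[OF \<nu> p finite_lists_length] mono)
      also have "\<dots> = (\<Sum>L\<in>{L. length L = k}. LINT w|fock_volume. (\<nu> (mono_list L) / fact k) * (q w * cnj (mono_list L w) * fock_weight 0 w))"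
        unfolding I_def integral_mult_right_zero by (simp add: mult_ac)
      also have "\<dots> = (LINT w|fock_volume. (\<Sum>L\<in>{L. length L = k}. (\<nu> (mono_list L) / fact k) * (q w * cnj (mono_list L w) * fock_weight 0 w)))"
        by (rule Bochner_Integration.integral_sum[symmetric]) (auto intro!: integrable_mult_right int)
      also have "\<dots> = fock_form 0 q (g k)"
        unfolding fock_form_def fock_form_integrand_eq g_def \<nu>_herm
        by (simp add: sum_distrib_left sum_distrib_right mult_ac)
      finally show ?thesis .
    qed
    then show ?thesis using ex gr entire_if_expansion_growth[OF ex gr] homogeneous_part_eq[OF ex] by blast
  qed
  then show ?thesis using C(1) by blast
qed

section \<open>The pairing on homogeneous polynomials\<close>

lemma homogeneous_part_homogeneous:
  assumes "homogeneous_poly k q"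
  shows "homogeneous_part q = (\<lambda>j z. if j = k then q z else 0)"
proof (rule homogeneous_part_eq)
  show "homogeneous_expansion q (\<lambda>j z. if j = k then q z else 0)"
    unfolding homogeneous_expansion_def
  proof (intro conjI allI)
    show "homogeneous_poly j (\<lambda>z. if j = k then q z else 0)" for j using assms by (cases "j = k") auto
    show "(\<lambda>j. if j = k then q z else 0) sums q z" for z using sums_single[of k "\<lambda>_. q z"] by simp
  qed
qed

text \<open>Only degree \<open>k\<close> contributes, by orthogonality; both functions grow
  polynomially, so a Gaussian majorant is available.\<close>

lemma fock_form_low_part:
  fixes q g :: "complex ^ 'n \<Rightarrow> complex"
  assumes q: "homogeneous_poly k q" and g: "entire g" "fock_growth b B g" and k: "k < K"
  shows "fock_form 0 q (low_part K g) = fock_form 0 q (homogeneous_part g k)"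
proof -
  obtain c where c: "c \<ge> 0" "\<And>z. norm (q z) \<le> c * norm z ^ k"
    using homogeneous_poly_growth[OF q] by blast
  define d where "d = real K * (B * growth_const b)"
  have d: "d \<ge> 0" using g(2) growth_const_pos[of b] by (simp add: d_def fock_growth_def)
  define D where "D z = c * d * ((1 + norm z) powr (real k + real K) * exp (0 * norm z) * exp (- 1 * (norm z)\<^sup>2))" for z :: "complex ^ 'n"
  have "(LINT z|fock_volume. q z * cnj (low_part K g z) * fock_weight 0 z)
    = (LINT z|fock_volume. q z * cnj (if k < K then homogeneous_part g k z else 0) * fock_weight 0 z)"
  proof (rule integral_homogeneous_component[OF _ _ homogeneous_expansion_low_part[OF g(1)] entire_low_part[OF g(1)]])
    show "integrable fock_volume D"
      unfolding D_def by (intro integrable_mult_right gauss_growth_integrable) simp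
    show "D (c *s u) = D u" if "norm c = 1" for c u using that by (simp add: D_def)
    show "norm (q z * cnj (low_part K g z) * fock_weight 0 z) \<le> D z" for z
    proof -
      have "norm z ^ k \<le> (1 + norm z) powr real k"
        by (subst powr_realpow) (auto intro: power_mono add_pos_nonneg)
      then have "norm (q z) \<le> c * (1 + norm z) powr real k"
        using order_trans[OF c(2)[of z] mult_left_mono[OF _ c(1)]] by blast
      moreover have "norm (low_part K g z) \<le> d * (1 + norm z) powr real K"
        unfolding d_def by (rule fock_growth_low_part[OF g])
      moreover have "fock_weight 0 z \<le> exp (- (norm z)\<^sup>2)" by (simp add: fock_weight_def)
      ultimately have "norm (q z) * norm (low_part K g z) * fock_weight 0 z
        \<le> (c * (1 + norm z) powr real k) * (d * (1 + norm z) powr real K) * exp (- (norm z)\<^sup>2)"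
        using c(1) d by (intro mult_mono) auto
      also have "\<dots> = D z" unfolding D_def powr_add by (simp add: mult_ac)
      finally show ?thesis by (simp add: norm_mult)
    qed
    show "q (c *s z) = c ^ k * q z" for c z by (rule homogeneous_poly_scale[OF q])
    show "q \<in> borel_measurable borel" by (intro entire_measurable homogeneous_poly_entire[OF q])
  qed (simp_all add: fock_weight_rotate)
  then show ?thesis using k by (simp add: fock_form_def fock_form_integrand_eq)
qed

text \<open>Again orthogonality of degrees. The rotation invariant majorant is the sum of a part for
  the unit ball, where order \<open>K\<close> vanishing tames the weight, and a part for its
  complement, where the Gaussian outweighs the growth of \<open>g\<close>.\<close>

lemma fock_form_high_part:
  fixes q g :: "complex ^ 'n \<Rightarrow> complex" and \<sigma> :: real
  defines "K \<equiv> fock_cut CARD('n) \<sigma>"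
  assumes q: "homogeneous_poly k q" and g: "entire g" "fock_growth b B g" and k: "K \<le> k"
  shows "fock_form \<sigma> q (high_part K g) = fock_form \<sigma> q (homogeneous_part g k)"
proof -
  obtain c where c: "c \<ge> 0" "\<And>z. norm (q z) \<le> c * norm z ^ k"
    using homogeneous_poly_growth[OF q] by blast
  obtain C2 where C2: "C2 \<ge> 0" "fock_growth b (C2 * B) (high_part K g)"
    using fock_growth_high_part_global[of b K, where 'n = 'n] g by blast
  define d where "d = 2 * (B * growth_const b)"
  have B: "B \<ge> 0" using g(2) by (simp add: fock_growth_def)
  have d: "d \<ge> 0" using B growth_const_pos[of b] by (simp add: d_def)
  define V where "V z = (1 + norm z) powr (real k + b - \<sigma>) * exp (0 * norm z) * exp (- (1/2) * (norm z)\<^sup>2)" for z :: "complex ^ 'n"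
  define m where "m = c * (C2 * B) * 2 powr \<bar>\<sigma>\<bar>"
  have m: "m \<ge> 0" using c C2 B by (simp add: m_def)
  define D where "D z = c * d * fock_weight (\<sigma> - 2 * real K) z + m * V z" for z :: "complex ^ 'n"
  have V0: "V z \<ge> 0" for z by (simp add: V_def)
  have "(LINT z|fock_volume. q z * cnj (high_part K g z) * fock_weight \<sigma> z)
    = (LINT z|fock_volume. q z * cnj (if k < K then 0 else homogeneous_part g k z) * fock_weight \<sigma> z)"
  proof (rule integral_homogeneous_component[OF _ _ homogeneous_expansion_high_part[OF g(1)] entire_high_part[OF g(1)]])
    show "integrable fock_volume D"
    proof -
      have "\<sigma> / 2 < real (CARD('n) + K)" by (rule fock_cut_le) (simp add: K_def)
      then have "integrable fock_volume (fock_weight (\<sigma> - 2 * real K) :: complex ^ 'n \<Rightarrow> real)"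
        by (intro fock_weight_integrable) simp
      moreover have "integrable fock_volume V" unfolding V_def by (rule gauss_growth_integrable) simp
      ultimately show ?thesis
        unfolding D_def by (intro Bochner_Integration.integrable_add integrable_mult_right)
    qed
    show "D (c *s u) = D u" if "norm c = 1" for c u using that by (simp add: D_def V_def fock_weight_rotate)
    show "norm (q z * cnj (high_part K g z) * fock_weight \<sigma> z) \<le> D z" for z
    proof (cases "norm z \<le> 1")
      case True
      have "norm z ^ k \<le> norm z ^ K" using k True by (intro power_decreasing) auto
      then have "norm (q z) \<le> c * norm z ^ K"
        using order_trans[OF c(2)[of z] mult_left_mono[OF _ c(1)]] by blast
      moreover have "norm (high_part K g z) \<le> d * norm z ^ K"
        unfolding d_def by (rule fock_growth_high_part[OF g True])
      ultimately have "norm (q z) * norm (high_part K g z) * fock_weight \<sigma> z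
        \<le> (c * norm z ^ K) * (d * norm z ^ K) * fock_weight \<sigma> z"
        using c(1) d by (intro mult_mono mult_right_mono) auto
      also have "\<dots> = c * d * (norm z ^ K * norm z ^ K * fock_weight \<sigma> z)" by (simp add: mult_ac)
      also have "norm z ^ K * norm z ^ K * fock_weight \<sigma> z = fock_weight (\<sigma> - 2 * real K) z"
      proof (cases "z = 0")
        case False
        then have "norm z ^ K * norm z ^ K = norm z powr (2 * real K)" by (simp add: powr_realpow[symmetric] flip: powr_add)
        then show ?thesis using False by (simp add: fock_weight_def mult_ac flip: powr_add)
      qed (simp add: fock_weight_def)
      also have "c * d * fock_weight (\<sigma> - 2 * real K) z \<le> D z" using m V0 by (simp add: D_def)
      finally show ?thesis by (simp add: norm_mult)
    next
      case False
      have "norm z ^ k \<le> (1 + norm z) powr real k"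
        by (subst powr_realpow) (auto intro: power_mono add_pos_nonneg)
      then have "norm (q z) \<le> c * (1 + norm z) powr real k"
        using order_trans[OF c(2)[of z] mult_left_mono[OF _ c(1)]] by blast
      moreover have "norm (high_part K g z) \<le> C2 * B * (exp ((norm z)\<^sup>2 / 2) * (1 + norm z) powr b)"
        using C2(2) unfolding fock_growth_def by blast
      moreover have "fock_weight \<sigma> z \<le> 2 powr \<bar>\<sigma>\<bar> * (1 + norm z) powr (- \<sigma>) * exp (- (norm z)\<^sup>2)"
        using False by (intro fock_weight_far) simp
      ultimately have "norm (q z) * norm (high_part K g z) * fock_weight \<sigma> z
        \<le> (c * (1 + norm z) powr real k) * (C2 * B * (exp ((norm z)\<^sup>2 / 2) * (1 + norm z) powr b)) * (2 powr \<bar>\<sigma>\<bar> * (1 + norm z) powr (- \<sigma>) * exp (- (norm z)\<^sup>2))"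
        using c(1) C2 B by (intro mult_mono) auto
      also have "\<dots> = m * (((1 + norm z) powr real k * (1 + norm z) powr b * (1 + norm z) powr (- \<sigma>)) * (exp ((norm z)\<^sup>2 / 2) * exp (- (norm z)\<^sup>2)))"
        by (simp add: m_def mult_ac)
      also have "exp ((norm z)\<^sup>2 / 2) * exp (- (norm z)\<^sup>2) = exp (- (1/2) * (norm z)\<^sup>2)"
        by (simp flip: exp_add)
      also have "(1 + norm z) powr real k * (1 + norm z) powr b * (1 + norm z) powr (- \<sigma>) = (1 + norm z) powr (real k + b - \<sigma>)"
        by (simp flip: powr_add)
      also have "m * ((1 + norm z) powr (real k + b - \<sigma>) * exp (- (1/2) * (norm z)\<^sup>2)) \<le> D z"
        using c(1) d by (simp add: D_def V_def)
      finally show ?thesis by (simp add: norm_mult)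
    qed
    show "q (c *s z) = c ^ k * q z" for c z by (rule homogeneous_poly_scale[OF q])
    show "q \<in> borel_measurable borel" by (intro entire_measurable homogeneous_poly_entire[OF q])
  qed (simp_all add: fock_weight_rotate)
  then show ?thesis using k by (simp add: fock_form_def fock_form_integrand_eq)
qed

lemma fock_pairing_homogeneous:
  fixes q g :: "complex ^ 'n \<Rightarrow> complex"
  assumes q: "homogeneous_poly k q" and g: "entire g" "fock_growth b B g"
  shows "fock_pairing \<sigma> q g = pairing_ratio CARD('n) \<sigma> k * fock_form 0 q (homogeneous_part g k)"
proof -
  define K where "K = fock_cut CARD('n) \<sigma>"
  note eq = fock_pairing_eq(1)[OF homogeneous_poly_entire[OF q] g(1), of \<sigma>, folded K_def]
  have z: "fock_form \<tau> (\<lambda>_. 0) h = 0" for \<tau> and h :: "complex ^ 'n \<Rightarrow> complex"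
    by (simp add: fock_form_def fock_form_integrand_eq)
  show ?thesis
  proof (cases "k < K")
    case True
    then have "low_part K q = q" by (simp add: fun_eq_iff low_part_def homogeneous_part_homogeneous[OF q])
    moreover from this have "high_part K q = (\<lambda>_. 0)" by (simp add: fun_eq_iff high_part_def)
    ultimately show ?thesis
      using True fock_form_low_part[OF q g True] by (simp add: eq z pairing_ratio_def K_def)
  next
    case False
    then have "low_part K q = (\<lambda>_. 0)"
      by (auto simp: fun_eq_iff low_part_def homogeneous_part_homogeneous[OF q] intro!: sum.neutral)
    moreover from this have "high_part K q = q" by (simp add: fun_eq_iff high_part_def)
    moreover have "fock_form \<sigma> q (high_part K g) = fock_form \<sigma> q (homogeneous_part g k)"
      using False fock_form_high_part[OF q g, of \<sigma>] by (simp add: K_def)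
    moreover have "fock_form \<sigma> q (homogeneous_part g k) = fock_ratio CARD('n) \<sigma> k * fock_form 0 q (homogeneous_part g k)"
      using False by (intro fock_form_homogeneous q homogeneous_part_homogeneous_poly g fock_cut_le) (simp add: K_def)
    ultimately show ?thesis using False by (simp add: eq z pairing_ratio_def K_def)
  qed
qed

section \<open>Duality\<close>

lemma fock_form_add:
  assumes "integrable fock_volume (fock_form_integrand \<sigma> f g)" "integrable fock_volume (fock_form_integrand \<sigma> h g)"
  shows "fock_form \<sigma> (\<lambda>z. f z + h z) g = fock_form \<sigma> f g + fock_form \<sigma> h g"
proof -
  have "fock_form_integrand \<sigma> (\<lambda>z. f z + h z) g = (\<lambda>z. fock_form_integrand \<sigma> f g z + fock_form_integrand \<sigma> h g z)"
    by (simp add: fun_eq_iff fock_form_integrand_def distrib_right)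
  then show ?thesis unfolding fock_form_def by (simp only: Bochner_Integration.integral_add[OF assms])
qed

lemma fock_form_cmult: "fock_form \<sigma> (\<lambda>z. c * f z) g = c * fock_form \<sigma> f g"
proof -
  have "fock_form_integrand \<sigma> (\<lambda>z. c * f z) g = (\<lambda>z. c * fock_form_integrand \<sigma> f g z)"
    by (simp add: fun_eq_iff fock_form_integrand_def mult.assoc)
  then show ?thesis unfolding fock_form_def by (simp only: integral_mult_right_zero)
qed

lemma fock_space_zero: "0 < p \<Longrightarrow> p \<le> 1 \<Longrightarrow> (\<lambda>_. 0) \<in> fock_space p \<gamma>"
  using fock_space_sum[of p "{}"] by simp

lemma fock_norm_zero: "0 < p \<Longrightarrow> fock_norm p \<gamma> (\<lambda>_. 0) = 0"
  using fock_norm_cmult[of p \<gamma> 0 "\<lambda>_. 0"] by simp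

lemma homogeneous_part_add:
  assumes "entire f" "entire h"
  shows "homogeneous_part (\<lambda>z. f z + h z) = (\<lambda>k z. homogeneous_part f k z + homogeneous_part h k z)"
  by (intro homogeneous_part_eq homogeneous_expansion_add homogeneous_expansion_homogeneous_part assms)

lemma homogeneous_part_cmult:
  assumes "entire f"
  shows "homogeneous_part (\<lambda>z. c * f z) = (\<lambda>k z. c * homogeneous_part f k z)"
  by (intro homogeneous_part_eq homogeneous_expansion_cmult homogeneous_expansion_homogeneous_part assms)

lemma fock_pairing_bounded_functional:
  fixes p \<alpha> \<beta> :: real and g :: "complex ^ 'n \<Rightarrow> complex"
  assumes p: "0 < p" "p \<le> 1" and g: "entire g" "fock_growth \<beta> B g"
  shows "fock_bounded_functional p (\<alpha> * p) (\<lambda>f. fock_pairing (\<alpha> + \<beta>) f g)"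
proof -
  define \<sigma> where "\<sigma> = \<alpha> + \<beta>"
  define K where "K = fock_cut CARD('n) \<sigma>"
  obtain C where C: "\<And>f :: complex ^ 'n \<Rightarrow> complex. f \<in> fock_space p (\<alpha> * p) \<Longrightarrow>
    fock_pairing_well_defined \<sigma> f g \<and> norm (fock_pairing \<sigma> f g) \<le> C * fock_norm p (\<alpha> * p) f * B"
    using fock_pairing_bound[OF p, of \<alpha> \<beta>, where 'n = 'n] g unfolding \<sigma>_def by blast
  note eq = fock_pairing_eq(1)[OF fock_space_entire g(1), of _ p "\<alpha> * p" \<sigma>, folded K_def]
  have int: "integrable fock_volume (fock_form_integrand 0 (low_part K f) (low_part K g))"
    "integrable fock_volume (fock_form_integrand \<sigma> (high_part K f) (high_part K g))"
    if "f \<in> fock_space p (\<alpha> * p)" for f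
    using C[OF that] fock_pairing_eq(2)[OF fock_space_entire[OF that] g(1), of \<sigma>] by (simp_all add: K_def)
  show ?thesis
    unfolding fock_bounded_functional_def \<sigma>_def[symmetric]
  proof (intro conjI ballI allI exI)
    fix f h :: "complex ^ 'n \<Rightarrow> complex"
    assume f: "f \<in> fock_space p (\<alpha> * p)" and h: "h \<in> fock_space p (\<alpha> * p)"
    have "low_part K (\<lambda>z. f z + h z) = (\<lambda>z. low_part K f z + low_part K h z)"
      by (simp add: fun_eq_iff low_part_def homogeneous_part_add[OF fock_space_entire[OF f] fock_space_entire[OF h]] sum.distrib)
    moreover from this have "high_part K (\<lambda>z. f z + h z) = (\<lambda>z. high_part K f z + high_part K h z)"
      by (simp add: fun_eq_iff high_part_def)
    ultimately show "fock_pairing \<sigma> (\<lambda>z. f z + h z) g = fock_pairing \<sigma> f g + fock_pairing \<sigma> h g"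
      using int[OF f] int[OF h] by (simp add: eq[OF fock_space_add[OF p f h]] eq[OF f] eq[OF h] fock_form_add)
  next
    fix c and f :: "complex ^ 'n \<Rightarrow> complex"
    assume f: "f \<in> fock_space p (\<alpha> * p)"
    have "low_part K (\<lambda>z. c * f z) = (\<lambda>z. c * low_part K f z)"
      by (simp add: fun_eq_iff low_part_def homogeneous_part_cmult[OF fock_space_entire[OF f]] sum_distrib_left)
    moreover from this have "high_part K (\<lambda>z. c * f z) = (\<lambda>z. c * high_part K f z)"
      by (simp add: fun_eq_iff high_part_def right_diff_distrib)
    ultimately show "fock_pairing \<sigma> (\<lambda>z. c * f z) g = c * fock_pairing \<sigma> f g"
      by (simp add: eq[OF fock_space_cmult[OF f]] eq[OF f] fock_form_cmult distrib_left)
  next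
    fix f :: "complex ^ 'n \<Rightarrow> complex"
    assume "f \<in> fock_space p (\<alpha> * p)"
    then show "norm (fock_pairing \<sigma> f g) \<le> (C * B) * fock_norm p (\<alpha> * p) f"
      using C by (simp add: mult_ac)
  qed
qed

lemma fock_sup_space_growth:
  assumes "g \<in> fock_sup_space \<beta>" shows "entire g" "fock_growth \<beta> (fock_sup_norm \<beta> g) g"
proof -
  show "entire g" using assms by (simp add: fock_sup_space_def)
  have le: "fock_sup_quotient \<beta> g z \<le> fock_sup_norm \<beta> g" for z
    unfolding fock_sup_norm_def using assms by (intro cSUP_upper) (auto simp: fock_sup_space_def)
  have "0 \<le> fock_sup_quotient \<beta> g 0" by (simp add: fock_sup_quotient_def)
  then have "0 \<le> fock_sup_norm \<beta> g" using le order_trans by blast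
  moreover have "norm (g z) \<le> fock_sup_norm \<beta> g * (exp ((norm z)\<^sup>2 / 2) * (1 + norm z) powr \<beta>)" for z
  proof -
    have pos: "(1 + norm z) powr \<beta> > 0" by (simp add: add_nonneg_eq_0_iff)
    have "norm (g z) = fock_sup_quotient \<beta> g z * (exp ((norm z)\<^sup>2 / 2) * (1 + norm z) powr \<beta>)"
      using pos by (simp add: fock_sup_quotient_def exp_minus)
    then show ?thesis using le[of z] pos by (simp add: mult_right_mono)
  qed
  ultimately show "fock_growth \<beta> (fock_sup_norm \<beta> g) g" by (simp add: fock_growth_def)
qed

lemma fock_growth_sup_space:
  assumes "entire g" "fock_growth \<beta> A g" shows "g \<in> fock_sup_space \<beta>" "fock_sup_norm \<beta> g \<le> A"
proof -
  have le: "fock_sup_quotient \<beta> g z \<le> A" for z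
  proof -
    have pos: "(1 + norm z) powr \<beta> > 0" by (simp add: add_nonneg_eq_0_iff)
    have "norm (g z) \<le> A * (exp ((norm z)\<^sup>2 / 2) * (1 + norm z) powr \<beta>)"
      using assms(2) by (simp add: fock_growth_def)
    then have "norm (g z) * exp (- (norm z)\<^sup>2 / 2) \<le> A * (exp ((norm z)\<^sup>2 / 2) * (1 + norm z) powr \<beta>) * exp (- (norm z)\<^sup>2 / 2)"
      by (rule mult_right_mono) simp
    also have "\<dots> = A * (1 + norm z) powr \<beta>" by (simp add: exp_minus)
    finally show ?thesis using pos by (simp add: fock_sup_quotient_def divide_le_eq)
  qed
  then show "g \<in> fock_sup_space \<beta>" using assms(1) unfolding fock_sup_space_def bdd_above_def by auto
  show "fock_sup_norm \<beta> g \<le> A" unfolding fock_sup_norm_def using le by (intro cSUP_least) auto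
qed

lemma fock_functional_norm_bound:
  assumes p: "0 < p" "p \<le> 1" and \<nu>: "fock_bounded_functional p \<gamma> \<nu>"
  shows "0 \<le> fock_functional_norm p \<gamma> \<nu>"
    "f \<in> fock_space p \<gamma> \<Longrightarrow> norm (\<nu> f) \<le> fock_functional_norm p \<gamma> \<nu> * fock_norm p \<gamma> f"
proof -
  obtain B where B: "\<And>f. f \<in> fock_space p \<gamma> \<Longrightarrow> norm (\<nu> f) \<le> B * fock_norm p \<gamma> f"
    using \<nu> unfolding fock_bounded_functional_def by blast
  let ?S = "{f \<in> fock_space p \<gamma>. fock_norm p \<gamma> f \<le> 1}"
  \<comment> \<open>The constant supplied by boundedness may be negative, hence its absolute
    value.\<close>
  have "norm (\<nu> f) \<le> \<bar>B\<bar>" if "f \<in> ?S" for f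
  proof -
    have "norm (\<nu> f) \<le> B * fock_norm p \<gamma> f" using that B by blast
    also have "\<dots> \<le> \<bar>B\<bar> * 1" using that by (intro mult_mono) auto
    finally show ?thesis by simp
  qed
  then have bdd: "bdd_above ((\<lambda>f. norm (\<nu> f)) ` ?S)" by (auto simp: bdd_above_def)
  have upper: "norm (\<nu> f) \<le> fock_functional_norm p \<gamma> \<nu>" if "f \<in> ?S" for f
    unfolding fock_functional_norm_def using that bdd by (rule cSUP_upper)
  have zero: "(\<lambda>_. 0) \<in> ?S"
    using p by (simp add: fock_space_zero fock_norm_zero)
  then show "0 \<le> fock_functional_norm p \<gamma> \<nu>" using upper norm_ge_zero order_trans by blast
  assume f: "f \<in> fock_space p \<gamma>"
  define N where "N = fock_norm p \<gamma> f"
  have N: "N \<ge> 0" by (simp add: N_def)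
  show "norm (\<nu> f) \<le> fock_functional_norm p \<gamma> \<nu> * fock_norm p \<gamma> f"
  proof (cases "N = 0")
    case True
    \<comment> \<open>Rescaling to the unit ball is impossible here, but boundedness itself forces
      \<open>\<nu> f = 0\<close>.\<close>
    then show ?thesis using B[OF f] by (simp add: N_def)
  next
    case False
    then have N: "N > 0" using N by simp
    have "(\<lambda>z. of_real (1 / N) * f z) \<in> ?S"
      using N fock_space_cmult[OF f, of "of_real (1 / N)"] fock_norm_cmult[OF p(1), of \<gamma> "of_real (1 / N)" f]
      by (simp add: norm_divide flip: N_def)
    then have "norm (\<nu> (\<lambda>z. of_real (1 / N) * f z)) \<le> fock_functional_norm p \<gamma> \<nu>" by (rule upper)
    then show ?thesis
      unfolding fock_functional_cmult[OF \<nu> f] using N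
      by (simp add: norm_mult norm_divide divide_le_eq flip: N_def)
  qed
qed

lemma fock_functional_norm_le:
  fixes \<nu> :: "(complex ^ 'n \<Rightarrow> complex) \<Rightarrow> complex"
  assumes p: "0 < p" "p \<le> 1" and B: "0 \<le> B" "\<And>f. f \<in> fock_space p \<gamma> \<Longrightarrow> norm (\<nu> f) \<le> B * fock_norm p \<gamma> f"
  shows "fock_functional_norm p \<gamma> \<nu> \<le> B"
  unfolding fock_functional_norm_def
proof (rule cSUP_least)
  have "(\<lambda>_. 0) \<in> {f \<in> fock_space p \<gamma>. fock_norm p \<gamma> f \<le> 1}"
    using p by (simp add: fock_space_zero fock_norm_zero)
  then show "{f \<in> fock_space p \<gamma>. fock_norm p \<gamma> f \<le> 1} \<noteq> {}" by blast
  fix f :: "complex ^ 'n \<Rightarrow> complex" assume "f \<in> {f \<in> fock_space p \<gamma>. fock_norm p \<gamma> f \<le> 1}"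
  then have "norm (\<nu> f) \<le> B * fock_norm p \<gamma> f" "B * fock_norm p \<gamma> f \<le> B * 1"
    using B mult_left_le[of "fock_norm p \<gamma> f" B] by auto
  then show "norm (\<nu> f) \<le> B" by simp
qed

lemma fock_duality_exists:
  fixes p \<alpha> \<beta> :: real
  assumes p: "0 < p" "p \<le> 1"
  shows "\<exists>C\<ge>0. \<forall>\<nu> :: (complex ^ 'n \<Rightarrow> complex) \<Rightarrow> complex. fock_bounded_functional p (\<alpha> * p) \<nu> \<longrightarrow>
    (\<exists>g \<in> fock_sup_space \<beta>. fock_sup_norm \<beta> g \<le> C * fock_functional_norm p (\<alpha> * p) \<nu> \<and>
      (\<forall>f \<in> fock_space p (\<alpha> * p). \<nu> f = fock_pairing (\<alpha> + \<beta>) f g))"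
proof -
  obtain C1 where C1: "C1 \<ge> 0" "\<And>(\<nu> :: (complex ^ 'n \<Rightarrow> complex) \<Rightarrow> complex) B. fock_bounded_functional p (\<alpha> * p) \<nu> \<Longrightarrow> 0 \<le> B \<Longrightarrow>
     (\<And>f. f \<in> fock_space p (\<alpha> * p) \<Longrightarrow> norm (\<nu> f) \<le> B * fock_norm p (\<alpha> * p) f) \<Longrightarrow>
     (\<exists>G. entire G \<and> fock_growth (- \<alpha>) (C1 * B) G \<and> (\<forall>k q. homogeneous_poly k q \<longrightarrow> \<nu> q = fock_form 0 q (homogeneous_part G k)))"
    using fock_functional_transform[OF p, of \<alpha>, where 'n = 'n] by blast
  obtain C2 where C2: "C2 \<ge> 0" "\<And>(G :: complex ^ 'n \<Rightarrow> complex) A. entire G \<Longrightarrow> fock_growth (- \<alpha>) A G \<Longrightarrow>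
    (\<exists>g. entire g \<and> fock_growth \<beta> (C2 * A) g \<and>
      (\<forall>k z. of_real (pairing_ratio CARD('n) (\<alpha> + \<beta>) k) * homogeneous_part g k z = homogeneous_part G k z))"
    using fock_growth_inverse_ratio[of \<alpha> \<beta>, where 'n = 'n] by blast
  have "\<exists>g \<in> fock_sup_space \<beta>. fock_sup_norm \<beta> g \<le> (C2 * C1) * fock_functional_norm p (\<alpha> * p) \<nu> \<and>
      (\<forall>f \<in> fock_space p (\<alpha> * p). \<nu> f = fock_pairing (\<alpha> + \<beta>) f g)"
    if \<nu>: "fock_bounded_functional p (\<alpha> * p) \<nu>" for \<nu> :: "(complex ^ 'n \<Rightarrow> complex) \<Rightarrow> complex"
  proof -
    define B where "B = fock_functional_norm p (\<alpha> * p) \<nu>"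
    obtain G where G: "entire G" "fock_growth (- \<alpha>) (C1 * B) G"
      "\<And>k q. homogeneous_poly k q \<Longrightarrow> \<nu> q = fock_form 0 q (homogeneous_part G k)"
      using C1(2)[OF \<nu> fock_functional_norm_bound[OF p \<nu>]] unfolding B_def by blast
    obtain g where g: "entire g" "fock_growth \<beta> (C2 * (C1 * B)) g"
      "\<And>k z. of_real (pairing_ratio CARD('n) (\<alpha> + \<beta>) k) * homogeneous_part g k z = homogeneous_part G k z"
      using C2(2)[OF G(1,2)] by blast
    note \<mu> = fock_pairing_bounded_functional[OF p g(1,2), of \<alpha>]
    have "\<nu> q = fock_pairing (\<alpha> + \<beta>) q g" if q: "homogeneous_poly k q" for k q
    proof -
      have "\<nu> q = fock_form 0 q (homogeneous_part G k)" by (rule G(3)[OF q])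
      also have "\<dots> = (LINT z|fock_volume. of_real (pairing_ratio CARD('n) (\<alpha> + \<beta>) k) * fock_form_integrand 0 q (homogeneous_part g k) z)"
        unfolding fock_form_def fock_form_integrand_eq g(3)[symmetric] by (simp add: mult_ac)
      also have "\<dots> = pairing_ratio CARD('n) (\<alpha> + \<beta>) k * fock_form 0 q (homogeneous_part g k)"
        unfolding fock_form_def by (rule integral_mult_right_zero)
      also have "\<dots> = fock_pairing (\<alpha> + \<beta>) q g" by (rule fock_pairing_homogeneous[OF q g(1,2), symmetric])
      finally show ?thesis .
    qed
    then have "\<nu> f = fock_pairing (\<alpha> + \<beta>) f g" if "f \<in> fock_space p (\<alpha> * p)" for f
      using fock_functional_eqI[OF p \<nu> \<mu> _ that] by blast
    then show ?thesis
      using fock_growth_sup_space[OF g(1,2)] unfolding B_def by (intro bexI[of _ g]) (auto simp: mult.assoc)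
  qed
  then show ?thesis using C1(1) C2(1) by (intro exI[of _ "C2 * C1"]) auto
qed

text \<open>Testing against the homogeneous polynomial \<open>q = homogeneous_part g k - homogeneous_part g' k\<close> gives
  \<open>fock_form 0 q q = 0\<close>, and \<open>q = 0\<close> follows by the reproducing formula.\<close>

lemma fock_duality_unique:
  fixes p \<alpha> \<beta> :: real and g g' :: "complex ^ 'n \<Rightarrow> complex"
  assumes p: "0 < p" and g: "g \<in> fock_sup_space \<beta>" and g': "g' \<in> fock_sup_space \<beta>"
    and eq: "\<And>f. f \<in> fock_space p (\<alpha> * p) \<Longrightarrow> fock_pairing (\<alpha> + \<beta>) f g = fock_pairing (\<alpha> + \<beta>) f g'"
  shows "g = g'"
proof -
  note G = fock_sup_space_growth[OF g] and G' = fock_sup_space_growth[OF g']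
  have "homogeneous_part g k z = homogeneous_part g' k z" for k z
  proof -
    define q where "q z = homogeneous_part g k z - homogeneous_part g' k z" for z
    have q: "homogeneous_poly k q"
      using homogeneous_poly_add[OF homogeneous_part_homogeneous_poly[OF G(1)] homogeneous_poly_cmult[OF homogeneous_part_homogeneous_poly[OF G'(1)], of k "-1"]]
      unfolding q_def[abs_def] by simp
    have [measurable]: "q \<in> borel_measurable borel" by (intro entire_measurable homogeneous_poly_entire[OF q])
    \<comment> \<open>Positivity allows the multiplier to be cancelled, which brings the comparison
      back to the unweighted form, where testing with \<open>q\<close> itself is an integral of
      \<open>norm (q z) ^ 2\<close>.\<close>
    have "pairing_ratio CARD('n) (\<alpha> + \<beta>) k > 0" by (rule pairing_ratio_pos) simp
    then have "fock_form 0 q (homogeneous_part g k) = fock_form 0 q (homogeneous_part g' k)"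
      using eq[OF homogeneous_poly_fock_space[OF p q]]
      unfolding fock_pairing_homogeneous[OF q G] fock_pairing_homogeneous[OF q G'] by simp
    moreover have int: "integrable fock_volume (fock_form_integrand 0 q h)" if "homogeneous_poly k h" for h
      using that by (intro fock_form_homogeneous(1)[OF q]) (simp_all add: add_pos_nonneg)
    ultimately have "(LINT z|fock_volume. fock_form_integrand 0 q (homogeneous_part g k) z - fock_form_integrand 0 q (homogeneous_part g' k) z) = 0"
      by (subst Bochner_Integration.integral_diff)
         (auto simp: fock_form_def intro!: int homogeneous_part_homogeneous_poly G(1) G'(1))
    also have "(\<lambda>z. fock_form_integrand 0 q (homogeneous_part g k) z - fock_form_integrand 0 q (homogeneous_part g' k) z)
      = (\<lambda>z. complex_of_real ((norm (q z))\<^sup>2 * fock_weight 0 z))"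
    proof
      fix w
      have "fock_form_integrand 0 q (homogeneous_part g k) w - fock_form_integrand 0 q (homogeneous_part g' k) w = (q w * cnj (q w)) * fock_weight 0 w"
        by (simp add: fock_form_integrand_eq q_def algebra_simps)
      then show "fock_form_integrand 0 q (homogeneous_part g k) w - fock_form_integrand 0 q (homogeneous_part g' k) w
        = complex_of_real ((norm (q w))\<^sup>2 * fock_weight 0 w)"
        by (simp only: of_real_mult complex_norm_square)
    qed
    finally have 0: "(LINT z|fock_volume. (norm (q z))\<^sup>2 * fock_weight 0 z) = 0"
      by (simp only: integral_complex_of_real of_real_eq_0_iff)
    have "fock_form_integrand 0 q q = (\<lambda>z. complex_of_real ((norm (q z))\<^sup>2 * fock_weight 0 z))"
      by (simp only: fun_eq_iff fock_form_integrand_eq of_real_mult complex_norm_square simp_thms)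
    then have "integrable fock_volume (\<lambda>z. complex_of_real ((norm (q z))\<^sup>2 * fock_weight 0 z))"
      using int[OF q] by simp
    then have "integrable fock_volume (\<lambda>z. (norm (q z))\<^sup>2 * fock_weight 0 z)"
      using integrable_Re by fastforce
    then have "AE z in fock_volume. (norm (q z))\<^sup>2 * fock_weight 0 z = 0"
      using 0 by (subst (asm) integral_nonneg_eq_0_iff_AE) auto
    then have ae: "AE z in fock_volume. q z = 0"
      using AE_fock_volume_neq_0 by eventually_elim (simp add: fock_weight_def)
    have "q z = (LINT w|fock_volume. q w * cnj (exp (herm w z)) * fock_weight 0 w)"
      by (rule reproducing_formula[OF q, symmetric])
    also have "\<dots> = 0"
      using ae by (intro integral_eq_zero_AE) (auto elim: eventually_mono)
    finally show ?thesis by (simp add: q_def)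
  qed
  then show ?thesis
    using homogeneous_part_sums[OF G(1)] homogeneous_part_sums[OF G'(1)] sums_unique2 by (metis ext)
qed

theorem theorem5p7:
  fixes p \<alpha> \<beta> :: real
  assumes "0 < p" and "p \<le> 1"
  shows
    "(\<forall>g \<in> (fock_sup_space \<beta> :: (complex ^ 'n \<Rightarrow> complex) set).
        (\<forall>f \<in> fock_space p (\<alpha> * p). fock_pairing_well_defined (\<alpha> + \<beta>) f g) \<and>
        fock_bounded_functional p (\<alpha> * p) (\<lambda>f. fock_pairing (\<alpha> + \<beta>) f g)) \<and>
     (\<forall>\<nu> :: (complex ^ 'n \<Rightarrow> complex) \<Rightarrow> complex. fock_bounded_functional p (\<alpha> * p) \<nu> \<longrightarrow>
        (\<exists>!g. g \<in> fock_sup_space \<beta> \<and>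
              (\<forall>f \<in> fock_space p (\<alpha> * p). \<nu> f = fock_pairing (\<alpha> + \<beta>) f g))) \<and>
     (\<exists>c > 0. \<exists>C > 0. \<forall>g \<in> (fock_sup_space \<beta> :: (complex ^ 'n \<Rightarrow> complex) set).
        c * fock_sup_norm \<beta> g
          \<le> fock_functional_norm p (\<alpha> * p) (\<lambda>f. fock_pairing (\<alpha> + \<beta>) f g) \<and>
        fock_functional_norm p (\<alpha> * p) (\<lambda>f. fock_pairing (\<alpha> + \<beta>) f g)
          \<le> C * fock_sup_norm \<beta> g)"
proof (intro conjI)
  note p = assms
  obtain C1 where C1: "C1 \<ge> 0" "\<And>(f :: complex ^ 'n \<Rightarrow> complex) g B. f \<in> fock_space p (\<alpha> * p) \<Longrightarrow> entire g \<Longrightarrow> fock_growth \<beta> B g \<Longrightarrow>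
    fock_pairing_well_defined (\<alpha> + \<beta>) f g \<and> norm (fock_pairing (\<alpha> + \<beta>) f g) \<le> C1 * fock_norm p (\<alpha> * p) f * B"
    using fock_pairing_bound[OF p, of \<alpha> \<beta>, where 'n = 'n] by blast
  obtain C2 where C2: "C2 \<ge> 0" "\<And>\<nu> :: (complex ^ 'n \<Rightarrow> complex) \<Rightarrow> complex. fock_bounded_functional p (\<alpha> * p) \<nu> \<Longrightarrow>
    (\<exists>g \<in> fock_sup_space \<beta>. fock_sup_norm \<beta> g \<le> C2 * fock_functional_norm p (\<alpha> * p) \<nu> \<and>
      (\<forall>f \<in> fock_space p (\<alpha> * p). \<nu> f = fock_pairing (\<alpha> + \<beta>) f g))"
    using fock_duality_exists[OF p, of \<alpha> \<beta>, where 'n = 'n] by blast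
  have bounded: "fock_bounded_functional p (\<alpha> * p) (\<lambda>f. fock_pairing (\<alpha> + \<beta>) f g)"
    if "g \<in> fock_sup_space \<beta>" for g :: "complex ^ 'n \<Rightarrow> complex"
    using fock_pairing_bounded_functional[OF p fock_sup_space_growth[OF that]] .
  show "\<forall>g \<in> (fock_sup_space \<beta> :: (complex ^ 'n \<Rightarrow> complex) set).
        (\<forall>f \<in> fock_space p (\<alpha> * p). fock_pairing_well_defined (\<alpha> + \<beta>) f g) \<and>
        fock_bounded_functional p (\<alpha> * p) (\<lambda>f. fock_pairing (\<alpha> + \<beta>) f g)"
    using C1(2)[OF _ fock_sup_space_growth] bounded by blast
  show "\<forall>\<nu> :: (complex ^ 'n \<Rightarrow> complex) \<Rightarrow> complex. fock_bounded_functional p (\<alpha> * p) \<nu> \<longrightarrow>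
        (\<exists>!g. g \<in> fock_sup_space \<beta> \<and>
              (\<forall>f \<in> fock_space p (\<alpha> * p). \<nu> f = fock_pairing (\<alpha> + \<beta>) f g))"
  proof (intro allI impI)
    fix \<nu> :: "(complex ^ 'n \<Rightarrow> complex) \<Rightarrow> complex"
    assume \<nu>: "fock_bounded_functional p (\<alpha> * p) \<nu>"
    obtain g where g: "g \<in> fock_sup_space \<beta>" "\<And>f. f \<in> fock_space p (\<alpha> * p) \<Longrightarrow> \<nu> f = fock_pairing (\<alpha> + \<beta>) f g"
      using C2(2)[OF \<nu>] by blast
    show "\<exists>!g. g \<in> fock_sup_space \<beta> \<and> (\<forall>f \<in> fock_space p (\<alpha> * p). \<nu> f = fock_pairing (\<alpha> + \<beta>) f g)"
    proof (rule ex1I[of _ g])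
      show "g' = g" if g': "g' \<in> fock_sup_space \<beta> \<and> (\<forall>f \<in> fock_space p (\<alpha> * p). \<nu> f = fock_pairing (\<alpha> + \<beta>) f g')" for g'
      proof (rule fock_duality_unique[OF p(1)])
        show "fock_pairing (\<alpha> + \<beta>) f g' = fock_pairing (\<alpha> + \<beta>) f g" if "f \<in> fock_space p (\<alpha> * p)" for f
          using g(2)[OF that] g' that by simp
      qed (use g g' in auto)
    qed (use g in auto)
  qed
  \<comment> \<open>Adding 1 makes both constants positive even if \<open>C1\<close> or
    \<open>C2\<close> is 0.\<close>
  have lower: "1 / (C2 + 1) * fock_sup_norm \<beta> g \<le> fock_functional_norm p (\<alpha> * p) (\<lambda>f. fock_pairing (\<alpha> + \<beta>) f g)"
    and upper: "fock_functional_norm p (\<alpha> * p) (\<lambda>f. fock_pairing (\<alpha> + \<beta>) f g) \<le> (C1 + 1) * fock_sup_norm \<beta> g"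
    if g: "g \<in> fock_sup_space \<beta>" for g :: "complex ^ 'n \<Rightarrow> complex"
  proof -
    let ?\<nu> = "\<lambda>f. fock_pairing (\<alpha> + \<beta>) f g"
    note G = fock_sup_space_growth[OF g]
    have S: "0 \<le> fock_sup_norm \<beta> g" using G(2) by (simp add: fock_growth_def)
    have N: "0 \<le> fock_functional_norm p (\<alpha> * p) ?\<nu>"
      by (rule fock_functional_norm_bound(1)[OF p bounded[OF g]])
    obtain g' where g': "g' \<in> fock_sup_space \<beta>" "fock_sup_norm \<beta> g' \<le> C2 * fock_functional_norm p (\<alpha> * p) ?\<nu>"
      "\<And>f. f \<in> fock_space p (\<alpha> * p) \<Longrightarrow> ?\<nu> f = fock_pairing (\<alpha> + \<beta>) f g'"
      using C2(2)[OF bounded[OF g]] by blast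
    \<comment> \<open>The existence result applied to the pairing with \<open>g\<close> itself
      returns some \<open>g'\<close> whose norm is controlled by the functional norm; uniqueness
      transfers this control to \<open>g\<close>, so the lower estimate comes without an open
      mapping argument.\<close>
    have "g = g'" by (rule fock_duality_unique[OF p(1) g g'(1,3)])
    then have "fock_sup_norm \<beta> g \<le> (C2 + 1) * fock_functional_norm p (\<alpha> * p) ?\<nu>"
      using g'(2) N by (simp add: distrib_right)
    then show "1 / (C2 + 1) * fock_sup_norm \<beta> g \<le> fock_functional_norm p (\<alpha> * p) ?\<nu>"
      using C2(1) by (simp add: divide_le_eq mult.commute)
    show "fock_functional_norm p (\<alpha> * p) ?\<nu> \<le> (C1 + 1) * fock_sup_norm \<beta> g"
    proof (rule fock_functional_norm_le[OF p])
      show "0 \<le> (C1 + 1) * fock_sup_norm \<beta> g" using C1(1) S by simp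
      fix f :: "complex ^ 'n \<Rightarrow> complex" assume "f \<in> fock_space p (\<alpha> * p)"
      then have "norm (?\<nu> f) \<le> C1 * fock_norm p (\<alpha> * p) f * fock_sup_norm \<beta> g" using C1(2) G by blast
      also have "\<dots> \<le> (C1 + 1) * fock_sup_norm \<beta> g * fock_norm p (\<alpha> * p) f"
        using S by (simp add: algebra_simps)
      finally show "norm (?\<nu> f) \<le> (C1 + 1) * fock_sup_norm \<beta> g * fock_norm p (\<alpha> * p) f" .
    qed
  qed
  show "\<exists>c > 0. \<exists>C > 0. \<forall>g \<in> (fock_sup_space \<beta> :: (complex ^ 'n \<Rightarrow> complex) set).
        c * fock_sup_norm \<beta> g
          \<le> fock_functional_norm p (\<alpha> * p) (\<lambda>f. fock_pairing (\<alpha> + \<beta>) f g) \<and>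
        fock_functional_norm p (\<alpha> * p) (\<lambda>f. fock_pairing (\<alpha> + \<beta>) f g)
          \<le> C * fock_sup_norm \<beta> g"
    using lower upper C1(1) C2(1) by (intro exI[of _ "1 / (C2 + 1)"] exI[of _ "C1 + 1"] conjI) auto
qed

end
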